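(* Let $\zeta_x:=\xi_x$, $x\in\mathcal S$, such that $\mathcal F=\mathcal G$. The processes $V_j=(V_j(t))_{t\ge0}$, $j\in S$, defined by $$V_j(t):=\begin{cases}\sum_{n=0}^\infty\mathbf 1_{\{J^j_t=n\}}\mathcal V_{(j,n)}(t)&\text{if } t>0,\ Z_{t-}=j,\text{ or } t=0,\\ V_{kj}(t)&\text{if } t>0,\ Z_{t-}=k\neq j,\end{cases}$$ are state-wise prospective reserves. Moreover, $$V_j(t)=I_j(t-)\,V_{jj}(t)+\sum_{k:k\ne j}I_k(t-)\,V_{kj}(t),\quad j\in S,\ t>0,$$ almost surely.
   Context: **Information.** Let $(\Omega,\mathbb F,P)$ be a complete probability space with null sets $\mathcal A$, and let $Z=(Z_t)_{t\ge0}$ be a pure jump process (right-continuous, piecewise constant) on a countable state space $S$. Processes are defined only up to evanescence. Put $I_j(t)=\mathbf 1_{\{Z_t=j\}}$ and, for $j\ne k$, $N_{jk}(t)=\#\{s\in(0,t]:Z_{s-}=j,Z_s=k\}$, $N_{jk}(0-)=0$. Standing assumption: $\mathrm E[\sum_{j\ne k}N_{jk}(t)]<\infty$ for all $t\ge0$. Let $\mathcal F_t=\sigma(Z_s:s\le t)\vee\mathcal A$. Let $J^j_t=\sum_{k\ne j}N_{jk}(t-)$, $J_t=\sum_{j}I_j(t)J^j_t$, $\mathcal Z=(Z,J)$ with state space $\mathcal S=S\times\mathbb N_0$ (each state of $\mathcal S$ is visited at most once). For $x\in\mathcal S$: $T_x=\inf\{t\ge0:\mathcal Z_t=x\}$ ($\inf\emptyset=\infty$),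 $\mathcal I_x(t)=\mathbf 1_{\{\mathcal Z_t=x\}}$, $\xi_x=(T_y\mathbf 1_{\{T_y\le T_x\}})_{y\in\mathcal S}$. In general, information is described by random variables $\zeta_x$, $x\in\mathcal S$, with values in a separable completely metrizable space and $\sigma(\zeta_x)\subseteq\sigma(\xi_x)$, through $\mathcal G_t=\sigma(\mathcal Z_t,\zeta_{\mathcal Z_t})\vee\mathcal A$, $\mathcal G_{t-}=\sigma(\mathcal Z_{t-},\zeta_{\mathcal Z_{t-}})\vee\mathcal A$, where $\zeta_{\mathcal Z_t}=\sum_x\mathcal I_x(t)\zeta_x$. **Payments.** $B(\mathrm dt)=\sum_{j}I_j(t-)b_j(t)\beta(\mathrm dt)+\sum_{j\ne k}b_{jk}(t)N_{jk}(\mathrm dt)$ with $\mathcal F$-predictable bounded $b_j,b_{jk}$, and $\beta=m+\sum_{n\ge1}\varepsilon_{t_n}$, where $m$ is Lebesgue measure, $\varepsilon_s$ is Dirac measure at $s$, and $0\le t_1<t_2<\dots$ are deterministic and increase to infinity. $\kappa:[0,\infty)\to(0,\infty)$ is deterministic, measurable, càdlàg, bounded away from zero, of finite variation on compacts, $\kappa(0)=1$. $Y(t)=\int_{(t,\infty)}\frac{\kappa(t)}{\kappa(s)}B(\mathrm ds)$ is assumed to have finite expected variation on compacts. The prospective reserve $V$ is the (unique up to evanescence) optional projection of $Y$ with respect to $\mathcal G$, i.e. the càdlàg finite variation process with $V(t)=\mathrm E[Y(t)|\mathcal G_t]$ almost surely for each $t\ge0$. A finite variation process is an adapted process with càdlàg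 paths of finite variation on compacts. **Conventions.** $0/0:=0$. Conditional expectations with conditions such as $T_y=t$ are factorized conditional expectations evaluated at these values; a conditioning variable written without a value (such as $\zeta_x$) is evaluated at that random variable. Since conditioning variables do not depend on time, the quantities below are well-defined processes. **State-wise quantities.** $\mathcal V_x(t)=\frac{\mathrm E[\mathcal I_x(t)Y(t)|\zeta_x]}{\mathrm E[\mathcal I_x(t)|\zeta_x]}$; for $x\neq y$ and $t>0$, $\mathcal V_{xx}(t)=\frac{\mathrm E[\mathcal I_x(t-)\mathcal I_x(t)Y(t)|\zeta_x]}{\mathrm E[\mathcal I_x(t-)\mathcal I_x(t)|\zeta_x]}$, $\mathcal V_{xy}(t)=\frac{\mathrm E[\mathcal I_x(T_y-)Y(T_y)|\zeta_x,T_y=t]}{\mathrm E[\mathcal I_x(T_y-)|\zeta_x,T_y=t]}$; for $k\neq j$ in $S$, $V_{jj}(t)=\sum_{l}\mathbf 1_{\{J^j_{t-}=l\}}\mathcal V_{(j,l)(j,l)}(t)$, $V_{kj}(t)=\sum_{l,n=0}^\infty\mathbf 1_{\{J^k_{t-}=l\}}\mathbf 1_{\{J^j_t=n\}}\mathcal V_{(k,l)(j,n)}(t)$. **Definition.** $(V_j(t))_{t\ge0,j\in S}$ are called *state-wise prospective reserves* if for each $j\in S$: (1) $I_j(t)V_j(t)=I_j(t)V(t)$ almost surely for each $t\ge0$; (2) $I_j(t-)V_j(t)$ is $\mathcal G_{t-}$-measurable for each $t>0$; (3) the mapping $t\mapsto\int_{(0,t]}I_j(s-)V_j(\mathrm ds)$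 defines a finite variation process. *)

theory Defs
  imports "HOL-Probability.Probability"
begin

section \<open>Paths\<close>

text \<open>Time is \<open>[0,\<infinity>)\<close>, embedded in \<^typ>\<open>real\<close>; values of a path at negative arguments are never used.
  In particular \<open>f(0-) = f(0)\<close>, which gives \<open>N\<^sub>j\<^sub>k(0-) = 0\<close> for the jump counting processes.\<close>

definition left_lim :: "(real \<Rightarrow> 'b::t2_space) \<Rightarrow> real \<Rightarrow> 'b" where
  "left_lim f t = (if t \<le> 0 then f 0 else Lim (at_left t) f)"

definition cadlag :: "(real \<Rightarrow> 'b::t2_space) \<Rightarrow> bool" where
  "cadlag f \<longleftrightarrow> (\<forall>t\<ge>0. continuous (at_right t) f) \<and> (\<forall>t>0. \<exists>l. (f \<longlongrightarrow> l) (at_left t))"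

definition variation :: "(real \<Rightarrow> real) \<Rightarrow> real \<Rightarrow> real \<Rightarrow> ennreal" where
  "variation f a b =
     (\<Squnion>xs\<in>{xs. sorted xs \<and> set xs \<subseteq> {a..b}}. \<Sum>i<length xs - 1. ennreal \<bar>f (xs ! Suc i) - f (xs ! i)\<bar>)"

definition finite_variation_on_compacts :: "(real \<Rightarrow> real) \<Rightarrow> bool" where
  "finite_variation_on_compacts f \<longleftrightarrow> (\<forall>t\<ge>0. variation f 0 t < \<infinity>)"

text \<open>\<open>F\<close> is an arbitrary family of sub-sigma-algebras, not necessarily increasing.\<close>

definition finite_variation_process ::
  "'a measure \<Rightarrow> (real \<Rightarrow> 'a measure) \<Rightarrow> (real \<Rightarrow> 'a \<Rightarrow> real) \<Rightarrow> bool" where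
  "finite_variation_process M F X \<longleftrightarrow>
     (\<forall>t\<ge>0. X t \<in> borel_measurable (F t)) \<and>
     (AE \<omega> in M. cadlag (\<lambda>t. X t \<omega>) \<and> finite_variation_on_compacts (\<lambda>t. X t \<omega>))"


section \<open>The jump process and the information\<close>

text \<open>The state space carries the discrete topology, so a path is right-continuous with left limits
  iff it is right-continuous and piecewise constant with finitely many jumps on compacts.\<close>

definition pure_jump_process ::
  "'a measure \<Rightarrow> (real \<Rightarrow> 'a \<Rightarrow> 's::{countable,discrete_topology}) \<Rightarrow> bool" where
  "pure_jump_process M Z \<longleftrightarrow>
     (\<forall>t\<ge>0. Z t \<in> measurable M (count_space UNIV)) \<and> (\<forall>\<omega>\<in>space M. cadlag (\<lambda>t. Z t \<omega>))"

definition Z_left :: "(real \<Rightarrow> 'a \<Rightarrow> 's::{countable,discrete_topology}) \<Rightarrow> real \<Rightarrow> 'a \<Rightarrow> 's" where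
  "Z_left Z t \<omega> = left_lim (\<lambda>s. Z s \<omega>) t"

definition jump_times ::
  "(real \<Rightarrow> 'a \<Rightarrow> 's::{countable,discrete_topology}) \<Rightarrow> 's \<Rightarrow> 's \<Rightarrow> 'a \<Rightarrow> real set" where
  "jump_times Z j k \<omega> = {s. 0 < s \<and> Z_left Z s \<omega> = j \<and> Z s \<omega> = k}"

definition jump_count ::
  "(real \<Rightarrow> 'a \<Rightarrow> 's::{countable,discrete_topology}) \<Rightarrow> 's \<Rightarrow> 's \<Rightarrow> real \<Rightarrow> 'a \<Rightarrow> nat" where
  "jump_count Z j k t \<omega> = card (jump_times Z j k \<omega> \<inter> {0<..t})"

text \<open>\<open>exits Z j t\<close> is \<open>J\<^sup>j\<^sub>t\<close>, \<open>exits_cur\<close> is \<open>J\<^sub>t\<close>, and \<open>ZJ\<close> is the process \<open>(Z,J)\<close>.\<close>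

definition exits :: "(real \<Rightarrow> 'a \<Rightarrow> 's::{countable,discrete_topology}) \<Rightarrow> 's \<Rightarrow> real \<Rightarrow> 'a \<Rightarrow> nat" where
  "exits Z j t \<omega> = (\<Sum>\<^sub>\<infinity>k\<in>-{j}. left_lim (\<lambda>s. jump_count Z j k s \<omega>) t)"

definition exits_cur :: "(real \<Rightarrow> 'a \<Rightarrow> 's::{countable,discrete_topology}) \<Rightarrow> real \<Rightarrow> 'a \<Rightarrow> nat" where
  "exits_cur Z t \<omega> = (\<Sum>\<^sub>\<infinity>j. of_bool (Z t \<omega> = j) * exits Z j t \<omega>)"

definition ZJ :: "(real \<Rightarrow> 'a \<Rightarrow> 's::{countable,discrete_topology}) \<Rightarrow> real \<Rightarrow> 'a \<Rightarrow> 's \<times> nat" where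
  "ZJ Z t \<omega> = (Z t \<omega>, exits_cur Z t \<omega>)"

definition ZJ_left :: "(real \<Rightarrow> 'a \<Rightarrow> 's::{countable,discrete_topology}) \<Rightarrow> real \<Rightarrow> 'a \<Rightarrow> 's \<times> nat" where
  "ZJ_left Z t \<omega> = left_lim (\<lambda>s. ZJ Z s \<omega>) t"

definition entry_time ::
  "(real \<Rightarrow> 'a \<Rightarrow> 's::{countable,discrete_topology}) \<Rightarrow> 's \<times> nat \<Rightarrow> 'a \<Rightarrow> ereal" where
  "entry_time Z x \<omega> = (INF t\<in>{t. 0 \<le> t \<and> ZJ Z t \<omega> = x}. ereal t)"

text \<open>\<open>full_info\<close> is \<open>\<xi>\<^sub>x\<close>; it takes values in a countable power of the extended real line, with the
  product topology.\<close>

definition full_info ::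
  "(real \<Rightarrow> 'a \<Rightarrow> 's::{countable,discrete_topology}) \<Rightarrow> 's \<times> nat \<Rightarrow> 'a \<Rightarrow> ('s \<times> nat \<Rightarrow> ereal)" where
  "full_info Z x \<omega> =
     (\<lambda>y. entry_time Z y \<omega> * of_bool (entry_time Z y \<omega> \<le> entry_time Z x \<omega>))"

definition natural_filtration ::
  "'a measure \<Rightarrow> (real \<Rightarrow> 'a \<Rightarrow> 's::{countable,discrete_topology}) \<Rightarrow> real \<Rightarrow> 'a measure" where
  "natural_filtration M Z t =
     sigma (space M) ({Z s -` {j} \<inter> space M |s j. 0 \<le> s \<and> s \<le> t} \<union> null_sets M)"

definition sigma_gen_null :: "'a measure \<Rightarrow> ('a \<Rightarrow> 'c) \<Rightarrow> 'c measure \<Rightarrow> 'a measure" where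
  "sigma_gen_null M U N = sigma (space M) (sets (vimage_algebra (space M) U N) \<union> null_sets M)"

text \<open>The information families \<open>\<G>\<^sub>t\<close> and \<open>\<G>\<^sub>t\<^sub>-\<close> belonging to \<open>\<zeta>\<close>. Instead of the sum of the
  \<open>\<I>\<^sub>x(t) \<zeta>\<^sub>x\<close>, in which exactly one term is present, the random variable \<open>\<zeta>\<^sub>x\<close> is selected at the
  current value of the process; this makes sense without a linear structure on the range.\<close>

definition info_family ::
  "'a measure \<Rightarrow> (real \<Rightarrow> 'a \<Rightarrow> 's::{countable,discrete_topology}) \<Rightarrow>
   ('s \<times> nat \<Rightarrow> 'a \<Rightarrow> 'b::topological_space) \<Rightarrow> real \<Rightarrow> 'a measure" where
  "info_family M Z \<zeta> t =
     sigma_gen_null M (\<lambda>\<omega>. (ZJ Z t \<omega>, \<zeta> (ZJ Z t \<omega>) \<omega>)) (count_space UNIV \<Otimes>\<^sub>M borel)"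

definition info_family_left ::
  "'a measure \<Rightarrow> (real \<Rightarrow> 'a \<Rightarrow> 's::{countable,discrete_topology}) \<Rightarrow>
   ('s \<times> nat \<Rightarrow> 'a \<Rightarrow> 'b::topological_space) \<Rightarrow> real \<Rightarrow> 'a measure" where
  "info_family_left M Z \<zeta> t =
     sigma_gen_null M (\<lambda>\<omega>. (ZJ_left Z t \<omega>, \<zeta> (ZJ_left Z t \<omega>) \<omega>)) (count_space UNIV \<Otimes>\<^sub>M borel)"


section \<open>Payments\<close>

definition predictable_sigma :: "'a measure \<Rightarrow> (real \<Rightarrow> 'a measure) \<Rightarrow> (real \<times> 'a) measure" where
  "predictable_sigma M F = sigma ({0..} \<times> space M)
     ({{0} \<times> A |A. A \<in> sets (F 0)} \<union> {{s<..t} \<times> A |s t A. 0 \<le> s \<and> s \<le> t \<and> A \<in> sets (F s)})"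

definition predictable_bounded ::
  "'a measure \<Rightarrow> (real \<Rightarrow> 'a measure) \<Rightarrow> (real \<Rightarrow> 'a \<Rightarrow> real) \<Rightarrow> bool" where
  "predictable_bounded M F X \<longleftrightarrow>
     (\<lambda>(t, \<omega>). X t \<omega>) \<in> borel_measurable (predictable_sigma M F) \<and>
     (\<exists>C. \<forall>t\<ge>0. \<forall>\<omega>\<in>space M. \<bar>X t \<omega>\<bar> \<le> C)"

text \<open>Lebesgue measure on \<open>[0,\<infinity>)\<close> plus unit masses at the points \<open>\<tau> 0 < \<tau> 1 < \<dots>\<close>\<close>

definition pay_measure :: "(nat \<Rightarrow> real) \<Rightarrow> real measure" where
  "pay_measure \<tau> = measure_of UNIV (sets borel)
     (\<lambda>A. emeasure lborel (A \<inter> {0..}) + (\<Sum>n. indicator A (\<tau> n)))"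

lemma sets_pay_measure [simp, measurable_cong]: "sets (pay_measure \<tau>) = sets borel"
  by (simp add: pay_measure_def sigma_algebra.sets_measure_of_eq sets.sigma_algebra_axioms
      flip: space_borel)

lemma emeasure_pay_measure:
  assumes "A \<in> sets borel"
  shows "emeasure (pay_measure \<tau>) A = emeasure lborel (A \<inter> {0..}) + (\<Sum>n. indicator A (\<tau> n))"
proof (rule emeasure_measure_of[OF pay_measure_def])
  let ?\<mu> = "\<lambda>A. emeasure lborel (A \<inter> {0..}) + (\<Sum>n. indicator A (\<tau> n)) :: ennreal"
  show "positive (sets (pay_measure \<tau>)) ?\<mu>"
    by (simp add: positive_def)
  show "countably_additive (sets (pay_measure \<tau>)) ?\<mu>"
  proof (rule countably_additiveI)
    fix A :: "nat \<Rightarrow> real set"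
    assume A: "range A \<subseteq> sets (pay_measure \<tau>)" and d: "disjoint_family A"
    have "(\<Sum>i. emeasure lborel (A i \<inter> {0..})) = emeasure lborel (\<Union>i. A i \<inter> {0..})"
      using A d by (intro suminf_emeasure) (auto simp: disjoint_family_on_def)
    moreover have "(\<Sum>i. \<Sum>n. indicator (A i) (\<tau> n)) = (\<Sum>n. indicator (\<Union>i. A i) (\<tau> n) :: ennreal)"
    proof -
      have "(\<Sum>i. \<Sum>n. indicator (A i) (\<tau> n) :: ennreal) =
          (\<Sum>i. \<integral>\<^sup>+n. indicator (A i) (\<tau> n) \<partial>count_space UNIV)"
        by (simp add: nn_integral_count_space_nat)
      also have "\<dots> = (\<integral>\<^sup>+n. (\<Sum>i. indicator (A i) (\<tau> n)) \<partial>count_space UNIV)"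
        by (rule nn_integral_suminf[symmetric]) simp
      also have "\<dots> = (\<Sum>n. indicator (\<Union>i. A i) (\<tau> n))"
        by (simp add: suminf_indicator[OF d] nn_integral_count_space_nat)
      finally show ?thesis .
    qed
    ultimately show "(\<Sum>i. ?\<mu> (A i)) = ?\<mu> (\<Union> (range A))"
      by (simp add: suminf_add[symmetric])
  qed
qed (use assms in auto)

text \<open>The random measure \<open>N\<^sub>j\<^sub>k(ds)\<close>: unit masses at the jump times\<close>

definition jump_measure ::
  "(real \<Rightarrow> 'a \<Rightarrow> 's::{countable,discrete_topology}) \<Rightarrow> 's \<Rightarrow> 's \<Rightarrow> 'a \<Rightarrow> real measure" where
  "jump_measure Z j k \<omega> = distr (count_space (jump_times Z j k \<omega>)) borel (\<lambda>s. s)"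

definition sojourn_rate ::
  "(real \<Rightarrow> 'a \<Rightarrow> 's::{countable,discrete_topology}) \<Rightarrow> ('s \<Rightarrow> real \<Rightarrow> 'a \<Rightarrow> real) \<Rightarrow> real \<Rightarrow> 'a \<Rightarrow> real" where
  "sojourn_rate Z b s \<omega> = (\<Sum>\<^sub>\<infinity>j. of_bool (Z_left Z s \<omega> = j) * b j s \<omega>)"

text \<open>\<open>Y(t)\<close>, the integral of \<open>\<kappa>(t)/\<kappa>(s)\<close> against \<open>B(ds)\<close> over \<open>(t,\<infinity>)\<close>; \<open>b\<close>
  collects the sojourn payments, \<open>bb\<close> the transition payments.\<close>

definition future_payments ::
  "(real \<Rightarrow> 'a \<Rightarrow> 's::{countable,discrete_topology}) \<Rightarrow> (nat \<Rightarrow> real) \<Rightarrow> (real \<Rightarrow> real) \<Rightarrow>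
   ('s \<Rightarrow> real \<Rightarrow> 'a \<Rightarrow> real) \<Rightarrow> ('s \<Rightarrow> 's \<Rightarrow> real \<Rightarrow> 'a \<Rightarrow> real) \<Rightarrow> real \<Rightarrow> 'a \<Rightarrow> real" where
  "future_payments Z \<tau> \<kappa> b bb t \<omega> =
     (LINT s:{t<..}|pay_measure \<tau>. \<kappa> t / \<kappa> s * sojourn_rate Z b s \<omega>) +
     (\<Sum>\<^sub>\<infinity>(j, k)\<in>{(j, k). j \<noteq> k}. LINT s:{t<..}|jump_measure Z j k \<omega>. \<kappa> t / \<kappa> s * bb j k s \<omega>)"

text \<open>Absolute convergence of the integral defining \<open>Y(t)\<close>\<close>

definition payments_convergent ::
  "(real \<Rightarrow> 'a \<Rightarrow> 's::{countable,discrete_topology}) \<Rightarrow> (nat \<Rightarrow> real) \<Rightarrow> (real \<Rightarrow> real) \<Rightarrow>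
   ('s \<Rightarrow> real \<Rightarrow> 'a \<Rightarrow> real) \<Rightarrow> ('s \<Rightarrow> 's \<Rightarrow> real \<Rightarrow> 'a \<Rightarrow> real) \<Rightarrow> real \<Rightarrow> 'a \<Rightarrow> bool" where
  "payments_convergent Z \<tau> \<kappa> b bb t \<omega> \<longleftrightarrow>
     set_integrable (pay_measure \<tau>) {t<..} (\<lambda>s. \<kappa> t / \<kappa> s * sojourn_rate Z b s \<omega>) \<and>
     (\<forall>j k. j \<noteq> k \<longrightarrow>
        set_integrable (jump_measure Z j k \<omega>) {t<..} (\<lambda>s. \<kappa> t / \<kappa> s * bb j k s \<omega>)) \<and>
     (\<lambda>(j, k). LINT s:{t<..}|jump_measure Z j k \<omega>. \<bar>\<kappa> t / \<kappa> s * bb j k s \<omega>\<bar>)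
        summable_on {(j, k). j \<noteq> k}"

definition prospective_reserve ::
  "'a measure \<Rightarrow> (real \<Rightarrow> 'a measure) \<Rightarrow> (real \<Rightarrow> 'a \<Rightarrow> real) \<Rightarrow> (real \<Rightarrow> 'a \<Rightarrow> real) \<Rightarrow> bool" where
  "prospective_reserve M G Y V \<longleftrightarrow>
     finite_variation_process M G V \<and>
     (\<forall>t\<ge>0. AE \<omega> in M. V t \<omega> = real_cond_exp M (G t) (Y t) \<omega>)"


section \<open>State-wise quantities\<close>

text \<open>\<open>g\<close> is a version of the factorized conditional expectation \<open>u \<mapsto> E[X | U = u]\<close>.\<close>

definition factorized_cond_exp ::
  "'a measure \<Rightarrow> ('a \<Rightarrow> real) \<Rightarrow> ('a \<Rightarrow> 'c) \<Rightarrow> 'c measure \<Rightarrow> ('c \<Rightarrow> real) \<Rightarrow> bool" where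
  "factorized_cond_exp M X U N g \<longleftrightarrow>
     g \<in> borel_measurable N \<and>
     (AE \<omega> in M. g (U \<omega>) = real_cond_exp M (vimage_algebra (space M) U N) X \<omega>)"

text \<open>
  The process \<open>t \<mapsto> E[X(t) | U]\<close> for a conditioning variable \<open>U\<close> that does not depend on time.
  Conditional expectations for single \<open>t\<close> are only determined up to null sets depending on \<open>t\<close>;
  what determines the process up to evanescence is the regularity of its paths. If the paths of \<open>X\<close>
  are right-continuous (and dominated), the process has a right-continuous version, and similarly
  for left limits. The last argument \<open>R\<close> restricts right-continuity to times different from a
  \<open>\<sigma>(U)\<close>-measurable random time, at which \<open>X\<close> itself fails to be right-continuous.\<close>

definition cond_exp_process_cadlag ::
  "'a measure \<Rightarrow> (real \<Rightarrow> 'a \<Rightarrow> real) \<Rightarrow> ('a \<Rightarrow> 'c) \<Rightarrow> 'c measure \<Rightarrow> (real \<Rightarrow> 'c \<Rightarrow> real) \<Rightarrow> bool" where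
  "cond_exp_process_cadlag M X U N g \<longleftrightarrow>
     (\<forall>t\<ge>0. factorized_cond_exp M (X t) U N (g t)) \<and> (AE \<omega> in M. cadlag (\<lambda>t. g t (U \<omega>)))"

definition cond_exp_process_except ::
  "'a measure \<Rightarrow> (real \<Rightarrow> 'a \<Rightarrow> real) \<Rightarrow> ('a \<Rightarrow> 'c) \<Rightarrow> 'c measure \<Rightarrow> (real \<Rightarrow> 'c \<Rightarrow> real) \<Rightarrow>
   ('a \<Rightarrow> ereal) \<Rightarrow> bool" where
  "cond_exp_process_except M X U N g R \<longleftrightarrow>
     (\<forall>t>0. factorized_cond_exp M (X t) U N (g t)) \<and>
     (AE \<omega> in M. \<forall>t>0. ereal t \<noteq> R \<omega> \<longrightarrow> continuous (at_right t) (\<lambda>s. g s (U \<omega>)))"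

text \<open>\<open>v\<close> is a version of the process \<open>\<V>\<^sub>x\<close>. The convention \<open>0/0 = 0\<close> is that of division in
  \<^typ>\<open>real\<close>.\<close>

definition is_state_reserve ::
  "'a measure \<Rightarrow> (real \<Rightarrow> 'a \<Rightarrow> 's::{countable,discrete_topology}) \<Rightarrow>
   ('s \<times> nat \<Rightarrow> 'a \<Rightarrow> 'b::topological_space) \<Rightarrow> (real \<Rightarrow> 'a \<Rightarrow> real) \<Rightarrow>
   's \<times> nat \<Rightarrow> (real \<Rightarrow> 'a \<Rightarrow> real) \<Rightarrow> bool" where
  "is_state_reserve M Z \<zeta> Y x v \<longleftrightarrow> (\<exists>g h.
     cond_exp_process_cadlag M (\<lambda>t \<omega>. of_bool (ZJ Z t \<omega> = x) * Y t \<omega>) (\<zeta> x) borel g \<and>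
     cond_exp_process_cadlag M (\<lambda>t \<omega>. of_bool (ZJ Z t \<omega> = x)) (\<zeta> x) borel h \<and>
     (\<forall>t\<ge>0. \<forall>\<omega>\<in>space M. v t \<omega> = g t (\<zeta> x \<omega>) / h t (\<zeta> x \<omega>)))"

text \<open>\<open>v\<close> is a version of the process \<open>\<V>\<^sub>x\<^sub>x\<close>. The path \<open>\<I>\<^sub>x(t-) \<I>\<^sub>x(t) Y(t)\<close> is right-continuous
  except at the entry time \<open>T\<^sub>x\<close>. The definition is meant for \<open>\<zeta>\<^sub>x\<close> with respect to which \<open>T\<^sub>x\<close> is
  measurable, such as \<open>\<xi>\<^sub>x\<close>.\<close>

definition is_stay_reserve ::
  "'a measure \<Rightarrow> (real \<Rightarrow> 'a \<Rightarrow> 's::{countable,discrete_topology}) \<Rightarrow>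
   ('s \<times> nat \<Rightarrow> 'a \<Rightarrow> 'b::topological_space) \<Rightarrow> (real \<Rightarrow> 'a \<Rightarrow> real) \<Rightarrow>
   's \<times> nat \<Rightarrow> (real \<Rightarrow> 'a \<Rightarrow> real) \<Rightarrow> bool" where
  "is_stay_reserve M Z \<zeta> Y x v \<longleftrightarrow> (\<exists>g h.
     cond_exp_process_except M
       (\<lambda>t \<omega>. of_bool (ZJ_left Z t \<omega> = x) * of_bool (ZJ Z t \<omega> = x) * Y t \<omega>) (\<zeta> x) borel g
       (entry_time Z x) \<and>
     cond_exp_process_except M
       (\<lambda>t \<omega>. of_bool (ZJ_left Z t \<omega> = x) * of_bool (ZJ Z t \<omega> = x)) (\<zeta> x) borel h
       (entry_time Z x) \<and>
     (\<forall>t>0. \<forall>\<omega>\<in>space M. v t \<omega> = g t (\<zeta> x \<omega>) / h t (\<zeta> x \<omega>)))"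

text \<open>\<open>v\<close> is a version of the process \<open>\<V>\<^sub>x\<^sub>y\<close>, where the value of \<open>T\<^sub>y\<close> is set to \<open>t\<close> in the
  factorized conditional expectations. The variables to be conditioned are put to zero on
  \<open>{T\<^sub>y = \<infinity>}\<close>, where they are undefined and which does not matter for the condition \<open>T\<^sub>y = t\<close>.\<close>

definition is_jump_reserve ::
  "'a measure \<Rightarrow> (real \<Rightarrow> 'a \<Rightarrow> 's::{countable,discrete_topology}) \<Rightarrow>
   ('s \<times> nat \<Rightarrow> 'a \<Rightarrow> 'b::topological_space) \<Rightarrow> (real \<Rightarrow> 'a \<Rightarrow> real) \<Rightarrow>
   's \<times> nat \<Rightarrow> 's \<times> nat \<Rightarrow> (real \<Rightarrow> 'a \<Rightarrow> real) \<Rightarrow> bool" where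
  "is_jump_reserve M Z \<zeta> Y x y v \<longleftrightarrow> (\<exists>g h.
     factorized_cond_exp M
       (\<lambda>\<omega>. if entry_time Z y \<omega> = \<infinity> then 0
             else of_bool (ZJ_left Z (real_of_ereal (entry_time Z y \<omega>)) \<omega> = x) *
                  Y (real_of_ereal (entry_time Z y \<omega>)) \<omega>)
       (\<lambda>\<omega>. (\<zeta> x \<omega>, entry_time Z y \<omega>)) (borel \<Otimes>\<^sub>M borel) g \<and>
     factorized_cond_exp M
       (\<lambda>\<omega>. if entry_time Z y \<omega> = \<infinity> then 0
             else of_bool (ZJ_left Z (real_of_ereal (entry_time Z y \<omega>)) \<omega> = x))
       (\<lambda>\<omega>. (\<zeta> x \<omega>, entry_time Z y \<omega>)) (borel \<Otimes>\<^sub>M borel) h \<and>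
     (\<forall>t>0. \<forall>\<omega>\<in>space M. v t \<omega> = g (\<zeta> x \<omega>, ereal t) / h (\<zeta> x \<omega>, ereal t)))"

text \<open>\<open>V\<^sub>j\<^sub>j\<close> and \<open>V\<^sub>k\<^sub>j\<close>, built from versions \<open>vs x\<close> of \<open>\<V>\<^sub>x\<^sub>x\<close> and \<open>vj x y\<close> of \<open>\<V>\<^sub>x\<^sub>y\<close>\<close>

definition V_stay ::
  "(real \<Rightarrow> 'a \<Rightarrow> 's::{countable,discrete_topology}) \<Rightarrow> ('s \<times> nat \<Rightarrow> real \<Rightarrow> 'a \<Rightarrow> real) \<Rightarrow>
   's \<Rightarrow> real \<Rightarrow> 'a \<Rightarrow> real" where
  "V_stay Z vs j t \<omega> =
     (\<Sum>\<^sub>\<infinity>l. of_bool (left_lim (\<lambda>s. exits Z j s \<omega>) t = l) * vs (j, l) t \<omega>)"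

definition V_jump ::
  "(real \<Rightarrow> 'a \<Rightarrow> 's::{countable,discrete_topology}) \<Rightarrow>
   ('s \<times> nat \<Rightarrow> 's \<times> nat \<Rightarrow> real \<Rightarrow> 'a \<Rightarrow> real) \<Rightarrow> 's \<Rightarrow> 's \<Rightarrow> real \<Rightarrow> 'a \<Rightarrow> real" where
  "V_jump Z vj k j t \<omega> =
     (\<Sum>\<^sub>\<infinity>(l, n). of_bool (left_lim (\<lambda>s. exits Z k s \<omega>) t = l) * of_bool (exits Z j t \<omega> = n) *
        vj (k, l) (j, n) t \<omega>)"

definition V_state ::
  "(real \<Rightarrow> 'a \<Rightarrow> 's::{countable,discrete_topology}) \<Rightarrow> ('s \<times> nat \<Rightarrow> real \<Rightarrow> 'a \<Rightarrow> real) \<Rightarrow>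
   ('s \<times> nat \<Rightarrow> 's \<times> nat \<Rightarrow> real \<Rightarrow> 'a \<Rightarrow> real) \<Rightarrow> 's \<Rightarrow> real \<Rightarrow> 'a \<Rightarrow> real" where
  "V_state Z v vj j t \<omega> =
     (if t = 0 \<or> Z_left Z t \<omega> = j
      then \<Sum>\<^sub>\<infinity>n. of_bool (exits Z j t \<omega> = n) * v (j, n) t \<omega>
      else V_jump Z vj (Z_left Z t \<omega>) j t \<omega>)"

text \<open>
  The integral of \<open>I\<^sub>j(s-)\<close> over \<open>(0,t]\<close> with respect to \<open>f(ds)\<close>. The integrand is the indicator of
  a finite disjoint union of sojourn intervals \<open>(u,v]\<close>, the connected components of
  \<open>{s \<in> (0,t]. Z\<^sub>s\<^sub>- = j}\<close>, and an interval contributes \<open>f(v) - f(u)\<close>. No regularity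
  of \<open>f\<close> outside of these intervals is involved.\<close>

definition sojourn_integral ::
  "(real \<Rightarrow> 'a \<Rightarrow> 's::{countable,discrete_topology}) \<Rightarrow> 's \<Rightarrow> (real \<Rightarrow> 'a \<Rightarrow> real) \<Rightarrow>
   real \<Rightarrow> 'a \<Rightarrow> real" where
  "sojourn_integral Z j f t \<omega> =
     (\<Sum>C\<in>components {s\<in>{0<..t}. Z_left Z s \<omega> = j}. f (Sup C) \<omega> - f (Inf C) \<omega>)"

definition statewise_prospective_reserves ::
  "'a measure \<Rightarrow> (real \<Rightarrow> 'a \<Rightarrow> 's::{countable,discrete_topology}) \<Rightarrow>
   ('s \<times> nat \<Rightarrow> 'a \<Rightarrow> 'b::topological_space) \<Rightarrow> (real \<Rightarrow> 'a \<Rightarrow> real) \<Rightarrow>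
   ('s \<Rightarrow> real \<Rightarrow> 'a \<Rightarrow> real) \<Rightarrow> bool" where
  "statewise_prospective_reserves M Z \<zeta> V Vs \<longleftrightarrow> (\<forall>j.
     (\<forall>t\<ge>0. AE \<omega> in M. of_bool (Z t \<omega> = j) * Vs j t \<omega> = of_bool (Z t \<omega> = j) * V t \<omega>) \<and>
     (\<forall>t>0. (\<lambda>\<omega>. of_bool (Z_left Z t \<omega> = j) * Vs j t \<omega>) \<in> borel_measurable (info_family_left M Z \<zeta> t)) \<and>
     finite_variation_process M (natural_filtration M Z) (sojourn_integral Z j (Vs j)))"

end

theory Submission
  imports Defs
begin

text \<open>
  Write \<open>T\<^sub>x\<close> and \<open>S\<^sub>x\<close> for the entry and the exit time of a state \<open>x = (j, n)\<close> of \<open>(Z, J)\<close>. Leaving \<open>j\<close>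
  increases the counter of exits from \<open>j\<close> for good, so \<open>x\<close> is occupied exactly on \<open>[T\<^sub>x, S\<^sub>x)\<close>, and the integral
  of \<open>I\<^sub>j(s-)\<close> against \<open>V\<^sub>j(ds)\<close> is the sum over \<open>n\<close> of the increments of \<open>V\<^sub>j\<close> over \<open>(T\<^sub>x, S\<^sub>x]\<close>
  (\<open>sojourn_integral_eq\<close>). On such an interval \<open>V\<^sub>j\<close> is the quotient of the regular versions \<open>g\<close> of
  \<open>E[\<I>\<^sub>x(t) Y(t) | \<xi>\<^sub>x]\<close> and \<open>h\<close> of \<open>E[\<I>\<^sub>x(t) | \<xi>\<^sub>x]\<close>; at \<open>T\<^sub>x > 0\<close> it is the jump quotient for the previous
  state \<open>y\<close>.

  The main tool is a localization (\<open>real_cond_exp_local\<close>): if two sigma-algebras have the same trace on an event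
  \<open>C\<close> up to null sets and the first one contains \<open>C\<close>, then on \<open>C\<close> the conditional expectation given
  the first one is the quotient \<open>E[1\<^sub>C Y | \<cdot>] / E[1\<^sub>C | \<cdot>]\<close> formed with the second one. It is used twice.

  On the event that \<open>x\<close> is occupied at time \<open>t\<close>, the sigma-algebras \<open>\<G>\<^sub>t\<close> and \<open>\<sigma>(\<xi>\<^sub>x)\<close> have the same trace, so
  \<open>g/h\<close> is the prospective reserve there (\<open>state_reserve_eq_cond_exp\<close>). On the event that \<open>x\<close> is entered from
  \<open>y\<close>, the sigma-algebras \<open>\<sigma>(\<xi>\<^sub>x)\<close> and \<open>\<sigma>(\<xi>\<^sub>y, T\<^sub>x)\<close> have the same trace, so the jump quotient is the value of
  \<open>g/h\<close> at \<open>T\<^sub>x\<close> (\<open>reserve_at_entry\<close>). The latter needs two further facts: the versions \<open>g\<close> and \<open>h\<close> can be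
  evaluated at the random time \<open>T\<^sub>x\<close> (\<open>cond_exp_process_at_time\<close>), and the previous state is known to
  \<open>\<xi>\<^sub>x\<close> up to null sets. The variable \<open>\<xi>\<^sub>x\<close> itself does not name the initial state; this is where the
  hypothesis \<open>\<F> = \<G>\<close> enters (\<open>previous_state_known\<close>). Both results together give the first
  property of state-wise reserves, at jump times as well as inside sojourns.

  The second property holds because \<open>V\<^sub>j\<close> is on \<open>{Z\<^sub>t\<^sub>- = j}\<close> a measurable function of the state
  just before \<open>t\<close> and its information variable. For the third, \<open>g\<close> and \<open>h\<close> have finite variation
  because conditional expectations of partition sums are bounded by those of the integrable variation
  (\<open>cond_exp_process_finite_variation\<close>), and almost surely \<open>h\<close> is bounded away from zero on
  \<open>[T\<^sub>x, S\<^sub>x)\<close> (\<open>cond_survival_bounded_below\<close>). So the quotient is cadlag with finite variation there, and it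
  starts from the value of the jump quotient.

  The decomposition of \<open>V\<^sub>j\<close> comes down to \<open>\<V>\<^sub>x = \<V>\<^sub>x\<^sub>x\<close> on \<open>(T\<^sub>x, S\<^sub>x]\<close>. For fixed \<open>t\<close> the conditioned variables
  differ only on \<open>{T\<^sub>x = t}\<close>, an event known to \<open>\<xi>\<^sub>x\<close>; right-continuity extends the equality from rational
  times to all times other than \<open>T\<^sub>x\<close> (\<open>stay_reserve_eq\<close>).
\<close>

section \<open>Paths of the jump process\<close>

lemma left_lim_eqI:
  assumes "0 < t" "u < t" "\<And>s. u < s \<Longrightarrow> s < t \<Longrightarrow> f s = c"
  shows "left_lim f t = c"
proof -
  have "eventually (\<lambda>s. f s = c) (at_left t)"
    using assms(2,3) by (auto simp: eventually_at_left_field)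
  then have "(f \<longlongrightarrow> c) (at_left t)"
    by (rule tendsto_eventually)
  then show ?thesis
    using assms(1) by (auto simp: left_lim_def intro: tendsto_Lim)
qed

locale jump_path =
  fixes Z :: "real \<Rightarrow> 'a \<Rightarrow> 's::{countable,discrete_topology}" and \<omega> :: 'a
  assumes cadlag_path: "cadlag (\<lambda>t. Z t \<omega>)"
begin

lemma right_constant:
  assumes "0 \<le> t"
  obtains u where "t < u" "\<And>s. t \<le> s \<Longrightarrow> s < u \<Longrightarrow> Z s \<omega> = Z t \<omega>"
proof -
  have "((\<lambda>s. Z s \<omega>) \<longlongrightarrow> Z t \<omega>) (at_right t)"
    using cadlag_path assms by (auto simp: cadlag_def continuous_within)
  then have "eventually (\<lambda>s. Z s \<omega> = Z t \<omega>) (at_right t)"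
    by (simp add: tendsto_discrete)
  then obtain u where "t < u" "\<And>s. t < s \<Longrightarrow> s < u \<Longrightarrow> Z s \<omega> = Z t \<omega>"
    by (auto simp: eventually_at_right_field)
  then show ?thesis
    using that[of u] by (metis le_less)
qed

lemma left_constant:
  assumes "0 < t"
  obtains u where "0 \<le> u" "u < t" "\<And>s. u < s \<Longrightarrow> s < t \<Longrightarrow> Z s \<omega> = Z_left Z t \<omega>"
proof -
  obtain l where "((\<lambda>s. Z s \<omega>) \<longlongrightarrow> l) (at_left t)"
    using cadlag_path assms by (auto simp: cadlag_def)
  then have "eventually (\<lambda>s. Z s \<omega> = l) (at_left t)"
    by (simp add: tendsto_discrete)
  then obtain u where u: "u < t" "\<And>s. u < s \<Longrightarrow> s < t \<Longrightarrow> Z s \<omega> = l"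
    by (auto simp: eventually_at_left_field)
  have "Z_left Z t \<omega> = l"
    unfolding Z_left_def using assms u by (rule left_lim_eqI)
  then show ?thesis
    using that[of "max u 0"] u assms by auto
qed

lemma Z_left_eqI:
  assumes "0 < t" "u < t" "\<And>s. u < s \<Longrightarrow> s < t \<Longrightarrow> Z s \<omega> = j"
  shows "Z_left Z t \<omega> = j"
  unfolding Z_left_def using assms by (rule left_lim_eqI)

lemma no_jump_left:
  assumes "0 < t"
  obtains u where "0 \<le> u" "u < t"
    "\<And>s. u < s \<Longrightarrow> s < t \<Longrightarrow> Z s \<omega> = Z_left Z t \<omega> \<and> Z_left Z s \<omega> = Z_left Z t \<omega>"
proof -
  obtain u where u: "0 \<le> u" "u < t" "\<And>s. u < s \<Longrightarrow> s < t \<Longrightarrow> Z s \<omega> = Z_left Z t \<omega>"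
    using left_constant[OF assms] by blast
  have "Z_left Z s \<omega> = Z_left Z t \<omega>" if "u < s" "s < t" for s
    using that u by (intro Z_left_eqI[of s u]) auto
  then show ?thesis using that u by blast
qed

lemma no_jump_right:
  assumes "0 \<le> t"
  obtains u where "t < u" "\<And>s. t \<le> s \<Longrightarrow> s < u \<Longrightarrow> Z s \<omega> = Z t \<omega>"
    "\<And>s. t < s \<Longrightarrow> s < u \<Longrightarrow> Z_left Z s \<omega> = Z t \<omega>"
proof -
  obtain u where u: "t < u" "\<And>s. t \<le> s \<Longrightarrow> s < u \<Longrightarrow> Z s \<omega> = Z t \<omega>"
    using right_constant[OF assms] by blast
  have "Z_left Z s \<omega> = Z t \<omega>" if "t < s" "s < u" for s
    using that assms by (intro Z_left_eqI[of s t] u(2)) auto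
  then show ?thesis using that u by blast
qed

text \<open>At an accumulation point of jump times, the path would fail to be constant shortly before or shortly
  after this point.\<close>

lemma finite_jumps: "finite {s. 0 < s \<and> s \<le> t \<and> Z_left Z s \<omega> \<noteq> Z s \<omega>}" (is "finite ?J")
proof (rule ccontr)
  assume "infinite ?J"
  moreover have "?J \<subseteq> {0..t}" by auto
  ultimately obtain x where x: "x \<in> {0..t}" "x islimpt ?J"
    using Heine_Borel_imp_Bolzano_Weierstrass[OF compact_Icc] by meson
  have x0: "0 \<le> x" using x(1) by simp
  obtain v where v: "x < v" "\<And>s. x \<le> s \<Longrightarrow> s < v \<Longrightarrow> Z s \<omega> = Z x \<omega>"
      "\<And>s. x < s \<Longrightarrow> s < v \<Longrightarrow> Z_left Z s \<omega> = Z x \<omega>"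
    using no_jump_right[OF x0] by blast
  obtain u where u: "u < x" "\<And>s. 0 < s \<Longrightarrow> u < s \<Longrightarrow> s < x \<Longrightarrow> Z s \<omega> = Z_left Z s \<omega>"
  proof (cases "x = 0")
    case True
    then show ?thesis using that[of "-1"] by auto
  next
    case False
    then show ?thesis using no_jump_left[of x] that x by (metis atLeastAtMost_iff order_le_less)
  qed
  have "\<exists>s\<in>?J. s \<in> {u<..<v} \<and> s \<noteq> x"
    using x(2) u(1) v(1) unfolding islimpt_def
    by (metis open_greaterThanLessThan greaterThanLessThan_iff)
  then obtain s where s: "s \<in> ?J" "u < s" "s < v" "s \<noteq> x" by auto
  then show False using u(2)[of s] v(2)[of s] v(3)[of s] by force
qed

lemma exits_eq_card:
  "exits Z j t \<omega> = card {s. 0 < s \<and> s < t \<and> Z_left Z s \<omega> = j \<and> Z s \<omega> \<noteq> j}"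
    (is "_ = card ?E")
proof -
  define A where "A k = jump_times Z j k \<omega> \<inter> {0<..<t}" for k
  have lim: "left_lim (\<lambda>s. jump_count Z j k s \<omega>) t = card (A k)" if "k \<noteq> j" for k
  proof (cases "0 < t")
    case True
    obtain u where u: "0 \<le> u" "u < t"
      "\<And>s. u < s \<Longrightarrow> s < t \<Longrightarrow> Z s \<omega> = Z_left Z t \<omega> \<and> Z_left Z s \<omega> = Z_left Z t \<omega>"
      using no_jump_left[OF True] by blast
    show ?thesis
    proof (rule left_lim_eqI[OF True u(2)])
      fix s assume s: "u < s" "s < t"
      have "jump_times Z j k \<omega> \<inter> {0<..s} = A k"
      proof (intro equalityI subsetI)
        fix r assume r: "r \<in> A k"
        then have "\<not> u < r" using u(3)[of r] that by (auto simp: A_def jump_times_def)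
        then show "r \<in> jump_times Z j k \<omega> \<inter> {0<..s}" using r s by (auto simp: A_def)
      qed (use s in \<open>auto simp: A_def\<close>)
      then show "jump_count Z j k s \<omega> = card (A k)" by (simp add: jump_count_def)
    qed
  next
    case False
    then show ?thesis by (auto simp: A_def left_lim_def jump_count_def)
  qed
  have fin: "finite ?E"
    by (rule finite_subset[OF _ finite_jumps[of t]]) auto
  have A: "A k = {s \<in> ?E. Z s \<omega> = k}" if "k \<noteq> j" for k
    using that by (auto simp: A_def jump_times_def)
  have finA: "finite (A k)" if "k \<noteq> j" for k
    unfolding A[OF that] using fin by (rule rev_finite_subset) auto
  define F where "F = (\<lambda>s. Z s \<omega>) ` ?E"
  have F: "finite F" "F \<subseteq> -{j}" using fin by (auto simp: F_def)
  have "exits Z j t \<omega> = (\<Sum>\<^sub>\<infinity>k\<in>-{j}. card (A k))"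
    unfolding exits_def using lim by (intro infsum_cong) auto
  also have "\<dots> = (\<Sum>\<^sub>\<infinity>k\<in>F. card (A k))"
  proof (rule infsum_cong_neutral)
    fix k assume "k \<in> -{j} - F"
    then have "A k = {}" using A[of k] by (auto simp: F_def)
    then show "card (A k) = 0" by simp
  qed (use F in auto)
  also have "\<dots> = (\<Sum>k\<in>F. card (A k))" using F by simp
  also have "\<dots> = card (\<Union>k\<in>F. A k)"
  proof (rule card_UN_disjoint[symmetric])
    show "\<forall>k\<in>F. finite (A k)" using F finA by blast
    show "\<forall>k\<in>F. \<forall>l\<in>F. k \<noteq> l \<longrightarrow> A k \<inter> A l = {}"
      by (auto simp: A_def jump_times_def)
  qed (use F in simp)
  also have "(\<Union>k\<in>F. A k) = ?E"
  proof -
    have "(\<Union>k\<in>F. A k) = (\<Union>k\<in>F. {s \<in> ?E. Z s \<omega> = k})" using A F(2) by (intro SUP_cong refl) blast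
    also have "\<dots> = ?E" by (auto simp: F_def)
    finally show ?thesis .
  qed
  finally show ?thesis .
qed

lemma finite_exits: "finite {s. 0 < s \<and> s < t \<and> Z_left Z s \<omega> = j \<and> Z s \<omega> \<noteq> j}"
  by (rule finite_subset[OF _ finite_jumps[of t]]) auto

lemma exits_mono: "s \<le> t \<Longrightarrow> exits Z j s \<omega> \<le> exits Z j t \<omega>"
  unfolding exits_eq_card by (intro card_mono finite_exits) auto

lemma exits_eqI:
  assumes "s \<le> t" "\<And>u. 0 < u \<Longrightarrow> s \<le> u \<Longrightarrow> u < t \<Longrightarrow> Z_left Z u \<omega> = j \<Longrightarrow> Z u \<omega> = j"
  shows "exits Z j s \<omega> = exits Z j t \<omega>"
proof -
  have "0 < u \<and> u < s \<and> Z_left Z u \<omega> = j \<and> Z u \<omega> \<noteq> j \<longleftrightarrow>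
      0 < u \<and> u < t \<and> Z_left Z u \<omega> = j \<and> Z u \<omega> \<noteq> j" for u
    using assms(1) assms(2)[of u] by linarith
  then show ?thesis by (simp only: exits_eq_card)
qed

lemma exits_less:
  assumes "0 < u" "s \<le> u" "u < t" "Z_left Z u \<omega> = j" "Z u \<omega> \<noteq> j"
  shows "exits Z j s \<omega> < exits Z j t \<omega>"
proof -
  have "{r. 0 < r \<and> r < s \<and> Z_left Z r \<omega> = j \<and> Z r \<omega> \<noteq> j} \<subseteq>
      {r. 0 < r \<and> r < t \<and> Z_left Z r \<omega> = j \<and> Z r \<omega> \<noteq> j} - {u}"
    using assms by auto
  then have "exits Z j s \<omega> \<le> card ({r. 0 < r \<and> r < t \<and> Z_left Z r \<omega> = j \<and> Z r \<omega> \<noteq> j} - {u})"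
    unfolding exits_eq_card using finite_exits by (intro card_mono) auto
  also have "\<dots> < exits Z j t \<omega>"
    unfolding exits_eq_card using assms finite_exits by (intro card_Diff1_less) auto
  finally show ?thesis .
qed

lemma exit_between:
  assumes "0 \<le> q" "q < r" "Z q \<omega> = j" "Z r \<omega> \<noteq> j"
  obtains u where "q < u" "u \<le> r" "Z_left Z u \<omega> = j" "Z u \<omega> \<noteq> j"
    "\<And>s. q \<le> s \<Longrightarrow> s < u \<Longrightarrow> Z s \<omega> = j"
proof -
  define A where "A = {s. q \<le> s \<and> Z s \<omega> \<noteq> j}"
  have A: "r \<in> A" "bdd_below A" using assms by (auto simp: A_def intro: bdd_belowI)
  define u where "u = Inf A"
  have u: "q \<le> u" "u \<le> r"
    using A by (auto simp: u_def A_def intro: cInf_greatest cInf_lower)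
  have before: "Z s \<omega> = j" if "q \<le> s" "s < u" for s
    using that A by (metis (mono_tags, lifting) A_def cInf_lower leD mem_Collect_eq u_def)
  have *: "Z u \<omega> \<noteq> j"
  proof
    assume j: "Z u \<omega> = j"
    obtain v where v: "u < v" "\<And>s. u \<le> s \<Longrightarrow> s < v \<Longrightarrow> Z s \<omega> = j"
      using right_constant[of u] u assms(1) j by (metis order_trans)
    have "v \<le> Inf A"
    proof (rule cInf_greatest)
      fix s assume "s \<in> A"
      then show "v \<le> s" using v(2)[of s] before[of s] by (auto simp: A_def not_le[symmetric])
    qed (use A in auto)
    then show False using v u_def by simp
  qed
  then have "q < u" using u assms(3) by (metis order_le_less)
  moreover have "Z_left Z u \<omega> = j"
    using \<open>q < u\<close> assms(1) before by (intro Z_left_eqI[of u q]) auto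
  ultimately show ?thesis using that u * before by blast
qed

lemma exits_less_of_leave:
  assumes "0 \<le> q" "q < r" "r < t" "Z q \<omega> = j" "Z r \<omega> \<noteq> j"
  shows "exits Z j q \<omega> < exits Z j t \<omega>"
proof -
  obtain u where "q < u" "u \<le> r" "Z_left Z u \<omega> = j" "Z u \<omega> \<noteq> j"
    using exit_between[OF assms(1,2,4,5)] by blast
  then show ?thesis using assms by (intro exits_less[of u]) auto
qed

lemma exits_left_constant:
  assumes "0 < t"
  obtains u where "0 \<le> u" "u < t" "\<And>s j. u < s \<Longrightarrow> s \<le> t \<Longrightarrow> exits Z j s \<omega> = exits Z j t \<omega>"
    "\<And>s. u < s \<Longrightarrow> s < t \<Longrightarrow> Z s \<omega> = Z_left Z t \<omega>"
proof -
  obtain u where u: "0 \<le> u" "u < t"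
    "\<And>s. u < s \<Longrightarrow> s < t \<Longrightarrow> Z s \<omega> = Z_left Z t \<omega> \<and> Z_left Z s \<omega> = Z_left Z t \<omega>"
    using no_jump_left[OF assms] by blast
  show ?thesis
  proof (rule that[OF u(1,2)])
    fix s j assume s: "u < s" "s \<le> t"
    show "exits Z j s \<omega> = exits Z j t \<omega>"
    proof (rule exits_eqI[OF s(2)])
      fix r assume "s \<le> r" "r < t" "Z_left Z r \<omega> = j"
      then show "Z r \<omega> = j" using u(3)[of r] s by simp
    qed
  qed (use u(3) in blast)
qed

lemma left_lim_exits: "0 < t \<Longrightarrow> left_lim (\<lambda>s. exits Z j s \<omega>) t = exits Z j t \<omega>"
proof -
  assume "0 < t"
  from exits_left_constant[OF this]
  obtain u where u: "0 \<le> u" "u < t" "\<And>s j. u < s \<Longrightarrow> s \<le> t \<Longrightarrow> exits Z j s \<omega> = exits Z j t \<omega>"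
    "\<And>s. u < s \<Longrightarrow> s < t \<Longrightarrow> Z s \<omega> = Z_left Z t \<omega>" by metis
  show ?thesis
  proof (rule left_lim_eqI[OF \<open>0 < t\<close> u(2)])
    show "exits Z j s \<omega> = exits Z j t \<omega>" if "u < s" "s < t" for s
      using u(3)[of s] that by simp
  qed
qed

lemma ZJ_eq: "ZJ Z t \<omega> = (Z t \<omega>, exits Z (Z t \<omega>) t \<omega>)"
proof -
  have "exits_cur Z t \<omega> = (\<Sum>\<^sub>\<infinity>j\<in>{Z t \<omega>}. of_bool (Z t \<omega> = j) * exits Z j t \<omega>)"
    unfolding exits_cur_def by (intro infsum_cong_neutral) auto
  then show ?thesis by (simp add: ZJ_def)
qed

lemma ZJ_eq_iff: "ZJ Z t \<omega> = (j, n) \<longleftrightarrow> Z t \<omega> = j \<and> exits Z j t \<omega> = n"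
  by (auto simp: ZJ_eq)

lemma ZJ_right_constant:
  assumes "0 \<le> t"
  obtains u where "t < u" "\<And>s. t \<le> s \<Longrightarrow> s < u \<Longrightarrow> ZJ Z s \<omega> = ZJ Z t \<omega>"
proof -
  obtain u where u: "t < u" "\<And>s. t \<le> s \<Longrightarrow> s < u \<Longrightarrow> Z s \<omega> = Z t \<omega>"
    using right_constant[OF assms] by blast
  have "ZJ Z s \<omega> = ZJ Z t \<omega>" if "t \<le> s" "s < u" for s
  proof -
    have "exits Z (Z t \<omega>) t \<omega> = exits Z (Z t \<omega>) s \<omega>"
    proof (rule exits_eqI[OF that(1)])
      fix r assume "t \<le> r" "r < s"
      then show "Z r \<omega> = Z t \<omega>" using u(2)[of r] that by simp
    qed
    then show ?thesis using u(2)[OF that] by (simp add: ZJ_eq)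
  qed
  then show ?thesis using that u by blast
qed

lemma ZJ_left_constant:
  assumes "0 < t"
  obtains u where "0 \<le> u" "u < t" "\<And>s. u < s \<Longrightarrow> s < t \<Longrightarrow> ZJ Z s \<omega> = ZJ_left Z t \<omega>"
proof -
  obtain u where u: "0 \<le> u" "u < t" "\<And>s j. u < s \<Longrightarrow> s \<le> t \<Longrightarrow> exits Z j s \<omega> = exits Z j t \<omega>"
    "\<And>s. u < s \<Longrightarrow> s < t \<Longrightarrow> Z s \<omega> = Z_left Z t \<omega>"
    using exits_left_constant[OF assms] by blast
  have *: "ZJ Z s \<omega> = (Z_left Z t \<omega>, exits Z (Z_left Z t \<omega>) t \<omega>)" if "u < s" "s < t" for s
    using u(3)[of s] u(4)[of s] that by (simp add: ZJ_eq)
  then have "ZJ_left Z t \<omega> = (Z_left Z t \<omega>, exits Z (Z_left Z t \<omega>) t \<omega>)"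
    unfolding ZJ_left_def using assms u(2) by (intro left_lim_eqI)
  then show ?thesis using that u(1,2) * by metis
qed

lemma ZJ_left_eq: "0 < t \<Longrightarrow> ZJ_left Z t \<omega> = (Z_left Z t \<omega>, exits Z (Z_left Z t \<omega>) t \<omega>)"
proof -
  assume "0 < t"
  from exits_left_constant[OF this]
  obtain u where u: "0 \<le> u" "u < t" "\<And>s j. u < s \<Longrightarrow> s \<le> t \<Longrightarrow> exits Z j s \<omega> = exits Z j t \<omega>"
    "\<And>s. u < s \<Longrightarrow> s < t \<Longrightarrow> Z s \<omega> = Z_left Z t \<omega>" by blast
  have "ZJ Z s \<omega> = (Z_left Z t \<omega>, exits Z (Z_left Z t \<omega>) t \<omega>)" if "u < s" "s < t" for s
    using u(3)[of s] u(4)[of s] that by (simp add: ZJ_eq)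
  then show ?thesis
    unfolding ZJ_left_def using \<open>0 < t\<close> u(2) by (intro left_lim_eqI)
qed

text \<open>Leaving \<open>j\<close> between two visits of \<open>(j, n)\<close> would increase the counter of exits from \<open>j\<close> for good, so
  the second visit could not happen.\<close>

lemma ZJ_interval:
  assumes "0 \<le> s" "s \<le> r" "r \<le> t" "ZJ Z s \<omega> = x" "ZJ Z t \<omega> = x"
  shows "ZJ Z r \<omega> = x"
proof -
  obtain j n where x: "x = (j, n)" by (cases x)
  have j: "Z s \<omega> = j" "Z t \<omega> = j" "exits Z j s \<omega> = n" "exits Z j t \<omega> = n"
    using assms(4,5) by (auto simp: x ZJ_eq_iff)
  have "Z r \<omega> = j"
  proof (rule ccontr)
    assume *: "Z r \<omega> \<noteq> j"
    then have "s < r" "r < t" using assms j by (auto simp: order_le_less)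
    then have "exits Z j s \<omega> < exits Z j t \<omega>" using assms j * by (intro exits_less_of_leave[of s r]) auto
    then show False using j by simp
  qed
  moreover have "exits Z j r \<omega> = n"
    using exits_mono[OF assms(2), of j] exits_mono[OF assms(3), of j] j by auto
  ultimately show ?thesis by (simp add: x ZJ_eq_iff)
qed

lemma entry_time_nonneg: "0 \<le> entry_time Z x \<omega>"
  unfolding entry_time_def by (auto intro!: INF_greatest)

lemma entry_time_le: "0 \<le> t \<Longrightarrow> ZJ Z t \<omega> = x \<Longrightarrow> entry_time Z x \<omega> \<le> ereal t"
  unfolding entry_time_def by (auto intro!: INF_lower)

lemma entry_time_cases:
  obtains (never) "entry_time Z x \<omega> = \<infinity>" "\<And>t. 0 \<le> t \<Longrightarrow> ZJ Z t \<omega> \<noteq> x"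
  | (visit) T where "0 \<le> T" "entry_time Z x \<omega> = ereal T" "ZJ Z T \<omega> = x"
     "\<And>t. 0 \<le> t \<Longrightarrow> t < T \<Longrightarrow> ZJ Z t \<omega> \<noteq> x"
proof (cases "\<exists>t\<ge>0. ZJ Z t \<omega> = x")
  case False
  then have e: "{t. 0 \<le> t \<and> ZJ Z t \<omega> = x} = {}" by auto
  have "entry_time Z x \<omega> = \<infinity>" unfolding entry_time_def e by (simp add: top_ereal_def)
  then show ?thesis using False never by auto
next
  case True
  then obtain t where t: "0 \<le> t" "ZJ Z t \<omega> = x" by auto
  have "\<bar>entry_time Z x \<omega>\<bar> \<noteq> \<infinity>"
    using entry_time_nonneg[of x] entry_time_le[OF t] by auto
  then obtain T where T: "entry_time Z x \<omega> = ereal T" by auto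
  have T0: "0 \<le> T" using entry_time_nonneg[of x] T by simp
  have before: "ZJ Z s \<omega> \<noteq> x" if "0 \<le> s" "s < T" for s
    using entry_time_le[of s x] that T by auto
  obtain u where u: "T < u" "\<And>s. T \<le> s \<Longrightarrow> s < u \<Longrightarrow> ZJ Z s \<omega> = ZJ Z T \<omega>"
    using ZJ_right_constant[OF T0] by blast
  have "entry_time Z x \<omega> < ereal u" using T u by simp
  then obtain s where s: "0 \<le> s" "ZJ Z s \<omega> = x" "s < u"
    unfolding entry_time_def by (auto simp: INF_less_iff)
  then have "T \<le> s" using entry_time_le[of s x] T by simp
  then have "ZJ Z T \<omega> = x" using u(2)[of s] s by simp
  then show ?thesis using visit T0 T before by blast
qed

lemma entry_time_leD:
  assumes "entry_time Z x \<omega> = ereal T"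
  shows "0 \<le> T" "ZJ Z T \<omega> = x" "\<And>t. 0 \<le> t \<Longrightarrow> t < T \<Longrightarrow> ZJ Z t \<omega> \<noteq> x"
  using assms by (cases x rule: entry_time_cases; force)+

lemma ZJ_left_visit:
  assumes "0 < t" "ZJ_left Z t \<omega> = x"
  obtains T where "0 \<le> T" "T < t" "entry_time Z x \<omega> = ereal T"
    "\<And>s. T \<le> s \<Longrightarrow> s < t \<Longrightarrow> ZJ Z s \<omega> = x"
proof -
  obtain u where u: "0 \<le> u" "u < t" "\<And>s. u < s \<Longrightarrow> s < t \<Longrightarrow> ZJ Z s \<omega> = x"
    using ZJ_left_constant[OF assms(1)] assms(2) by metis
  define r where "r = (u + t) / 2"
  have r: "u < r" "r < t" "0 \<le> r" using u by (auto simp: r_def)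
  have rx: "ZJ Z r \<omega> = x" using u r by auto
  show ?thesis
  proof (cases x rule: entry_time_cases)
    case never
    then show ?thesis using rx r by auto
  next
    case (visit T)
    have "T \<le> r" using visit(4) rx r by (metis not_le)
    have inT: "ZJ Z s \<omega> = x" if "T \<le> s" "s < t" for s
    proof (cases "s \<le> r")
      case True
      then show ?thesis using ZJ_interval[of T s r x] that visit rx by auto
    next
      case False
      then show ?thesis using u(3)[of s] r that by auto
    qed
    show ?thesis
      by (rule that[OF visit(1) _ visit(2) inT]) (use \<open>T \<le> r\<close> r in auto)
  qed
qed

text \<open>No state is entered between the entry of \<open>y\<close> and the jump from \<open>y\<close> to \<open>x\<close>. Therefore the information
  variables of \<open>x\<close> and \<open>y\<close> only differ in the coordinate \<open>x\<close>.\<close>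

lemma entry_time_le_iff_of_jump:
  assumes T: "entry_time Z x \<omega> = ereal T" and y: "ZJ_left Z T \<omega> = y" "y \<noteq> x" and "z \<noteq> x"
  shows "entry_time Z z \<omega> \<le> ereal T \<longleftrightarrow> entry_time Z z \<omega> \<le> entry_time Z y \<omega>"
    and "entry_time Z y \<omega> < ereal T"
proof -
  have T0: "0 < T"
  proof (rule ccontr)
    assume "\<not> 0 < T"
    then have "T = 0" using entry_time_leD[OF T] by auto
    then show False using y entry_time_leD[OF T] by (simp add: ZJ_left_def left_lim_def)
  qed
  obtain U where U: "0 \<le> U" "U < T" "entry_time Z y \<omega> = ereal U"
    "\<And>s. U \<le> s \<Longrightarrow> s < T \<Longrightarrow> ZJ Z s \<omega> = y"
    using ZJ_left_visit[OF T0 y(1)] by blast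
  show "entry_time Z y \<omega> < ereal T" using U by simp
  show "entry_time Z z \<omega> \<le> ereal T \<longleftrightarrow> entry_time Z z \<omega> \<le> entry_time Z y \<omega>"
  proof
    assume *: "entry_time Z z \<omega> \<le> ereal T"
    then obtain R where R: "entry_time Z z \<omega> = ereal R"
      using entry_time_nonneg[of z] by (cases "entry_time Z z \<omega>") auto
    have "R \<noteq> T" using entry_time_leD[OF R] entry_time_leD[OF T] \<open>z \<noteq> x\<close> by auto
    then have "R < T" using * R by auto
    then have "R \<le> U" using U(4)[of R] entry_time_leD[OF R] U(3) R by fastforce
    then show "entry_time Z z \<omega> \<le> entry_time Z y \<omega>" using U R by simp
  next
    assume "entry_time Z z \<omega> \<le> entry_time Z y \<omega>"
    then show "entry_time Z z \<omega> \<le> ereal T" using U by (auto intro: order_trans)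
  qed
qed

text \<open>The previous state in terms of the entry times alone, which makes it accessible to measurability
  arguments\<close>

lemma ZJ_left_entry_iff:
  assumes T: "entry_time Z x \<omega> = ereal T" and "y \<noteq> x"
  shows "ZJ_left Z T \<omega> = y \<longleftrightarrow> entry_time Z y \<omega> < ereal T \<and>
    (\<forall>z. \<not> (entry_time Z y \<omega> < entry_time Z z \<omega> \<and> entry_time Z z \<omega> < ereal T))"
proof
  assume *: "ZJ_left Z T \<omega> = y"
  note e = entry_time_le_iff_of_jump[OF T *]
  show "entry_time Z y \<omega> < ereal T \<and>
    (\<forall>z. \<not> (entry_time Z y \<omega> < entry_time Z z \<omega> \<and> entry_time Z z \<omega> < ereal T))"
    using e(1) e(2)[of y] assms by (metis less_le_not_le)
next
  assume *: "entry_time Z y \<omega> < ereal T \<and>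
    (\<forall>z. \<not> (entry_time Z y \<omega> < entry_time Z z \<omega> \<and> entry_time Z z \<omega> < ereal T))"
  have T0: "0 < T" using * entry_time_nonneg[of y] by (metis ereal_less(2) le_less_trans)
  define z where "z = ZJ_left Z T \<omega>"
  obtain U where U: "0 \<le> U" "U < T" "entry_time Z z \<omega> = ereal U"
    "\<And>s. U \<le> s \<Longrightarrow> s < T \<Longrightarrow> ZJ Z s \<omega> = z"
    using ZJ_left_visit[OF T0] z_def by blast
  have "entry_time Z z \<omega> \<le> entry_time Z y \<omega>" using * U by (metis ereal_less_le less_ereal.simps(1) not_le)
  moreover obtain R where R: "entry_time Z y \<omega> = ereal R" "R < T"
    using * entry_time_nonneg[of y] by (cases "entry_time Z y \<omega>") auto
  ultimately have "ZJ Z R \<omega> = z" using U by auto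
  then show "ZJ_left Z T \<omega> = y" using entry_time_leD(2)[OF R(1)] z_def by simp
qed

end

text \<open>The infimum of the empty set makes this infinite if the state is never entered or never left.\<close>

definition exit_time ::
  "(real \<Rightarrow> 'a \<Rightarrow> 's::{countable,discrete_topology}) \<Rightarrow> 's \<times> nat \<Rightarrow> 'a \<Rightarrow> ereal" where
  "exit_time Z x \<omega> = (INF t\<in>{t. 0 \<le> t \<and> entry_time Z x \<omega> \<le> ereal t \<and> ZJ Z t \<omega> \<noteq> x}. ereal t)"

context jump_path
begin

lemma ZJ_iff_times:
  assumes "0 \<le> t"
  shows "ZJ Z t \<omega> = x \<longleftrightarrow> entry_time Z x \<omega> \<le> ereal t \<and> ereal t < exit_time Z x \<omega>"
proof
  assume x: "ZJ Z t \<omega> = x"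
  have le: "entry_time Z x \<omega> \<le> ereal t" by (rule entry_time_le[OF assms x])
  then obtain T where T: "entry_time Z x \<omega> = ereal T" "0 \<le> T" "T \<le> t" "ZJ Z T \<omega> = x"
    by (cases x rule: entry_time_cases) auto
  obtain v where v: "t < v" "\<And>s. t \<le> s \<Longrightarrow> s < v \<Longrightarrow> ZJ Z s \<omega> = ZJ Z t \<omega>"
    using ZJ_right_constant[OF assms] by blast
  have "ereal v \<le> exit_time Z x \<omega>"
    unfolding exit_time_def
  proof (rule INF_greatest)
    fix s assume "s \<in> {s. 0 \<le> s \<and> entry_time Z x \<omega> \<le> ereal s \<and> ZJ Z s \<omega> \<noteq> x}"
    then have s: "T \<le> s" "ZJ Z s \<omega> \<noteq> x" using T by auto
    then have "\<not> s \<le> t" using ZJ_interval[OF T(2) s(1) _ T(4) x] by auto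
    then have "\<not> s < v" using v(2)[of s] s x by auto
    then show "ereal v \<le> ereal s" by simp
  qed
  then show "entry_time Z x \<omega> \<le> ereal t \<and> ereal t < exit_time Z x \<omega>"
    using le v(1) by (auto intro: less_le_trans[of _ "ereal v"])
next
  assume *: "entry_time Z x \<omega> \<le> ereal t \<and> ereal t < exit_time Z x \<omega>"
  show "ZJ Z t \<omega> = x"
  proof (rule ccontr)
    assume "ZJ Z t \<omega> \<noteq> x"
    then have "exit_time Z x \<omega> \<le> ereal t"
      unfolding exit_time_def using * assms by (intro INF_lower) auto
    then show False using * by auto
  qed
qed

lemma ZJ_left_iff_times:
  assumes "0 < t"
  shows "ZJ_left Z t \<omega> = x \<longleftrightarrow> entry_time Z x \<omega> < ereal t \<and> ereal t \<le> exit_time Z x \<omega>"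
proof
  assume "ZJ_left Z t \<omega> = x"
  from ZJ_left_visit[OF assms this]
  obtain T where T: "0 \<le> T" "T < t" "entry_time Z x \<omega> = ereal T"
    "\<And>s. T \<le> s \<Longrightarrow> s < t \<Longrightarrow> ZJ Z s \<omega> = x" by blast
  have "ereal t \<le> exit_time Z x \<omega>"
    unfolding exit_time_def T(3) by (rule INF_greatest) (use T(4) in force)
  then show "entry_time Z x \<omega> < ereal t \<and> ereal t \<le> exit_time Z x \<omega>" using T by auto
next
  assume *: "entry_time Z x \<omega> < ereal t \<and> ereal t \<le> exit_time Z x \<omega>"
  then obtain T where T: "0 \<le> T" "T < t" "entry_time Z x \<omega> = ereal T"
    using entry_time_nonneg[of x] by (cases "entry_time Z x \<omega>") auto
  show "ZJ_left Z t \<omega> = x"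
    unfolding ZJ_left_def
  proof (rule left_lim_eqI[OF assms T(2)])
    fix s assume s: "T < s" "s < t"
    then have "ereal s < exit_time Z x \<omega>" using * by (meson less_ereal.simps(1) less_le_trans)
    then show "ZJ Z s \<omega> = x" using s T by (subst ZJ_iff_times) auto
  qed
qed

lemma entry_less_exit:
  assumes "entry_time Z x \<omega> \<noteq> \<infinity>"
  shows "entry_time Z x \<omega> < exit_time Z x \<omega>"
proof -
  obtain T where T: "entry_time Z x \<omega> = ereal T"
    using assms entry_time_nonneg[of x] by (cases "entry_time Z x \<omega>") auto
  show ?thesis
    using entry_time_leD(1,2)[OF T] ZJ_iff_times[of T x] T by simp
qed

lemma exits_at_entry: "entry_time Z (j, n) \<omega> = ereal T \<Longrightarrow> exits Z j T \<omega> = n"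
  by (drule entry_time_leD(2)) (simp add: ZJ_eq_iff)

lemma visited_le_exits:
  assumes "entry_time Z (j, n) \<omega> < ereal t"
  shows "n \<le> exits Z j t \<omega>"
proof -
  obtain T where T: "entry_time Z (j, n) \<omega> = ereal T"
    using assms entry_time_nonneg[of "(j, n)"] by (cases "entry_time Z (j, n) \<omega>") auto
  show ?thesis
    using exits_at_entry[OF T] exits_mono[of T t j] T assms by simp
qed

lemma finite_visited: "finite {n. entry_time Z (j, n) \<omega> < ereal t}"
  by (rule finite_subset[of _ "{..exits Z j t \<omega>}"]) (use visited_le_exits in auto)

lemma ZJ_left_sojourn_eq:
  assumes "entry_time Z x \<omega> < ereal t"
  shows "{s \<in> {0<..t}. ZJ_left Z s \<omega> = x} =
      {real_of_ereal (entry_time Z x \<omega>) <.. real_of_ereal (min (exit_time Z x \<omega>) (ereal t))}"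
    and "real_of_ereal (entry_time Z x \<omega>) < real_of_ereal (min (exit_time Z x \<omega>) (ereal t))"
    and "0 \<le> real_of_ereal (entry_time Z x \<omega>)"
proof -
  obtain T where T: "entry_time Z x \<omega> = ereal T" "0 \<le> T"
    using assms entry_time_nonneg[of x] by (cases "entry_time Z x \<omega>") auto
  have "entry_time Z x \<omega> < exit_time Z x \<omega>" using T by (intro entry_less_exit) auto
  then have "ereal T < min (exit_time Z x \<omega>) (ereal t)" using T assms by simp
  moreover have "min (exit_time Z x \<omega>) (ereal t) \<le> ereal t" by simp
  ultimately obtain m where m: "min (exit_time Z x \<omega>) (ereal t) = ereal m" "T < m"
    by (cases "min (exit_time Z x \<omega>) (ereal t)") auto
  have "ereal s \<le> ereal m \<longleftrightarrow> ereal s \<le> exit_time Z x \<omega> \<and> s \<le> t" for s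
    unfolding m(1)[symmetric] by simp
  then have "s \<in> {0<..t} \<and> ZJ_left Z s \<omega> = x \<longleftrightarrow> s \<in> {T<..m}" for s
    using T ZJ_left_iff_times[of s x] by (cases "0 < s") auto
  then have "{s \<in> {0<..t}. ZJ_left Z s \<omega> = x} = {T<..m}" by blast
  then show "{s \<in> {0<..t}. ZJ_left Z s \<omega> = x} =
      {real_of_ereal (entry_time Z x \<omega>) <.. real_of_ereal (min (exit_time Z x \<omega>) (ereal t))}"
    using T m by simp
  show "real_of_ereal (entry_time Z x \<omega>) < real_of_ereal (min (exit_time Z x \<omega>) (ereal t))"
    "0 \<le> real_of_ereal (entry_time Z x \<omega>)"
    using T m by auto
qed

text \<open>No exit from \<open>j\<close> happens within a component of a sojourn set of \<open>j\<close>, whereas different components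
  are separated by one. So the counter of exits labels the components.\<close>

lemma sojourn_component:
  assumes s: "0 < s" "s \<le> t" "Z_left Z s \<omega> = j"
  shows "connected_component_set {s \<in> {0<..t}. Z_left Z s \<omega> = j} s =
    {r \<in> {0<..t}. ZJ_left Z r \<omega> = (j, exits Z j s \<omega>)}" (is "connected_component_set ?A s = ?K")
proof (intro equalityI subsetI)
  have sK: "s \<in> ?K" using s by (simp add: ZJ_left_eq)
  fix r assume "r \<in> ?K"
  moreover have "connected ?K"
  proof -
    have "entry_time Z (j, exits Z j s \<omega>) \<omega> < ereal s"
      using sK s by (simp add: ZJ_left_iff_times)
    also have "\<dots> \<le> ereal t" using s by simp
    finally have e: "entry_time Z (j, exits Z j s \<omega>) \<omega> < ereal t" .
    show ?thesis unfolding ZJ_left_sojourn_eq(1)[OF e] by simp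
  qed
  moreover have "?K \<subseteq> ?A" by (auto simp: ZJ_left_eq)
  ultimately show "r \<in> connected_component_set ?A s"
    using sK by (auto simp: connected_component_def)
next
  fix r assume "r \<in> connected_component_set ?A s"
  then obtain C where C: "connected C" "C \<subseteq> ?A" "s \<in> C" "r \<in> C"
    by (auto simp: connected_component_def)
  have *: "exits Z j p \<omega> = exits Z j q \<omega>" if "p \<le> q" "p \<in> C" "q \<in> C" for p q
  proof (rule exits_eqI[OF that(1)])
    fix u assume u: "0 < u" "p \<le> u" "u < q"
    then have u0: "0 \<le> u" by simp
    obtain v where v: "u < v" "\<And>w. u \<le> w \<Longrightarrow> w < v \<Longrightarrow> Z w \<omega> = Z u \<omega>"
      "\<And>w. u < w \<Longrightarrow> w < v \<Longrightarrow> Z_left Z w \<omega> = Z u \<omega>"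
      using no_jump_right[OF u0] by blast
    define w where "w = (u + min v q) / 2"
    have w: "u < w" "w < v" "w \<le> q" using u v(1) by (auto simp: w_def min_def field_simps)
    have "w \<in> C" using connected_contains_Icc[OF C(1) that(2,3)] u w by auto
    then show "Z u \<omega> = j" using C(2) v(3)[OF w(1,2)] by auto
  qed
  have "exits Z j r \<omega> = exits Z j s \<omega>"
    by (metis * C(3,4) linear)
  moreover have "r \<in> ?A" using C by auto
  ultimately show "r \<in> ?K" by (simp add: ZJ_left_eq)
qed

lemma sojourn_components:
  "components {s \<in> {0<..t}. Z_left Z s \<omega> = j} =
    (\<lambda>n. {s \<in> {0<..t}. ZJ_left Z s \<omega> = (j, n)}) ` {n. entry_time Z (j, n) \<omega> < ereal t}"
    (is "components ?A = ?K ` ?N")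
proof (intro equalityI subsetI)
  fix C assume "C \<in> components ?A"
  then obtain s where s: "s \<in> ?A" "C = connected_component_set ?A s"
    by (auto simp: components_def)
  then have C: "C = ?K (exits Z j s \<omega>)" using sojourn_component[of s t j] by auto
  have "ZJ_left Z s \<omega> = (j, exits Z j s \<omega>)" using s by (simp add: ZJ_left_eq)
  then have "entry_time Z (j, exits Z j s \<omega>) \<omega> < ereal s" using s by (simp add: ZJ_left_iff_times)
  also have "ereal s \<le> ereal t" using s by simp
  finally show "C \<in> ?K ` ?N" using C by auto
next
  fix C assume "C \<in> ?K ` ?N"
  then obtain n where n: "entry_time Z (j, n) \<omega> < ereal t" "C = ?K n" by auto
  have "C \<noteq> {}" unfolding n(2) ZJ_left_sojourn_eq(1)[OF n(1)] using ZJ_left_sojourn_eq(2)[OF n(1)] by simp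
  then obtain s where s: "s \<in> ?A" "ZJ_left Z s \<omega> = (j, n)" using n by (auto simp: ZJ_left_eq)
  then have "exits Z j s \<omega> = n" by (simp add: ZJ_left_eq)
  then have "C = connected_component_set ?A s" using sojourn_component[of s t j] s n by auto
  then show "C \<in> components ?A" using s by (auto simp: components_def)
qed

lemma sojourn_integral_eq:
  "sojourn_integral Z j f t \<omega> = (\<Sum>n\<in>{n. entry_time Z (j, n) \<omega> < ereal t}.
     f (real_of_ereal (min (exit_time Z (j, n) \<omega>) (ereal t))) \<omega> - f (real_of_ereal (entry_time Z (j, n) \<omega>)) \<omega>)"
proof -
  let ?K = "\<lambda>n. {s \<in> {0<..t}. ZJ_left Z s \<omega> = (j, n)}"
  let ?N = "{n. entry_time Z (j, n) \<omega> < ereal t}"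
  have ne: "?K n \<noteq> {}" if "n \<in> ?N" for n
  proof -
    have e: "entry_time Z (j, n) \<omega> < ereal t" using that by simp
    show ?thesis unfolding ZJ_left_sojourn_eq(1)[OF e] using ZJ_left_sojourn_eq(2)[OF e] by simp
  qed
  have inj: "inj_on ?K ?N"
  proof (rule inj_onI)
    fix m n assume mn: "m \<in> ?N" "n \<in> ?N" "?K m = ?K n"
    obtain s where s: "s \<in> ?K m" using ne[OF mn(1)] by blast
    have "s \<in> ?K n" using s unfolding mn(3) .
    with s show "m = n" by auto
  qed
  have "sojourn_integral Z j f t \<omega> = (\<Sum>n\<in>?N. f (Sup (?K n)) \<omega> - f (Inf (?K n)) \<omega>)"
    unfolding sojourn_integral_def sojourn_components by (subst sum.reindex[OF inj]) simp
  also have "\<dots> = (\<Sum>n\<in>?N. f (real_of_ereal (min (exit_time Z (j, n) \<omega>) (ereal t))) \<omega>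
      - f (real_of_ereal (entry_time Z (j, n) \<omega>)) \<omega>)"
  proof (rule sum.cong[OF refl])
    fix n assume "n \<in> ?N"
    then have e: "entry_time Z (j, n) \<omega> < ereal t" by simp
    show "f (Sup (?K n)) \<omega> - f (Inf (?K n)) \<omega> =
      f (real_of_ereal (min (exit_time Z (j, n) \<omega>) (ereal t))) \<omega> - f (real_of_ereal (entry_time Z (j, n) \<omega>)) \<omega>"
      unfolding ZJ_left_sojourn_eq(1)[OF e] using ZJ_left_sojourn_eq(2)[OF e] by simp
  qed
  finally show ?thesis .
qed

text \<open>The right-hand side only involves rational times, which makes the exit counter measurable.\<close>

lemma Suc_le_exits_iff:
  "Suc n \<le> exits Z j t \<omega> \<longleftrightarrow>
    (\<exists>q\<in>\<rat>. \<exists>r\<in>\<rat>. 0 \<le> q \<and> q < r \<and> r < t \<and> n \<le> exits Z j q \<omega> \<and> Z q \<omega> = j \<and> Z r \<omega> \<noteq> j)"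
proof
  assume "\<exists>q\<in>\<rat>. \<exists>r\<in>\<rat>. 0 \<le> q \<and> q < r \<and> r < t \<and> n \<le> exits Z j q \<omega> \<and> Z q \<omega> = j \<and> Z r \<omega> \<noteq> j"
  then obtain q r where *: "0 \<le> q" "q < r" "r < t" "n \<le> exits Z j q \<omega>" "Z q \<omega> = j" "Z r \<omega> \<noteq> j" by auto
  show "Suc n \<le> exits Z j t \<omega>" using exits_less_of_leave[OF *(1-3,5,6)] *(4) by simp
next
  assume *: "Suc n \<le> exits Z j t \<omega>"
  define E where "E s = {r. 0 < r \<and> r < s \<and> Z_left Z r \<omega> = j \<and> Z r \<omega> \<noteq> j}" for s
  have fin: "finite (E s)" for s unfolding E_def by (rule finite_exits)
  have ex: "exits Z j s \<omega> = card (E s)" for s unfolding E_def by (rule exits_eq_card)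
  have "E t \<noteq> {}" using * ex[of t] by auto
  define u where "u = Max (E t)"
  have uE: "u \<in> E t" using \<open>E t \<noteq> {}\<close> fin by (auto simp: u_def)
  then have u: "0 < u" "u < t" "Z_left Z u \<omega> = j" "Z u \<omega> \<noteq> j" by (auto simp: E_def)
  have "E t \<subseteq> insert u (E u)"
  proof
    fix r assume r: "r \<in> E t"
    then have "r \<le> u" using fin by (auto simp: u_def)
    then show "r \<in> insert u (E u)" using r by (auto simp: E_def)
  qed
  then have "card (E t) \<le> Suc (card (E u))"
    using card_mono[OF _ \<open>E t \<subseteq> insert u (E u)\<close>] fin by (auto simp: card_insert_if split: if_splits)
  then have n: "n \<le> exits Z j u \<omega>" using * ex by simp
  obtain v where v: "0 \<le> v" "v < u" "\<And>s j. v < s \<Longrightarrow> s \<le> u \<Longrightarrow> exits Z j s \<omega> = exits Z j u \<omega>"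
    "\<And>s. v < s \<Longrightarrow> s < u \<Longrightarrow> Z s \<omega> = Z_left Z u \<omega>"
    using exits_left_constant[OF u(1)] by metis
  have u0: "0 \<le> u" using u by simp
  obtain w where w: "u < w" "\<And>s. u \<le> s \<Longrightarrow> s < w \<Longrightarrow> Z s \<omega> = Z u \<omega>"
    using right_constant[OF u0] by blast
  obtain q where q: "q \<in> \<rat>" "v < q" "q < u" using Rats_dense_in_real[OF v(2)] by auto
  obtain r where r: "r \<in> \<rat>" "u < r" "r < min w t"
    using Rats_dense_in_real[of u "min w t"] u w(1) by auto
  have "Z r \<omega> \<noteq> j" using w(2)[of r] r u by simp
  moreover have "Z q \<omega> = j" "n \<le> exits Z j q \<omega>" using v(3)[of q j] v(4)[of q] q u n by auto
  ultimately show "\<exists>q\<in>\<rat>. \<exists>r\<in>\<rat>. 0 \<le> q \<and> q < r \<and> r < t \<and> n \<le> exits Z j q \<omega> \<and> Z q \<omega> = j \<and> Z r \<omega> \<noteq> j"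
    using q r v(1) by (intro bexI[of _ q] bexI[of _ r]) auto
qed

end

section \<open>Right-continuous functions and finite variation\<close>

text \<open>The smallest multiple of \<open>1/2\<^sup>n\<close> that is strictly larger than \<open>x\<close>. Strictness makes limits along
  these points limits from the right.\<close>

definition dyadic_above :: "nat \<Rightarrow> real \<Rightarrow> real" where
  "dyadic_above n x = (of_int \<lfloor>2 ^ n * x\<rfloor> + 1) / 2 ^ n"

lemma dyadic_above_gt: "x < dyadic_above n x"
proof -
  have "2 ^ n * x < of_int \<lfloor>2 ^ n * x\<rfloor> + 1" by linarith
  then show ?thesis by (simp add: dyadic_above_def field_simps)
qed

lemma dyadic_above_le: "dyadic_above n x \<le> x + (1/2) ^ n"
proof -
  have "of_int \<lfloor>2 ^ n * x\<rfloor> + 1 \<le> 2 ^ n * x + 1" by linarith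
  then show ?thesis by (simp add: dyadic_above_def field_simps)
qed

lemma dyadic_above_le_plus1: "dyadic_above n x \<le> x + 1"
  using dyadic_above_le[of n x] power_le_one[of "1/2::real" n] by simp

lemma dyadic_above_mono: "x \<le> y \<Longrightarrow> dyadic_above n x \<le> dyadic_above n y"
  by (simp add: dyadic_above_def divide_right_mono floor_mono)

lemma dyadic_above_Rats: "dyadic_above n x \<in> \<rat>"
  by (simp add: dyadic_above_def)

lemma dyadic_above_at_right: "filterlim (\<lambda>n. dyadic_above n x) (at_right x) sequentially"
proof (rule tendsto_imp_filterlim_at_right)
  have "(\<lambda>n. x + (1/2) ^ n) \<longlonglongrightarrow> x + 0"
    by (intro tendsto_add tendsto_const LIMSEQ_realpow_zero) auto
  then have lim: "(\<lambda>n. x + (1/2) ^ n) \<longlonglongrightarrow> x" by simp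
  show "(\<lambda>n. dyadic_above n x) \<longlonglongrightarrow> x"
    by (rule tendsto_sandwich[OF _ _ tendsto_const lim])
      (auto intro: always_eventually dyadic_above_le less_imp_le dyadic_above_gt)
  show "\<forall>\<^sub>F n in sequentially. x < dyadic_above n x" by (simp add: dyadic_above_gt)
qed

lemma tendsto_dyadic_above:
  "continuous (at_right x) f \<Longrightarrow> (\<lambda>n. f (dyadic_above n x)) \<longlonglongrightarrow> f x"
  unfolding continuous_within by (rule filterlim_compose[OF _ dyadic_above_at_right])

definition partition_sum :: "(real \<Rightarrow> real) \<Rightarrow> real list \<Rightarrow> real" where
  "partition_sum f xs = (\<Sum>i<length xs - 1. \<bar>f (xs ! Suc i) - f (xs ! i)\<bar>)"

lemma variation_eq:
  "variation f a b = (\<Squnion>xs\<in>{xs. sorted xs \<and> set xs \<subseteq> {a..b}}. ennreal (partition_sum f xs))"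
  by (simp add: variation_def partition_sum_def sum_ennreal)

lemma partition_sum_le_variation:
  "sorted xs \<Longrightarrow> set xs \<subseteq> {a..b} \<Longrightarrow> ennreal (partition_sum f xs) \<le> variation f a b"
  unfolding variation_eq by (intro SUP_upper) auto

lemma variation_leI:
  assumes "\<And>xs. sorted xs \<Longrightarrow> set xs \<subseteq> {a..b} \<Longrightarrow> partition_sum f xs \<le> K"
  shows "variation f a b \<le> ennreal K"
  unfolding variation_eq using assms by (intro SUP_least ennreal_leI) auto

lemma partition_sum_le_enn2real:
  assumes "variation f a b < \<infinity>" "sorted xs" "set xs \<subseteq> {a..b}"
  shows "partition_sum f xs \<le> enn2real (variation f a b)"
proof -
  have "ennreal (partition_sum f xs) \<le> ennreal (enn2real (variation f a b))"
    using partition_sum_le_variation[OF assms(2,3), of f] assms(1) by (simp add: ennreal_enn2real_if)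
  then show ?thesis by (subst (asm) ennreal_le_iff) auto
qed

lemma partition_sum_pair: "partition_sum f [x, y] = \<bar>f y - f x\<bar>"
  by (simp add: partition_sum_def)

lemma abs_le_of_partition_sums:
  assumes "0 \<le> x" "x \<le> t" and "\<And>xs. sorted xs \<Longrightarrow> set xs \<subseteq> {0..t} \<Longrightarrow> partition_sum f xs \<le> K"
  shows "\<bar>f x\<bar> \<le> \<bar>f 0\<bar> + K"
  using assms(3)[of "[0, x]"] assms(1,2) by (simp add: partition_sum_pair)

lemma partition_sum_dominated:
  assumes "sorted xs" "set xs \<subseteq> {a..b}"
    and le: "\<And>x y. a \<le> x \<Longrightarrow> x \<le> y \<Longrightarrow> y \<le> b \<Longrightarrow> \<bar>F y - F x\<bar> \<le> A * \<bar>f y - f x\<bar> + B * \<bar>g y - g x\<bar>"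
  shows "partition_sum F xs \<le> A * partition_sum f xs + B * partition_sum g xs"
proof -
  have "partition_sum F xs \<le> (\<Sum>i<length xs - 1. A * \<bar>f (xs ! Suc i) - f (xs ! i)\<bar> +
      B * \<bar>g (xs ! Suc i) - g (xs ! i)\<bar>)"
    unfolding partition_sum_def
  proof (rule sum_mono)
    fix i assume "i \<in> {..<length xs - 1}"
    then have i: "i < length xs" "Suc i < length xs" by auto
    then have "xs ! i \<in> {a..b}" "xs ! Suc i \<in> {a..b}" using assms(2) nth_mem by blast+
    moreover have "xs ! i \<le> xs ! Suc i" using assms(1) i sorted_nth_mono[of xs i "Suc i"] by simp
    ultimately show "\<bar>F (xs ! Suc i) - F (xs ! i)\<bar> \<le>
        A * \<bar>f (xs ! Suc i) - f (xs ! i)\<bar> + B * \<bar>g (xs ! Suc i) - g (xs ! i)\<bar>"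
      by (intro le) auto
  qed
  then show ?thesis by (simp add: partition_sum_def sum.distrib sum_distrib_left)
qed

lemma partition_sum_mono_fun:
  assumes "sorted xs" "mono_on (set xs) f" "\<And>x. 0 \<le> f x \<and> f x \<le> 1"
  shows "partition_sum f xs \<le> 1"
proof -
  have "partition_sum f xs = (\<Sum>i<length xs - 1. f (xs ! Suc i) - f (xs ! i))"
    unfolding partition_sum_def
  proof (rule sum.cong[OF refl])
    fix i assume "i \<in> {..<length xs - 1}"
    then have i: "i < length xs" "Suc i < length xs" by auto
    then have "f (xs ! i) \<le> f (xs ! Suc i)"
      using assms(1,2) sorted_nth_mono[of xs i "Suc i"] by (auto simp: mono_on_def)
    then show "\<bar>f (xs ! Suc i) - f (xs ! i)\<bar> = f (xs ! Suc i) - f (xs ! i)" by simp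
  qed
  also have "\<dots> = f (xs ! (length xs - 1)) - f (xs ! 0)"
    by (rule sum_lessThan_telescope)
  also have "\<dots> \<le> 1" using assms(3)[of "xs ! 0"] assms(3)[of "xs ! (length xs - 1)"] by simp
  finally show ?thesis .
qed

lemma finite_variation_boundE:
  assumes "finite_variation_on_compacts f" "0 \<le> t"
  obtains K where "0 \<le> K" "\<And>xs. sorted xs \<Longrightarrow> set xs \<subseteq> {0..t} \<Longrightarrow> partition_sum f xs \<le> K"
    "\<And>x. 0 \<le> x \<Longrightarrow> x \<le> t \<Longrightarrow> \<bar>f x\<bar> \<le> K"
proof -
  define K where "K = enn2real (variation f 0 t)"
  have K: "partition_sum f xs \<le> K" if "sorted xs" "set xs \<subseteq> {0..t}" for xs
    unfolding K_def using assms that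
    by (intro partition_sum_le_enn2real) (auto simp: finite_variation_on_compacts_def)
  have "\<bar>f x\<bar> \<le> \<bar>f 0\<bar> + K" if "0 \<le> x" "x \<le> t" for x
    using that K by (rule abs_le_of_partition_sums)
  then show ?thesis using that[of "\<bar>f 0\<bar> + K"] K by (force simp: K_def)
qed

lemma finite_variationI:
  assumes "\<And>t. 0 \<le> t \<Longrightarrow> \<exists>K. \<forall>xs. sorted xs \<longrightarrow> set xs \<subseteq> {0..t} \<longrightarrow> partition_sum f xs \<le> K"
  shows "finite_variation_on_compacts f"
  unfolding finite_variation_on_compacts_def
proof (intro allI impI)
  fix t :: real assume "0 \<le> t"
  from assms[OF this] obtain K
    where "\<And>xs. sorted xs \<Longrightarrow> set xs \<subseteq> {0..t} \<Longrightarrow> partition_sum f xs \<le> K" by blast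
  then have "variation f 0 t \<le> ennreal K" by (rule variation_leI)
  also have "\<dots> < \<infinity>" by simp
  finally show "variation f 0 t < \<infinity>" .
qed

text \<open>All closure properties of functions of finite variation below are instances of this
  comparison of increments.\<close>

lemma finite_variation_dominated:
  assumes f: "finite_variation_on_compacts f" and g: "finite_variation_on_compacts g"
    and le: "\<And>t. 0 \<le> t \<Longrightarrow> \<exists>A\<ge>0. \<exists>B\<ge>0. \<forall>x y. 0 \<le> x \<longrightarrow> x \<le> y \<longrightarrow> y \<le> t \<longrightarrow>
      \<bar>F y - F x\<bar> \<le> A * \<bar>f y - f x\<bar> + B * \<bar>g y - g x\<bar>"
  shows "finite_variation_on_compacts F"
proof (rule finite_variationI)
  fix t :: real assume t: "0 \<le> t"
  obtain A B where AB: "0 \<le> A" "0 \<le> B"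
    "\<And>x y. 0 \<le> x \<Longrightarrow> x \<le> y \<Longrightarrow> y \<le> t \<Longrightarrow> \<bar>F y - F x\<bar> \<le> A * \<bar>f y - f x\<bar> + B * \<bar>g y - g x\<bar>"
    using le[OF t] by blast
  obtain K where K: "\<And>xs. sorted xs \<Longrightarrow> set xs \<subseteq> {0..t} \<Longrightarrow> partition_sum f xs \<le> K"
    using finite_variation_boundE[OF f t] by metis
  obtain L where L: "\<And>xs. sorted xs \<Longrightarrow> set xs \<subseteq> {0..t} \<Longrightarrow> partition_sum g xs \<le> L"
    using finite_variation_boundE[OF g t] by metis
  have "partition_sum F xs \<le> A * K + B * L" if xs: "sorted xs" "set xs \<subseteq> {0..t}" for xs
  proof -
    have "partition_sum F xs \<le> A * partition_sum f xs + B * partition_sum g xs"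
      using xs AB(3) by (rule partition_sum_dominated)
    also have "\<dots> \<le> A * K + B * L"
      using AB K[OF xs] L[OF xs] by (intro add_mono mult_left_mono)
    finally show ?thesis .
  qed
  then show "\<exists>K. \<forall>xs. sorted xs \<longrightarrow> set xs \<subseteq> {0..t} \<longrightarrow> partition_sum F xs \<le> K" by blast
qed

definition cadlag_fv :: "(real \<Rightarrow> real) \<Rightarrow> bool" where
  "cadlag_fv f \<longleftrightarrow> cadlag f \<and> finite_variation_on_compacts f"

lemma cadlag_fv_const: "cadlag_fv (\<lambda>_. c)"
proof -
  have "finite_variation_on_compacts (\<lambda>_. c)"
    by (rule finite_variationI) (auto simp: partition_sum_def)
  then show ?thesis by (auto simp: cadlag_fv_def cadlag_def)
qed

lemma cadlag_fv_add:
  assumes "cadlag_fv f" "cadlag_fv g"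
  shows "cadlag_fv (\<lambda>t. f t + g t)"
  unfolding cadlag_fv_def
proof
  show "cadlag (\<lambda>t. f t + g t)"
    using assms unfolding cadlag_fv_def cadlag_def by (metis continuous_add tendsto_add)
  show "finite_variation_on_compacts (\<lambda>t. f t + g t)"
  proof (rule finite_variation_dominated[of f g])
    show "\<exists>A\<ge>0. \<exists>B\<ge>0. \<forall>x y. 0 \<le> x \<longrightarrow> x \<le> y \<longrightarrow> y \<le> t \<longrightarrow>
      \<bar>f y + g y - (f x + g x)\<bar> \<le> A * \<bar>f y - f x\<bar> + B * \<bar>g y - g x\<bar>" for t
      by (rule exI[of _ 1], simp, rule exI[of _ 1]) auto
  qed (use assms in \<open>auto simp: cadlag_fv_def\<close>)
qed

lemma cadlag_fv_mult:
  assumes "cadlag_fv f" "cadlag_fv g"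
  shows "cadlag_fv (\<lambda>t. f t * g t)"
  unfolding cadlag_fv_def
proof
  show "cadlag (\<lambda>t. f t * g t)"
    using assms unfolding cadlag_fv_def cadlag_def by (metis continuous_mult tendsto_mult)
  have fv: "finite_variation_on_compacts f" "finite_variation_on_compacts g"
    using assms by (auto simp: cadlag_fv_def)
  then show "finite_variation_on_compacts (\<lambda>t. f t * g t)"
  proof (rule finite_variation_dominated)
    fix t :: real assume t: "0 \<le> t"
    obtain K where K: "0 \<le> K" "\<And>x. 0 \<le> x \<Longrightarrow> x \<le> t \<Longrightarrow> \<bar>f x\<bar> \<le> K"
      using finite_variation_boundE[OF fv(1) t] by metis
    obtain L where L: "0 \<le> L" "\<And>x. 0 \<le> x \<Longrightarrow> x \<le> t \<Longrightarrow> \<bar>g x\<bar> \<le> L"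
      using finite_variation_boundE[OF fv(2) t] by metis
    have "\<bar>f y * g y - f x * g x\<bar> \<le> L * \<bar>f y - f x\<bar> + K * \<bar>g y - g x\<bar>"
      if "0 \<le> x" "x \<le> y" "y \<le> t" for x y
    proof -
      have "f y * g y - f x * g x = (f y - f x) * g y + f x * (g y - g x)" by (simp add: algebra_simps)
      also have "\<bar>\<dots>\<bar> \<le> \<bar>g y\<bar> * \<bar>f y - f x\<bar> + \<bar>f x\<bar> * \<bar>g y - g x\<bar>"
        by (rule order_trans[OF abs_triangle_ineq]) (simp add: abs_mult)
      also have "\<dots> \<le> L * \<bar>f y - f x\<bar> + K * \<bar>g y - g x\<bar>"
        using that K L by (intro add_mono mult_right_mono) auto
      finally show ?thesis .
    qed
    then show "\<exists>A\<ge>0. \<exists>B\<ge>0. \<forall>x y. 0 \<le> x \<longrightarrow> x \<le> y \<longrightarrow> y \<le> t \<longrightarrow>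
      \<bar>f y * g y - f x * g x\<bar> \<le> A * \<bar>f y - f x\<bar> + B * \<bar>g y - g x\<bar>"
      using K(1) L(1) by blast
  qed
qed

lemma cadlag_fv_inverse_max:
  assumes f: "cadlag_fv f" and "0 < \<epsilon>"
  shows "cadlag_fv (\<lambda>t. 1 / max \<epsilon> (f t))"
  unfolding cadlag_fv_def
proof
  have ne: "max \<epsilon> x \<noteq> 0" for x using \<open>0 < \<epsilon>\<close> by auto
  show "cadlag (\<lambda>t. 1 / max \<epsilon> (f t))"
    unfolding cadlag_def
  proof (intro conjI allI impI)
    fix t :: real
    show "continuous (at_right t) (\<lambda>t. 1 / max \<epsilon> (f t))" if "0 \<le> t"
      using f that ne unfolding cadlag_fv_def cadlag_def continuous_within
      by (intro tendsto_divide tendsto_max tendsto_const) auto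
    assume "0 < t"
    then obtain l where "(f \<longlongrightarrow> l) (at_left t)" using f by (auto simp: cadlag_fv_def cadlag_def)
    then have "((\<lambda>t. 1 / max \<epsilon> (f t)) \<longlongrightarrow> 1 / max \<epsilon> l) (at_left t)"
      using ne by (intro tendsto_divide tendsto_max tendsto_const)
    then show "\<exists>l. ((\<lambda>t. 1 / max \<epsilon> (f t)) \<longlongrightarrow> l) (at_left t)" by blast
  qed
  have fv: "finite_variation_on_compacts f" using f by (auto simp: cadlag_fv_def)
  show "finite_variation_on_compacts (\<lambda>t. 1 / max \<epsilon> (f t))"
  proof (rule finite_variation_dominated[OF fv fv])
    have "\<bar>1 / max \<epsilon> b - 1 / max \<epsilon> a\<bar> \<le> (1 / \<epsilon>\<^sup>2) * \<bar>b - a\<bar> + 0 * \<bar>b - a\<bar>" for a b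
    proof -
      define p q where "p = max \<epsilon> a" and "q = max \<epsilon> b"
      have pq: "\<epsilon> \<le> p" "\<epsilon> \<le> q" "\<bar>p - q\<bar> \<le> \<bar>b - a\<bar>" by (auto simp: p_def q_def)
      have "0 < p" "0 < q" using pq \<open>0 < \<epsilon>\<close> by auto
      then have "1 / q - 1 / p = (p - q) / (p * q)" by (simp add: field_simps)
      then have "\<bar>1 / q - 1 / p\<bar> = \<bar>p - q\<bar> / (p * q)" using \<open>0 < p\<close> \<open>0 < q\<close> by (simp add: abs_mult)
      also have "\<dots> \<le> \<bar>b - a\<bar> / (\<epsilon> * \<epsilon>)"
        using pq \<open>0 < \<epsilon>\<close> by (intro frac_le mult_mono) auto
      finally show ?thesis by (simp add: p_def q_def power2_eq_square)
    qed
    moreover have "0 \<le> 1 / \<epsilon>\<^sup>2" by simp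
    ultimately show "\<exists>A\<ge>0. \<exists>B\<ge>0. \<forall>x y. 0 \<le> x \<longrightarrow> x \<le> y \<longrightarrow> y \<le> t \<longrightarrow>
      \<bar>1 / max \<epsilon> (f y) - 1 / max \<epsilon> (f x)\<bar> \<le> A * \<bar>f y - f x\<bar> + B * \<bar>f y - f x\<bar>" for t
      by blast
  qed
qed

lemma partition_sum_step:
  assumes "sorted xs"
  shows "partition_sum (\<lambda>t. of_bool (c \<le> ereal t)) xs \<le> 1"
  using assms
proof (rule partition_sum_mono_fun)
  have "c \<le> ereal s" if "c \<le> ereal r" "r \<le> s" for r s
    using that(1) by (rule order_trans) (simp add: that(2))
  then show "mono_on (set xs) (\<lambda>t. of_bool (c \<le> ereal t) :: real)" by (auto simp: mono_on_def)
qed auto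

lemma cadlag_fv_step: "cadlag_fv (\<lambda>t. of_bool (c \<le> ereal t))"
  unfolding cadlag_fv_def
proof
  show "cadlag (\<lambda>t. of_bool (c \<le> ereal t) :: real)"
    unfolding cadlag_def continuous_within
  proof (intro conjI allI impI)
    fix t :: real
    have "eventually (\<lambda>s. (c \<le> ereal s) = (c \<le> ereal t)) (at_right t)"
    proof (cases "c \<le> ereal t")
      case True
      then show ?thesis
        by (auto simp: eventually_at_right_field intro!: exI[of _ "t + 1"] intro: order_trans)
    next
      case False
      then obtain u where "t < u" "ereal u < c"
        by (metis ereal_dense2 less_ereal.simps(1) not_le)
      then show ?thesis using False
        by (auto simp: eventually_at_right_field not_le intro!: exI[of _ u] intro: less_trans)
          (meson less_ereal.simps(1) less_trans not_le)
    qed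
    then show "((\<lambda>t. of_bool (c \<le> ereal t) :: real) \<longlongrightarrow> of_bool (c \<le> ereal t)) (at_right t)"
      by (intro tendsto_eventually) (auto elim: eventually_mono)
    have "eventually (\<lambda>s. (c \<le> ereal s) = (c < ereal t)) (at_left t)"
    proof (cases "c < ereal t")
      case True
      then obtain u where "u < t" "c < ereal u"
        by (metis ereal_dense2 less_ereal.simps(1))
      then show ?thesis using True
        by (auto simp: eventually_at_left_field intro!: exI[of _ u])
          (meson less_ereal.simps(1) less_trans less_imp_le)
    next
      case False
      then show ?thesis
        by (auto simp: eventually_at_left_field not_le not_less intro!: exI[of _ "t - 1"])
          (metis leD less_ereal.simps(1) less_le_trans not_le)
    qed
    then have "((\<lambda>t. of_bool (c \<le> ereal t) :: real) \<longlongrightarrow> of_bool (c < ereal t)) (at_left t)"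
      by (intro tendsto_eventually) (auto elim: eventually_mono)
    then show "\<exists>l. ((\<lambda>t. of_bool (c \<le> ereal t) :: real) \<longlongrightarrow> l) (at_left t)" by blast
  qed
  show "finite_variation_on_compacts (\<lambda>t. of_bool (c \<le> ereal t))"
  proof (rule finite_variationI, intro exI allI impI)
    fix xs :: "real list" assume "sorted xs"
    then show "partition_sum (\<lambda>t. of_bool (c \<le> ereal t)) xs \<le> 1" by (rule partition_sum_step)
  qed
qed

lemma cadlag_fv_sum:
  assumes "\<And>i. i \<in> I \<Longrightarrow> cadlag_fv (f i)"
  shows "cadlag_fv (\<lambda>t. \<Sum>i\<in>I. f i t)"
  using assms by (induction I rule: infinite_finite_induct) (auto intro: cadlag_fv_const cadlag_fv_add)

text \<open>The integral in the third property of state-wise reserves is a locally finite sum of infinitely many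
  contributions; this reduces it to finite sums.\<close>

lemma cadlag_fv_local:
  assumes "\<And>R. 0 \<le> R \<Longrightarrow> \<exists>F. cadlag_fv F \<and> (\<forall>t\<in>{0..R}. f t = F t)"
  shows "cadlag_fv f"
  unfolding cadlag_fv_def
proof
  show "cadlag f"
    unfolding cadlag_def continuous_within
  proof (intro conjI allI impI)
    fix t :: real assume "0 \<le> t"
    then obtain F where F: "cadlag_fv F" "\<forall>s\<in>{0..t+1}. f s = F s" using assms[of "t + 1"] by auto
    have "eventually (\<lambda>s. f s = F s) (at_right t)"
      using F(2) \<open>0 \<le> t\<close> by (auto simp: eventually_at_right_field intro!: exI[of _ "t + 1"])
    moreover have "(F \<longlongrightarrow> F t) (at_right t)"
      using F(1) \<open>0 \<le> t\<close> by (auto simp: cadlag_fv_def cadlag_def continuous_within)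
    ultimately show "(f \<longlongrightarrow> f t) (at_right t)"
      using F(2) \<open>0 \<le> t\<close> by (subst tendsto_cong) auto
  next
    fix t :: real assume "0 < t"
    then obtain F where F: "cadlag_fv F" "\<forall>s\<in>{0..t}. f s = F s" using assms[of t] by auto
    have "eventually (\<lambda>s. f s = F s) (at_left t)"
      using F(2) \<open>0 < t\<close> by (auto simp: eventually_at_left_field intro!: exI[of _ 0])
    moreover obtain l where "(F \<longlongrightarrow> l) (at_left t)"
      using F(1) \<open>0 < t\<close> by (auto simp: cadlag_fv_def cadlag_def)
    ultimately have "(f \<longlongrightarrow> l) (at_left t)" by (subst tendsto_cong)
    then show "\<exists>l. (f \<longlongrightarrow> l) (at_left t)" by blast
  qed
  show "finite_variation_on_compacts f"
  proof (rule finite_variationI)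
    fix t :: real assume t: "0 \<le> t"
    then obtain F where F: "cadlag_fv F" "\<forall>s\<in>{0..t}. f s = F s" using assms[of t] by auto
    then obtain K where K: "\<And>xs. sorted xs \<Longrightarrow> set xs \<subseteq> {0..t} \<Longrightarrow> partition_sum F xs \<le> K"
      using finite_variation_boundE[of F t] t by (metis cadlag_fv_def)
    have "partition_sum f xs \<le> K" if xs: "sorted xs" "set xs \<subseteq> {0..t}" for xs
    proof -
      have "partition_sum f xs \<le> 1 * partition_sum F xs + 0 * partition_sum F xs"
        using xs by (rule partition_sum_dominated) (use F(2) in auto)
      then show ?thesis using K[OF xs] by simp
    qed
    then show "\<exists>K. \<forall>xs. sorted xs \<longrightarrow> set xs \<subseteq> {0..t} \<longrightarrow> partition_sum f xs \<le> K" by blast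
  qed
qed

lemma cadlag_fv_cong:
  assumes "cadlag_fv F" "\<And>t. 0 \<le> t \<Longrightarrow> f t = F t"
  shows "cadlag_fv f"
  by (rule cadlag_fv_local) (use assms in auto)

lemma cadlag_fv_diff:
  assumes "cadlag_fv f" "cadlag_fv g"
  shows "cadlag_fv (\<lambda>t. f t - g t)"
  using cadlag_fv_add[OF assms(1) cadlag_fv_mult[OF cadlag_fv_const[of "- 1"] assms(2)]] by simp

text \<open>For a right-continuous function, the points of a partition can be moved to dyadic points slightly to
  the right, at the expense of a slightly larger interval.\<close>

lemma partition_sum_le_of_rational:
  assumes rc: "\<And>t. 0 \<le> t \<Longrightarrow> continuous (at_right t) f"
    and K: "\<And>xs. sorted xs \<Longrightarrow> set xs \<subseteq> {0..t+1} \<inter> \<rat> \<Longrightarrow> partition_sum f xs \<le> K"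
    and xs: "sorted xs" "set xs \<subseteq> {0..t}"
  shows "partition_sum f xs \<le> K"
proof (rule LIMSEQ_le_const2)
  let ?ys = "\<lambda>n. map (dyadic_above n) xs"
  have nth: "xs ! i \<in> {0..t}" if "i < length xs" for i
    using xs(2) nth_mem[OF that] by blast
  have "(\<lambda>n. \<Sum>i<length xs - 1. \<bar>f (dyadic_above n (xs ! Suc i)) - f (dyadic_above n (xs ! i))\<bar>)
      \<longlonglongrightarrow> (\<Sum>i<length xs - 1. \<bar>f (xs ! Suc i) - f (xs ! i)\<bar>)"
    by (intro tendsto_sum tendsto_rabs tendsto_diff tendsto_dyadic_above rc) (use nth in auto)
  then show "(\<lambda>n. partition_sum f (?ys n)) \<longlonglongrightarrow> partition_sum f xs"
    by (simp add: partition_sum_def)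
  have "partition_sum f (?ys n) \<le> K" for n
  proof (rule K)
    show "sorted (?ys n)"
      using xs(1) by (auto simp: sorted_map intro: sorted_wrt_mono_rel[OF dyadic_above_mono])
    have "0 \<le> dyadic_above n x" "dyadic_above n x \<le> t + 1" if "x \<in> set xs" for x
      using that xs(2) dyadic_above_gt[of x n] dyadic_above_le_plus1[of n x] by force+
    then show "set (?ys n) \<subseteq> {0..t+1} \<inter> \<rat>" by (auto simp: dyadic_above_Rats)
  qed
  then show "\<exists>N. \<forall>n\<ge>N. partition_sum f (?ys n) \<le> K" by blast
qed

section \<open>Right-continuity of the future payments\<close>

lemma right_continuous_tail_integral:
  fixes f :: "real \<Rightarrow> real"
  assumes f: "set_integrable \<mu> {0<..} f" and [measurable_cong, simp]: "sets \<mu> = sets borel" and "0 \<le> t"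
  shows "continuous (at_right t) (\<lambda>u. LINT s:{u<..}|\<mu>. f s)"
  unfolding continuous_within tendsto_at_iff_sequentially
proof (intro allI impI)
  fix X :: "nat \<Rightarrow> real" assume X: "\<forall>i. X i \<in> {t<..} - {t}" "X \<longlonglongrightarrow> t"
  have meas: "(\<lambda>s. indicator {0<..} s *\<^sub>R f s) \<in> borel_measurable \<mu>"
    using f by (auto simp: set_integrable_def)
  have eq: "indicator {u<..} s *\<^sub>R f s = indicator {u<..} s *\<^sub>R (indicator {0<..} s *\<^sub>R f s)"
    if "0 \<le> u" for u s :: real
    using that by (auto simp: indicator_def)
  have meas': "(\<lambda>s. indicator {u<..} s *\<^sub>R f s) \<in> borel_measurable \<mu>" if "0 \<le> u" for u
    unfolding eq[OF that] using meas by measurable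
  have Xt: "0 \<le> X i" "t < X i" for i using X(1) \<open>0 \<le> t\<close> by (auto simp: less_imp_le order_le_less_trans)
  show "((\<lambda>u. LINT s:{u<..}|\<mu>. f s) \<circ> X) \<longlonglongrightarrow> (LINT s:{t<..}|\<mu>. f s)"
    unfolding comp_def set_lebesgue_integral_def
  proof (rule integral_dominated_convergence)
    show "integrable \<mu> (\<lambda>s. norm (indicator {0<..} s *\<^sub>R f s))"
      using f by (intro integrable_norm) (simp add: set_integrable_def)
    show "AE s in \<mu>. (\<lambda>i. indicator {X i<..} s *\<^sub>R f s) \<longlonglongrightarrow> indicator {t<..} s *\<^sub>R f s"
    proof (rule AE_I2)
      fix s
      have "(\<lambda>i. indicator {X i<..} s :: real) \<longlonglongrightarrow> indicator {t<..} s"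
      proof (rule tendsto_eventually, cases "t < s")
        case True
        have "eventually (\<lambda>i. X i < s) sequentially" by (rule order_tendstoD(2)[OF X(2) True])
        then show "eventually (\<lambda>i. indicator {X i<..} s = (indicator {t<..} s :: real)) sequentially"
          using True by (auto elim: eventually_mono)
      next
        case False
        have "indicator {X i<..} s = (indicator {t<..} s :: real)" for i
          using False Xt(2)[of i] by (auto simp: indicator_def)
        then show "eventually (\<lambda>i. indicator {X i<..} s = (indicator {t<..} s :: real)) sequentially"
          by simp
      qed
      then show "(\<lambda>i. indicator {X i<..} s *\<^sub>R f s) \<longlonglongrightarrow> indicator {t<..} s *\<^sub>R f s"
        by (intro tendsto_scaleR tendsto_const)
    qed
    show "AE s in \<mu>. norm (indicator {X i<..} s *\<^sub>R f s) \<le> norm (indicator {0<..} s *\<^sub>R f s)" for i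
      using Xt(1)[of i] by (auto simp: indicator_def)
  qed (rule meas'[OF \<open>0 \<le> t\<close>] meas'[OF Xt(1)])+
qed

text \<open>The discount factor splits off, and the transition payments form a series of right-continuous functions
  that converges uniformly by the Weierstrass test.\<close>

lemma right_continuous_future_payments:
  assumes pc: "\<forall>t\<ge>0. payments_convergent Z \<tau> \<kappa> b bb t \<omega>"
    and \<kappa>: "cadlag \<kappa>" "\<kappa> 0 = 1" and "0 \<le> t"
  shows "continuous (at_right t) (\<lambda>t. future_payments Z \<tau> \<kappa> b bb t \<omega>)"
proof -
  let ?P = "{(j, k). j \<noteq> k}"
  define r where "r s = 1 / \<kappa> s * sojourn_rate Z b s \<omega>" for s
  define q where "q = (\<lambda>(j, k) s. 1 / \<kappa> s * bb j k s \<omega>)"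
  define \<mu> where "\<mu> = (\<lambda>(j, k). jump_measure Z j k \<omega>)"
  define H where "H t = (LINT s:{t<..}|pay_measure \<tau>. r s)" for t
  define G where "G p t = (LINT s:{t<..}|\<mu> p. q p s)" for p t
  have \<mu>: "sets (\<mu> p) = sets borel" for p by (auto simp: \<mu>_def jump_measure_def split: prod.split)
  have eq: "future_payments Z \<tau> \<kappa> b bb t \<omega> = \<kappa> t * (H t + (\<Sum>\<^sub>\<infinity>p\<in>?P. G p t))" for t
  proof -
    have "(LINT s:{t<..}|pay_measure \<tau>. \<kappa> t / \<kappa> s * sojourn_rate Z b s \<omega>) = \<kappa> t * H t"
      unfolding H_def r_def by (simp flip: set_integral_mult_right)
    moreover have "(\<Sum>\<^sub>\<infinity>(j, k)\<in>?P. LINT s:{t<..}|jump_measure Z j k \<omega>. \<kappa> t / \<kappa> s * bb j k s \<omega>) =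
        (\<Sum>\<^sub>\<infinity>p\<in>?P. \<kappa> t * G p t)"
      unfolding G_def q_def \<mu>_def by (intro infsum_cong) (auto simp flip: set_integral_mult_right)
    ultimately show ?thesis
      unfolding future_payments_def by (simp add: infsum_cmult_right' distrib_left)
  qed
  have conv: "payments_convergent Z \<tau> \<kappa> b bb 0 \<omega>" using pc by simp
  have r: "set_integrable (pay_measure \<tau>) {0<..} r"
    using conv \<kappa>(2) by (simp add: payments_convergent_def r_def[abs_def])
  have q: "set_integrable (\<mu> p) {0<..} (q p)" if "p \<in> ?P" for p
    using conv \<kappa>(2) that by (auto simp: payments_convergent_def q_def \<mu>_def)
  have sm: "(\<lambda>p. LINT s:{0<..}|\<mu> p. \<bar>q p s\<bar>) summable_on ?P"
    using conv \<kappa>(2) by (simp add: payments_convergent_def q_def \<mu>_def case_prod_unfold)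
  have Gc: "continuous (at_right t) (G p)" if "p \<in> ?P" "0 \<le> t" for p t
    unfolding G_def[abs_def] using right_continuous_tail_integral[OF q[OF that(1)] \<mu> that(2)] .
  have bound: "norm (G p t) \<le> (LINT s:{0<..}|\<mu> p. \<bar>q p s\<bar>)" if "p \<in> ?P" "t \<in> {0..}" for p t
  proof -
    have qt: "set_integrable (\<mu> p) {t<..} (q p)"
      by (rule set_integrable_subset[OF q[OF that(1)]]) (use that \<mu> in auto)
    have "norm (G p t) \<le> (LINT s:{t<..}|\<mu> p. \<bar>q p s\<bar>)"
      unfolding G_def using set_integral_norm_bound[OF qt] by simp
    also have "\<dots> \<le> (LINT s:{0<..}|\<mu> p. \<bar>q p s\<bar>)"
      unfolding set_lebesgue_integral_def
    proof (rule integral_mono)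
      show "integrable (\<mu> p) (\<lambda>x. indicator {t<..} x *\<^sub>R \<bar>q p x\<bar>)"
        using set_integrable_abs[OF qt] by (simp add: set_integrable_def)
      show "integrable (\<mu> p) (\<lambda>x. indicator {0<..} x *\<^sub>R \<bar>q p x\<bar>)"
        using set_integrable_abs[OF q[OF that(1)]] by (simp add: set_integrable_def)
      show "indicator {t<..} x *\<^sub>R \<bar>q p x\<bar> \<le> indicator {0<..} x *\<^sub>R \<bar>q p x\<bar>" for x
        using that(2) by (auto simp: indicator_def)
    qed
    finally show ?thesis .
  qed
  have "uniform_limit {0..} (\<lambda>X t. \<Sum>p\<in>X. G p t) (\<lambda>t. \<Sum>\<^sub>\<infinity>p\<in>?P. G p t) (finite_subsets_at_top ?P)"
    using bound sm by (rule Weierstrass_m_test_general)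
  then have "uniform_limit {t<..} (\<lambda>X t. \<Sum>p\<in>X. G p t) (\<lambda>t. \<Sum>\<^sub>\<infinity>p\<in>?P. G p t) (finite_subsets_at_top ?P)"
    and "((\<lambda>X. \<Sum>p\<in>X. G p t) \<longlongrightarrow> (\<Sum>\<^sub>\<infinity>p\<in>?P. G p t)) (finite_subsets_at_top ?P)"
    using \<open>0 \<le> t\<close> by (auto intro: uniform_limit_on_subset tendsto_uniform_limitI)
  moreover have "\<forall>\<^sub>F X in finite_subsets_at_top ?P.
      ((\<lambda>s. \<Sum>p\<in>X. G p s) \<longlongrightarrow> (\<Sum>p\<in>X. G p t)) (at_right t)"
    using Gc \<open>0 \<le> t\<close> unfolding continuous_within
    by (intro eventually_finite_subsets_at_top_weakI tendsto_sum) auto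
  ultimately have "((\<lambda>t. \<Sum>\<^sub>\<infinity>p\<in>?P. G p t) \<longlongrightarrow> (\<Sum>\<^sub>\<infinity>p\<in>?P. G p t)) (at_right t)"
    by (intro swap_uniform_limit[where f = "\<lambda>X s. \<Sum>p\<in>X. G p s" and F = "finite_subsets_at_top ?P"])
      (auto simp: trivial_limit_within)
  moreover have "continuous (at_right t) H"
    unfolding H_def[abs_def] using right_continuous_tail_integral[OF r _ \<open>0 \<le> t\<close>] by simp
  moreover have "continuous (at_right t) \<kappa>" using \<kappa> \<open>0 \<le> t\<close> by (simp add: cadlag_def)
  ultimately show ?thesis
    unfolding eq continuous_within by (intro tendsto_mult tendsto_add)
qed

section \<open>Conditional expectations\<close>

lemma (in prob_space) sigma_finite_subalgebraI:
  "subalgebra M H \<Longrightarrow> sigma_finite_subalgebra M H"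
  by (intro finite_measure_subalgebra_is_sigma_finite finite_measure_subalgebra.intro
      finite_measure_subalgebra_axioms.intro finite_measure_axioms)

lemma subalgebra_vimage_algebra:
  "U \<in> M \<rightarrow>\<^sub>M N \<Longrightarrow> subalgebra M (vimage_algebra (space M) U N)"
  unfolding subalgebra_def by (auto simp: sets_vimage_algebra2 measurable_space Pi_iff)

text \<open>Pulling out an indicator does not need integrability, since it only uses the extended
  nonnegative conditional expectations of the positive and the negative part.\<close>

lemma (in sigma_finite_subalgebra) real_cond_exp_indicator:
  assumes [measurable]: "A \<in> sets F" "f \<in> borel_measurable M"
  shows "AE x in M. real_cond_exp M F (\<lambda>x. indicator A x * f x) x = indicator A x * real_cond_exp M F f x"
proof -
  have [measurable]: "A \<in> sets M" using subalg assms(1) by (auto simp: subalgebra_def)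
  have pos: "(\<lambda>x. ennreal (indicator A x * f x)) = (\<lambda>x. indicator A x * ennreal (f x))"
    and neg: "(\<lambda>x. ennreal (- (indicator A x * f x))) = (\<lambda>x. indicator A x * ennreal (- f x))"
    by (auto simp: indicator_def)
  have "AE x in M. indicator A x * nn_cond_exp M F (\<lambda>x. ennreal (f x)) x =
      nn_cond_exp M F (\<lambda>x. indicator A x * ennreal (f x)) x"
    "AE x in M. indicator A x * nn_cond_exp M F (\<lambda>x. ennreal (- f x)) x =
      nn_cond_exp M F (\<lambda>x. indicator A x * ennreal (- f x)) x"
    by (intro nn_cond_exp_prod; measurable)+
  then show ?thesis
    unfolding real_cond_exp_def pos neg
    by eventually_elim (auto simp: indicator_def split: if_splits)
qed

lemma (in sigma_finite_subalgebra) real_cond_exp_abs_le: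
  assumes "integrable M f"
  shows "AE x in M. \<bar>real_cond_exp M F f x\<bar> \<le> real_cond_exp M F (\<lambda>x. \<bar>f x\<bar>) x"
proof -
  have i: "integrable M (\<lambda>x. \<bar>f x\<bar>)" "integrable M (\<lambda>x. - 1 * f x)" using assms by auto
  have "AE x in M. real_cond_exp M F f x \<le> real_cond_exp M F (\<lambda>x. \<bar>f x\<bar>) x"
    by (intro real_cond_exp_mono i assms) auto
  moreover have "AE x in M. real_cond_exp M F (\<lambda>x. - 1 * f x) x \<le> real_cond_exp M F (\<lambda>x. \<bar>f x\<bar>) x"
    by (intro real_cond_exp_mono i) auto
  moreover have "AE x in M. real_cond_exp M F (\<lambda>x. - 1 * f x) x = - 1 * real_cond_exp M F f x"
    by (rule real_cond_exp_cmult[OF assms])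
  ultimately show ?thesis by eventually_elim auto
qed

lemma (in sigma_finite_subalgebra) real_cond_exp_L1_contraction:
  assumes "integrable M f" "integrable M g"
  shows "(\<integral>x. \<bar>real_cond_exp M F f x - real_cond_exp M F g x\<bar> \<partial>M) \<le> (\<integral>x. \<bar>f x - g x\<bar> \<partial>M)"
proof -
  have i: "integrable M (\<lambda>x. f x - g x)" using assms by simp
  have "(\<integral>x. \<bar>real_cond_exp M F f x - real_cond_exp M F g x\<bar> \<partial>M) \<le>
      (\<integral>x. real_cond_exp M F (\<lambda>x. \<bar>f x - g x\<bar>) x \<partial>M)"
  proof (rule integral_mono_AE)
    show "AE x in M. \<bar>real_cond_exp M F f x - real_cond_exp M F g x\<bar>
        \<le> real_cond_exp M F (\<lambda>x. \<bar>f x - g x\<bar>) x"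
      using real_cond_exp_abs_le[OF i] real_cond_exp_diff[OF assms] by eventually_elim auto
  qed (use assms in \<open>auto intro!: real_cond_exp_int\<close>)
  also have "\<dots> = (\<integral>x. \<bar>f x - g x\<bar> \<partial>M)"
    using i by (intro real_cond_exp_int) auto
  finally show ?thesis .
qed

text \<open>The event \<open>C\<close> misses the set where its conditional probability vanishes up to a null set, since
  the probability of this intersection is the integral of zero.\<close>

lemma (in sigma_finite_subalgebra) real_cond_exp_event:
  assumes [measurable]: "C \<in> sets M" "emeasure M C < \<infinity>"
  defines "p \<equiv> real_cond_exp M F (indicator C)"
  shows "AE x in M. 0 \<le> p x" "AE x in M. x \<in> C \<longrightarrow> 0 < p x"
    "AE x in M. nn_cond_exp M F (\<lambda>x. ennreal (indicator C x)) x = ennreal (p x)"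
proof -
  have iC: "integrable M (indicator C :: 'a \<Rightarrow> real)" using assms(2) by simp
  show pos: "AE x in M. 0 \<le> p x"
    unfolding p_def by (rule real_cond_exp_pos) auto
  have [measurable]: "p \<in> borel_measurable F" by (simp add: p_def)
  have [measurable]: "p \<in> borel_measurable M" using measurable_from_subalg[OF subalg] by (simp add: p_def)
  define N where "N = {x \<in> space M. p x \<le> 0}"
  have NF: "N \<in> sets F"
  proof -
    have sp: "space F = space M" using subalg by (simp add: subalgebra_def)
    show ?thesis unfolding N_def sp[symmetric] by measurable
  qed
  then have [measurable]: "N \<in> sets M" using subalg by (auto simp: subalgebra_def)
  have "(\<integral>x. indicator N x * indicator C x \<partial>M) = (\<integral>x. indicator N x * p x \<partial>M)"
    using real_cond_exp_intA[OF iC NF] by (simp add: set_lebesgue_integral_def p_def)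
  also have "\<dots> = (\<integral>x. 0 \<partial>M)"
    using pos by (intro integral_cong_AE) (auto simp: indicator_def N_def)
  finally have "(\<integral>x. indicator (N \<inter> C) x \<partial>M) = (0::real)"
    by (simp add: indicator_inter_arith)
  moreover have "integrable M (indicator (N \<inter> C) :: 'a \<Rightarrow> real)"
    using iC by (rule Bochner_Integration.integrable_bound) (auto simp: indicator_def)
  ultimately have "AE x in M. indicator (N \<inter> C) x = (0::real)"
    by (subst (asm) integral_nonneg_eq_0_iff_AE) auto
  then show "AE x in M. x \<in> C \<longrightarrow> 0 < p x"
    using AE_space by eventually_elim (auto simp: N_def indicator_def split: if_splits)
  have le1: "AE x in M. nn_cond_exp M F (\<lambda>x. ennreal (indicator C x)) x \<le> nn_cond_exp M F (\<lambda>x. 1) x"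
    by (rule nn_cond_exp_mono) (auto simp: indicator_def)
  have const: "AE x in M. nn_cond_exp M F (\<lambda>x. c) x = c" for c
  proof -
    have "AE x in M. c = nn_cond_exp M F (\<lambda>x. c) x" by (rule nn_cond_exp_F_meas) simp
    then show ?thesis by eventually_elim (rule sym)
  qed
  have neg: "(\<lambda>x. ennreal (- indicator C x)) = (\<lambda>x. 0)"
    by (auto simp: fun_eq_iff indicator_def ennreal_neg)
  have "AE x in M. nn_cond_exp M F (\<lambda>x. ennreal (indicator C x)) x \<noteq> \<infinity>"
    using const[of 1] le1 by eventually_elim (auto simp: top_unique)
  moreover have "AE x in M. nn_cond_exp M F (\<lambda>x. 0) x = 0" by (rule const)
  ultimately show "AE x in M. nn_cond_exp M F (\<lambda>x. ennreal (indicator C x)) x = ennreal (p x)"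
    unfolding p_def real_cond_exp_def neg by eventually_elim (simp add: ennreal_enn2real_if)
qed

lemma indicator_mult_measurable_trace:
  assumes G: "subalgebra M G" and H: "subalgebra M H" and C: "C \<in> sets G"
    and BC: "\<And>B. B \<in> sets H \<Longrightarrow> B \<inter> C \<in> sets G" and f: "f \<in> borel_measurable H"
  shows "(\<lambda>x. indicator C x * f x :: real) \<in> borel_measurable G"
proof (rule measurableI)
  fix S :: "real set" assume S: "S \<in> sets borel"
  have sp: "space G = space M" "space H = space M" using G H by (auto simp: subalgebra_def)
  have CM: "C \<subseteq> space M" using sets.sets_into_space[OF C] sp by simp
  have "f -` S \<inter> space H \<in> sets H" using f S by (rule measurable_sets)
  then have 1: "(f -` S \<inter> space M) \<inter> C \<in> sets G" using BC sp by simp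
  have 2: "(if 0 \<in> S then space G - C else {}) \<in> sets G" using C by auto
  have "(\<lambda>x. indicator C x * f x) -` S \<inter> space G =
      (f -` S \<inter> space M) \<inter> C \<union> (if 0 \<in> S then space G - C else {})"
    using CM sp by (auto simp: indicator_def of_bool_def split: if_splits)
  then show "(\<lambda>x. indicator C x * f x) -` S \<inter> space G \<in> sets G"
    using sets.Un[OF 1 2] by simp
qed auto

text \<open>If two sigma-algebras have the same trace on an event \<open>C\<close> up to null sets, the conditional
  expectation given the one that knows \<open>C\<close> is on \<open>C\<close> the elementary quotient formed with the other one.
  Replacing a set \<open>A\<close> by one with the same trace and using the defining property of conditional
  expectations twice shows that the quotient integrates over \<open>A \<inter> C\<close> like \<open>Y\<close>.\<close>

lemma (in prob_space) real_cond_exp_local: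
  assumes G: "subalgebra M G" and H: "subalgebra M H" and C: "C \<in> sets G"
    and BC: "\<And>B. B \<in> sets H \<Longrightarrow> B \<inter> C \<in> sets G"
    and AB: "\<And>A. A \<in> sets G \<Longrightarrow> \<exists>B\<in>sets H. AE x in M. x \<in> C \<longrightarrow> (x \<in> A \<longleftrightarrow> x \<in> B)"
    and Y: "integrable M Y"
  shows "AE x in M. x \<in> C \<longrightarrow> 0 < real_cond_exp M H (indicator C) x \<and>
    real_cond_exp M G Y x = real_cond_exp M H (\<lambda>x. indicator C x * Y x) x / real_cond_exp M H (indicator C) x"
proof -
  interpret G: sigma_finite_subalgebra M G by (rule sigma_finite_subalgebraI[OF G])
  interpret H: sigma_finite_subalgebra M H by (rule sigma_finite_subalgebraI[OF H])
  have CM[measurable]: "C \<in> sets M" using G C by (auto simp: subalgebra_def)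
  have [measurable]: "Y \<in> borel_measurable M" using Y by auto
  define p r where "p = real_cond_exp M H (indicator C)"
    and "r = real_cond_exp M H (\<lambda>x. indicator C x * Y x)"
  have pH[measurable]: "p \<in> borel_measurable H" and rH[measurable]: "r \<in> borel_measurable H"
    by (auto simp: p_def r_def)
  have pM[measurable]: "p \<in> borel_measurable M" and rM[measurable]: "r \<in> borel_measurable M"
    by (rule measurable_from_subalg[OF H pH], rule measurable_from_subalg[OF H rH])
  have CY: "integrable M (\<lambda>x. indicator C x * Y x)"
    using integrable_mult_indicator[OF CM Y] by simp
  have iC: "integrable M (indicator C :: 'a \<Rightarrow> real)" by (simp add: emeasure_eq_measure)
  note p = H.real_cond_exp_event[OF CM, folded p_def]
  have p0: "AE x in M. 0 \<le> p x" and ppos: "AE x in M. x \<in> C \<longrightarrow> 0 < p x"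
    and nnp: "AE x in M. nn_cond_exp M H (\<lambda>x. ennreal (indicator C x)) x = ennreal (p x)"
    by (rule p; simp add: emeasure_eq_measure)+
  define N where "N = {x \<in> space M. p x \<le> 0}"
  have NH: "N \<in> sets H"
  proof -
    have sp: "space H = space M" using H by (simp add: subalgebra_def)
    show ?thesis unfolding N_def sp[symmetric] by measurable
  qed
  have r0: "AE x in M. p x = 0 \<longrightarrow> r x = 0"
  proof -
    have "AE x in M. real_cond_exp M H (\<lambda>x. indicator N x * (indicator C x * Y x)) x = indicator N x * r x"
      unfolding r_def by (rule H.real_cond_exp_indicator[OF NH]) measurable
    moreover have "AE x in M. real_cond_exp M H (\<lambda>x. indicator N x * (indicator C x * Y x)) x =
        real_cond_exp M H (\<lambda>x. 0) x"
    proof (rule H.real_cond_exp_cong)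
      show "AE x in M. indicator N x * (indicator C x * Y x) = 0"
        using ppos by eventually_elim (auto simp: N_def indicator_def)
      show "(\<lambda>x. indicator N x * (indicator C x * Y x)) \<in> borel_measurable M"
        using NH H by (auto simp: subalgebra_def intro!: borel_measurable_times borel_measurable_indicator)
    qed simp
    moreover have "AE x in M. real_cond_exp M H (\<lambda>x. 0) x = 0"
      by (rule H.real_cond_exp_F_meas) auto
    ultimately show ?thesis using AE_space by eventually_elim (auto simp: N_def)
  qed
  define R where "R x = r x / p x" for x
  have RH[measurable]: "R \<in> borel_measurable H" by (simp add: R_def[abs_def])
  have RM[measurable]: "R \<in> borel_measurable M" by (rule measurable_from_subalg[OF H RH])
  have Rp: "AE x in M. R x * p x = r x" using r0 by eventually_elim (auto simp: R_def)
  have RC: "integrable M (\<lambda>x. R x * indicator C x)"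
  proof (rule integrableI_bounded)
    have "(\<integral>\<^sup>+x. ennreal (norm (R x * indicator C x)) \<partial>M) = (\<integral>\<^sup>+x. ennreal \<bar>R x\<bar> * ennreal (indicator C x) \<partial>M)"
      by (intro nn_integral_cong) (auto simp: indicator_def)
    also have "\<dots> = (\<integral>\<^sup>+x. ennreal \<bar>R x\<bar> * nn_cond_exp M H (\<lambda>x. ennreal (indicator C x)) x \<partial>M)"
      by (rule H.nn_cond_exp_intg[symmetric]) measurable
    also have "\<dots> = (\<integral>\<^sup>+x. ennreal \<bar>r x\<bar> \<partial>M)"
    proof (rule nn_integral_cong_AE)
      show "AE x in M. ennreal \<bar>R x\<bar> * nn_cond_exp M H (\<lambda>x. ennreal (indicator C x)) x = ennreal \<bar>r x\<bar>"
        using nnp Rp p0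
      proof eventually_elim
        case (elim x)
        have "ennreal \<bar>R x\<bar> * ennreal (p x) = ennreal \<bar>R x * p x\<bar>"
          using elim(3) by (simp add: abs_mult ennreal_mult)
        then show ?case unfolding elim(1,2) .
      qed
    qed
    also have "\<dots> < \<infinity>"
      using H.real_cond_exp_int(1)[OF CY] unfolding r_def[symmetric] integrable_iff_bounded by simp
    finally show "(\<integral>\<^sup>+x. ennreal (norm (R x * indicator C x)) \<partial>M) < \<infinity>" .
  qed measurable
  have "AE x in M. real_cond_exp M G (\<lambda>x. indicator C x * Y x) x = indicator C x * R x"
  proof (rule G.real_cond_exp_charact)
    fix A assume A: "A \<in> sets G"
    then obtain B where B: "B \<in> sets H" "AE x in M. x \<in> C \<longrightarrow> (x \<in> A \<longleftrightarrow> x \<in> B)" using AB by blast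
    have [measurable]: "A \<in> sets M" "B \<in> sets M" using A B(1) G H by (auto simp: subalgebra_def)
    have "(LINT x:A|M. indicator C x * Y x) = (LINT x:B|M. indicator C x * Y x)"
      unfolding set_lebesgue_integral_def
      using B(2) by (intro integral_cong_AE) (auto simp: indicator_def)
    also have "\<dots> = (LINT x:B|M. r x)"
      unfolding r_def by (rule H.real_cond_exp_intA[OF CY B(1)])
    also have "\<dots> = (\<integral>x. (indicator B x * R x) * p x \<partial>M)"
      unfolding set_lebesgue_integral_def
      using Rp by (intro integral_cong_AE) (auto simp: indicator_def)
    also have "\<dots> = (\<integral>x. (indicator B x * R x) * indicator C x \<partial>M)"
      unfolding p_def
    proof (rule H.real_cond_exp_intg(2))
      show "integrable M (\<lambda>x. indicator B x * R x * indicator C x)"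
        using integrable_mult_indicator[OF \<open>B \<in> sets M\<close> RC] by (simp add: mult.assoc)
      show "(\<lambda>x. indicator B x * R x) \<in> borel_measurable H" using B(1) by measurable
    qed measurable
    also have "\<dots> = (LINT x:A|M. indicator C x * R x)"
      unfolding set_lebesgue_integral_def
      using B(2) by (intro integral_cong_AE) (auto simp: indicator_def)
    finally show "(LINT x:A|M. indicator C x * Y x) = (LINT x:A|M. indicator C x * R x)" .
  next
    show "integrable M (\<lambda>x. indicator C x * R x)" using RC by (simp add: mult.commute)
    show "(\<lambda>x. indicator C x * R x) \<in> borel_measurable G"
      by (rule indicator_mult_measurable_trace[OF G H C BC RH])
  qed (fact CY)
  moreover have "AE x in M. real_cond_exp M G (\<lambda>x. indicator C x * Y x) x = indicator C x * real_cond_exp M G Y x"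
    by (rule G.real_cond_exp_indicator[OF C]) measurable
  ultimately show ?thesis
    unfolding p_def[symmetric] r_def[symmetric] using ppos
    by eventually_elim (auto simp: R_def)
qed

lemma (in prob_space) real_cond_exp_mod_null:
  assumes G: "subalgebra M G" and HG: "subalgebra G H"
    and AB: "\<And>A. A \<in> sets G \<Longrightarrow> \<exists>B\<in>sets H. AE x in M. x \<in> A \<longleftrightarrow> x \<in> B"
    and Y: "integrable M Y"
  shows "AE x in M. real_cond_exp M G Y x = real_cond_exp M H Y x"
proof -
  have H: "subalgebra M H" using G HG by (auto simp: subalgebra_def)
  interpret G: sigma_finite_subalgebra M G by (rule sigma_finite_subalgebraI[OF G])
  interpret H: sigma_finite_subalgebra M H by (rule sigma_finite_subalgebraI[OF H])
  have [measurable]: "Y \<in> borel_measurable M" using Y by auto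
  have [measurable]: "real_cond_exp M H Y \<in> borel_measurable M"
    by (rule borel_measurable_cond_exp2)
  show ?thesis
  proof (rule G.real_cond_exp_charact)
    fix A assume A: "A \<in> sets G"
    then obtain B where B: "B \<in> sets H" "AE x in M. x \<in> A \<longleftrightarrow> x \<in> B" using AB by blast
    have [measurable]: "A \<in> sets M" "B \<in> sets M" using A B(1) G H by (auto simp: subalgebra_def)
    have "(LINT x:A|M. Y x) = (LINT x:B|M. Y x)"
      unfolding set_lebesgue_integral_def
      using B(2) by (intro integral_cong_AE) (auto simp: indicator_def)
    also have "\<dots> = (LINT x:B|M. real_cond_exp M H Y x)"
      by (rule H.real_cond_exp_intA[OF Y B(1)])
    also have "\<dots> = (LINT x:A|M. real_cond_exp M H Y x)"
      unfolding set_lebesgue_integral_def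
      using B(2) by (intro integral_cong_AE) (auto simp: indicator_def)
    finally show "(LINT x:A|M. Y x) = (LINT x:A|M. real_cond_exp M H Y x)" .
  next
    show "real_cond_exp M H Y \<in> borel_measurable G"
      by (rule measurable_from_subalg[OF HG]) simp
  qed (use Y in \<open>auto intro: H.real_cond_exp_int\<close>)
qed

section \<open>Sigma-algebras with all null sets\<close>

lemma sets_sigma_gen_null:
  "sets (sigma_gen_null M U N) =
    sigma_sets (space M) (sets (vimage_algebra (space M) U N) \<union> null_sets M)"
proof -
  have "sets (vimage_algebra (space M) U N) \<union> null_sets M \<subseteq> Pow (space M)"
    using sets.space_closed[of M] sets.space_closed[of "vimage_algebra (space M) U N"]
    by (auto dest: null_setsD2 simp del: sets_vimage_algebra)
  then show ?thesis unfolding sigma_gen_null_def by (rule sets_measure_of)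
qed

lemma space_sigma_gen_null: "space (sigma_gen_null M U N) = space M"
  unfolding sigma_gen_null_def by (simp add: space_measure_of_conv)

lemma vimage_subalgebra_sigma_gen_null:
  "subalgebra (sigma_gen_null M U N) (vimage_algebra (space M) U N)"
  unfolding subalgebra_def space_sigma_gen_null sets_sigma_gen_null
  by (auto simp del: sets_vimage_algebra)

lemma null_sets_sigma_gen_null: "null_sets M \<subseteq> sets (sigma_gen_null M U N)"
  unfolding sets_sigma_gen_null by auto

lemma subalgebra_sigma_gen_null:
  assumes U: "U \<in> M \<rightarrow>\<^sub>M N"
  shows "subalgebra M (sigma_gen_null M U N)"
proof -
  have "sets (vimage_algebra (space M) U N) \<subseteq> sets M"
    using subalgebra_vimage_algebra[OF U] by (simp add: subalgebra_def)
  then have "sigma_sets (space M) (sets (vimage_algebra (space M) U N) \<union> null_sets M) \<subseteq> sets M"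
    by (intro sets.sigma_sets_subset) auto
  then show ?thesis
    by (simp add: subalgebra_def sets_sigma_gen_null space_sigma_gen_null)
qed

lemma sigma_gen_null_AE:
  assumes U: "U \<in> M \<rightarrow>\<^sub>M N" and A: "A \<in> sets (sigma_gen_null M U N)"
  shows "\<exists>B\<in>sets N. AE x in M. x \<in> A \<longleftrightarrow> U x \<in> B"
proof -
  have "A \<in> sigma_sets (space M) (sets (vimage_algebra (space M) U N) \<union> null_sets M)"
    using A by (simp only: sets_sigma_gen_null)
  then show ?thesis
  proof induction
    case (Basic A)
    then show ?case
    proof
      assume "A \<in> sets (vimage_algebra (space M) U N)"
      then obtain B where "B \<in> sets N" "A = U -` B \<inter> space M"
        using U by (auto simp: sets_vimage_algebra2 measurable_space Pi_iff)
      then show ?thesis using AE_space[of M] by (intro bexI[of _ B]) auto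
    next
      assume "A \<in> null_sets M"
      then have "AE x in M. x \<notin> A" by (rule AE_not_in)
      then show ?thesis by (intro bexI[of _ "{}"]) auto
    qed
  next
    case Empty
    show ?case by (intro bexI[of _ "{}"]) auto
  next
    case (Compl A)
    then obtain B where B: "B \<in> sets N" "AE x in M. x \<in> A \<longleftrightarrow> U x \<in> B" by blast
    have "AE x in M. x \<in> space M - A \<longleftrightarrow> U x \<in> space N - B"
      using B(2) AE_space by eventually_elim (use measurable_space[OF U] in auto)
    then show ?case using B(1) by blast
  next
    case (Union A)
    then have "\<forall>i. \<exists>B. B \<in> sets N \<and> (AE x in M. x \<in> A i \<longleftrightarrow> U x \<in> B)" by blast
    then obtain B where B: "\<And>i. B i \<in> sets N" "\<And>i. AE x in M. x \<in> A i \<longleftrightarrow> U x \<in> B i" by metis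
    have "AE x in M. \<forall>i. x \<in> A i \<longleftrightarrow> U x \<in> B i" using B(2) by (simp add: AE_all_countable)
    then have "AE x in M. x \<in> (\<Union>i. A i) \<longleftrightarrow> U x \<in> (\<Union>i. B i)" by eventually_elim auto
    then show ?case using B(1) by (intro bexI[of _ "\<Union>i. B i"]) auto
  qed
qed

text \<open>In a complete space, modifications on null sets do not affect measurability with respect to a
  sub-sigma-algebra that contains all null sets.\<close>

lemma measurable_AE_eq:
  assumes M: "complete_measure M" and G: "subalgebra M G" "null_sets M \<subseteq> sets G"
    and f: "f \<in> G \<rightarrow>\<^sub>M N" and ae: "AE x in M. f x = g x" and g: "g \<in> space M \<rightarrow> space N"
  shows "g \<in> G \<rightarrow>\<^sub>M N"
proof (rule measurableI)
  interpret complete_measure M by fact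
  have sp: "space G = space M" using G by (simp add: subalgebra_def)
  show "g x \<in> space N" if "x \<in> space G" for x using g that sp by auto
  obtain E where E: "E \<in> null_sets M" "{x \<in> space M. f x \<noteq> g x} \<subseteq> E"
    using ae by (auto simp: eventually_ae_filter)
  fix S assume S: "S \<in> sets N"
  have "f -` S \<inter> space M \<in> sets G" using measurable_sets[OF f S] sp by simp
  moreover have EG: "E \<in> sets G" using E G by auto
  moreover have "(g -` S \<inter> space M) \<inter> E \<in> sets G"
    using complete2[of "(g -` S \<inter> space M) \<inter> E" E] E(1) G(2) by auto
  ultimately have "(f -` S \<inter> space M - E) \<union> ((g -` S \<inter> space M) \<inter> E) \<in> sets G" by auto
  moreover have "g -` S \<inter> space M = (f -` S \<inter> space M - E) \<union> ((g -` S \<inter> space M) \<inter> E)"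
    using E(2) by auto
  ultimately show "g -` S \<inter> space G \<in> sets G" using sp by simp
qed

lemma measurable_dyadic_time:
  fixes T :: "'a \<Rightarrow> real"
  assumes T: "T \<in> borel_measurable G"
    and X: "\<And>q. 0 \<le> q \<Longrightarrow> (\<lambda>\<omega>. indicator D \<omega> * X q \<omega> :: real) \<in> borel_measurable G"
    and pos: "\<And>\<omega>. \<omega> \<in> D \<Longrightarrow> 0 \<le> T \<omega>"
  shows "(\<lambda>\<omega>. indicator D \<omega> * X (dyadic_above n (T \<omega>)) \<omega>) \<in> borel_measurable G"
proof -
  have "(\<lambda>\<omega>. \<lfloor>2 ^ n * T \<omega>\<rfloor>) \<in> G \<rightarrow>\<^sub>M count_space UNIV" using T by measurable
  \<comment> \<open>The maximum only guards against negative times, which do not occur on \<open>D\<close>.\<close>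
  then have "(\<lambda>\<omega>. indicator D \<omega> * X (max 0 ((of_int \<lfloor>2 ^ n * T \<omega>\<rfloor> + 1) / 2 ^ n)) \<omega>) \<in> borel_measurable G"
    by (rule measurable_compose_countable[where f = "\<lambda>k \<omega>. indicator D \<omega> * X (max 0 ((of_int k + 1) / 2 ^ n)) \<omega>", rotated])
      (rule X, simp)
  moreover have "indicator D \<omega> * X (max 0 ((of_int \<lfloor>2 ^ n * T \<omega>\<rfloor> + 1) / 2 ^ n)) \<omega> =
      indicator D \<omega> * X (dyadic_above n (T \<omega>)) \<omega>" for \<omega>
    using pos[of \<omega>] dyadic_above_gt[of "T \<omega>" n]
    by (cases "\<omega> \<in> D") (auto simp: dyadic_above_def max_def)
  ultimately show ?thesis by simp
qed

text \<open>A right-continuous family can be evaluated at a random time through dyadic approximations from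
  the right, so that measurability at each single time suffices.\<close>

lemma measurable_at_random_time:
  fixes T :: "'a \<Rightarrow> real"
  assumes M: "complete_measure M" and G: "subalgebra M G" "null_sets M \<subseteq> sets G"
    and T: "T \<in> borel_measurable G"
    and X: "\<And>q. 0 \<le> q \<Longrightarrow> (\<lambda>\<omega>. indicator D \<omega> * X q \<omega> :: real) \<in> borel_measurable G"
    and pos: "\<And>\<omega>. \<omega> \<in> D \<Longrightarrow> 0 \<le> T \<omega>"
    and rc: "AE \<omega> in M. \<omega> \<in> D \<longrightarrow> (\<forall>t\<ge>0. continuous (at_right t) (\<lambda>t. X t \<omega>))"
  shows "(\<lambda>\<omega>. indicator D \<omega> * X (T \<omega>) \<omega>) \<in> borel_measurable G"
proof (rule measurable_AE_eq[OF M G])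
  show "(\<lambda>\<omega>. lim (\<lambda>n. indicator D \<omega> * X (dyadic_above n (T \<omega>)) \<omega>)) \<in> borel_measurable G"
    by (rule borel_measurable_lim_metric, rule measurable_dyadic_time[OF T X pos])
  show "AE \<omega> in M. lim (\<lambda>n. indicator D \<omega> * X (dyadic_above n (T \<omega>)) \<omega>) = indicator D \<omega> * X (T \<omega>) \<omega>"
    using rc
  proof eventually_elim
    case (elim \<omega>)
    have "(\<lambda>n. indicator D \<omega> * X (dyadic_above n (T \<omega>)) \<omega>) \<longlonglongrightarrow> indicator D \<omega> * X (T \<omega>) \<omega>"
    proof (cases "\<omega> \<in> D")
      case True
      then have "continuous (at_right (T \<omega>)) (\<lambda>t. X t \<omega>)" using elim pos by blast
      then show ?thesis by (intro tendsto_mult tendsto_const tendsto_dyadic_above)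
    qed simp
    then show ?case by (rule limI)
  qed
qed simp

section \<open>Regular versions of conditional expectation processes\<close>

lemma factorized_cond_exp_vimage_measurable:
  assumes "g \<in> borel_measurable N" "U \<in> M \<rightarrow>\<^sub>M N"
  shows "(\<lambda>\<omega>. g (U \<omega>)) \<in> borel_measurable (vimage_algebra (space M) U N)"
  by (rule measurable_compose[OF measurable_vimage_algebra1 assms(1)])
    (use assms(2) in \<open>auto simp: measurable_space\<close>)

text \<open>The defining property of a version at single times extends to random times known to \<open>U\<close>: for
  the dyadic approximations from the right by localization on the countably many values, in the limit
  because conditional expectation contracts the \<open>L\<^sup>1\<close>-norm.\<close>

lemma (in prob_space) cond_exp_process_at_time:
  assumes U: "U \<in> M \<rightarrow>\<^sub>M N" and g: "cond_exp_process_cadlag M X U N g"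
    and X: "\<And>t. 0 \<le> t \<Longrightarrow> integrable M (X t)"
    and rc: "AE \<omega> in M. \<forall>t\<ge>0. continuous (at_right t) (\<lambda>t. X t \<omega>)"
    and W: "integrable M W" and dom: "AE \<omega> in M. \<forall>t\<in>{0..m+1}. \<bar>X t \<omega>\<bar> \<le> W \<omega>"
    and D: "D \<in> sets (vimage_algebra (space M) U N)"
    and T: "T \<in> borel_measurable (vimage_algebra (space M) U N)"
    and TD: "\<And>\<omega>. \<omega> \<in> D \<Longrightarrow> 0 \<le> T \<omega> \<and> T \<omega> \<le> m"
    and meas: "(\<lambda>\<omega>. indicator D \<omega> * X (T \<omega>) \<omega>) \<in> borel_measurable M"
  shows "integrable M (\<lambda>\<omega>. indicator D \<omega> * X (T \<omega>) \<omega>)"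
    and "AE \<omega> in M. \<omega> \<in> D \<longrightarrow> g (T \<omega>) (U \<omega>) =
      real_cond_exp M (vimage_algebra (space M) U N) (\<lambda>\<omega>. indicator D \<omega> * X (T \<omega>) \<omega>) \<omega>"
proof -
  let ?H = "vimage_algebra (space M) U N"
  have H: "subalgebra M ?H" by (rule subalgebra_vimage_algebra[OF U])
  interpret H: sigma_finite_subalgebra M ?H by (rule sigma_finite_subalgebraI[OF H])
  have DM[measurable]: "D \<in> sets M" and TM[measurable]: "T \<in> borel_measurable M"
    using H D measurable_from_subalg[OF H T] by (auto simp: subalgebra_def)
  have Xm[measurable]: "X t \<in> borel_measurable M" if "0 \<le> t" for t
    using X[OF that] by auto
  define Xn where "Xn n \<omega> = indicator D \<omega> * X (dyadic_above n (T \<omega>)) \<omega>" for n \<omega>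
  define X0 where "X0 \<omega> = indicator D \<omega> * X (T \<omega>) \<omega>" for \<omega>
  have Xn_meas[measurable]: "Xn n \<in> borel_measurable M" for n
    unfolding Xn_def[abs_def] by (rule measurable_dyadic_time) (use TD in auto)
  have range: "dyadic_above n (T \<omega>) \<in> {0..m+1}" if "\<omega> \<in> D" for n \<omega>
    using TD[OF that] dyadic_above_gt[of "T \<omega>" n] dyadic_above_le_plus1[of n "T \<omega>"] by auto
  have Xn_dom: "AE \<omega> in M. norm (Xn n \<omega>) \<le> \<bar>W \<omega>\<bar>" for n
    using dom
  proof eventually_elim
    case (elim \<omega>)
    then show ?case using range[of \<omega> n] by (fastforce simp: Xn_def indicator_def)
  qed
  have lim: "AE \<omega> in M. (\<lambda>n. Xn n \<omega>) \<longlonglongrightarrow> X0 \<omega>"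
    using rc
  proof eventually_elim
    case (elim \<omega>)
    show ?case
    proof (cases "\<omega> \<in> D")
      case True
      then have "continuous (at_right (T \<omega>)) (\<lambda>t. X t \<omega>)" using elim TD by blast
      then show ?thesis unfolding Xn_def X0_def by (intro tendsto_mult tendsto_const tendsto_dyadic_above)
    qed (simp add: Xn_def X0_def)
  qed
  have absW: "integrable M (\<lambda>\<omega>. \<bar>W \<omega>\<bar>)" using W by simp
  have X0m[measurable]: "X0 \<in> borel_measurable M" using meas by (simp add: X0_def[abs_def])
  have intn: "integrable M (Xn n)" for n
    using Xn_dom[of n] by (intro Bochner_Integration.integrable_bound[OF absW]) auto
  have "AE \<omega> in M. \<forall>n. norm (Xn n \<omega>) \<le> \<bar>W \<omega>\<bar>" using Xn_dom by (simp add: AE_all_countable)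
  then have X0_dom: "AE \<omega> in M. norm (X0 \<omega>) \<le> \<bar>W \<omega>\<bar>"
    using lim
  proof eventually_elim
    case (elim \<omega>)
    show ?case by (rule LIMSEQ_le_const2[OF tendsto_norm[OF elim(2)]]) (use elim(1) in auto)
  qed
  have int0: "integrable M X0"
    using X0_dom by (intro Bochner_Integration.integrable_bound[OF absW]) auto
  then show "integrable M (\<lambda>\<omega>. indicator D \<omega> * X (T \<omega>) \<omega>)" by (simp add: X0_def[abs_def])

  have dyadic: "AE \<omega> in M. \<omega> \<in> D \<longrightarrow> g (dyadic_above n (T \<omega>)) (U \<omega>) = real_cond_exp M ?H (Xn n) \<omega>" for n
  proof -
    define t where "t k = (of_int k + 1) / (2::real) ^ n" for k :: int
    define Dk where "Dk k = {\<omega> \<in> space M. \<omega> \<in> D \<and> \<lfloor>2 ^ n * T \<omega>\<rfloor> = k}" for k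
    have DkH: "Dk k \<in> sets ?H" for k
    proof -
      have sp: "space ?H = space M" by simp
      have "{\<omega> \<in> space ?H. \<omega> \<in> D \<and> \<lfloor>2 ^ n * T \<omega>\<rfloor> = k} \<in> sets ?H" using D T by measurable
      then show ?thesis unfolding Dk_def sp .
    qed
    have DkM: "Dk k \<in> sets M" for k using DkH H by (auto simp: subalgebra_def)
    have "AE \<omega> in M. \<omega> \<in> Dk k \<longrightarrow> g (dyadic_above n (T \<omega>)) (U \<omega>) = real_cond_exp M ?H (Xn n) \<omega>" for k
    proof (cases "0 \<le> t k")
      case True
      have eq: "(\<lambda>\<omega>. indicator (Dk k) \<omega> * X (t k) \<omega>) = (\<lambda>\<omega>. indicator (Dk k) \<omega> * Xn n \<omega>)"
        by (auto simp: fun_eq_iff Dk_def Xn_def t_def dyadic_above_def indicator_def)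
      have "AE \<omega> in M. real_cond_exp M ?H (\<lambda>\<omega>. indicator (Dk k) \<omega> * X (t k) \<omega>) \<omega> =
          indicator (Dk k) \<omega> * real_cond_exp M ?H (X (t k)) \<omega>"
        by (rule H.real_cond_exp_indicator[OF DkH Xm[OF True]])
      moreover have "AE \<omega> in M. real_cond_exp M ?H (\<lambda>\<omega>. indicator (Dk k) \<omega> * Xn n \<omega>) \<omega> =
          indicator (Dk k) \<omega> * real_cond_exp M ?H (Xn n) \<omega>"
        by (rule H.real_cond_exp_indicator[OF DkH Xn_meas])
      moreover have "AE \<omega> in M. g (t k) (U \<omega>) = real_cond_exp M ?H (X (t k)) \<omega>"
        using g True by (auto simp: cond_exp_process_cadlag_def factorized_cond_exp_def)
      ultimately show ?thesis
      proof eventually_elim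
        case (elim \<omega>)
        show ?case
        proof
          assume \<omega>: "\<omega> \<in> Dk k"
          then have "dyadic_above n (T \<omega>) = t k" by (simp add: Dk_def t_def dyadic_above_def)
          moreover have "real_cond_exp M ?H (X (t k)) \<omega> = real_cond_exp M ?H (Xn n) \<omega>"
            using elim(1)[unfolded eq] elim(2) \<omega> by simp
          ultimately show "g (dyadic_above n (T \<omega>)) (U \<omega>) = real_cond_exp M ?H (Xn n) \<omega>"
            using elim(3) by simp
        qed
      qed
    next
      case False
      have "Dk k = {}"
      proof (rule ccontr)
        assume "Dk k \<noteq> {}"
        then obtain \<omega> where "\<omega> \<in> D" "\<lfloor>2 ^ n * T \<omega>\<rfloor> = k" by (auto simp: Dk_def)
        then show False using range[of \<omega> n] False by (auto simp: t_def dyadic_above_def)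
      qed
      then show ?thesis by simp
    qed
    then have "AE \<omega> in M. \<forall>k. \<omega> \<in> Dk k \<longrightarrow> g (dyadic_above n (T \<omega>)) (U \<omega>) = real_cond_exp M ?H (Xn n) \<omega>"
      unfolding AE_all_countable by blast
    then show ?thesis using AE_space by eventually_elim (auto simp: Dk_def)
  qed
  have "(\<lambda>n. \<integral>\<omega>. \<bar>Xn n \<omega> - X0 \<omega>\<bar> \<partial>M) \<longlonglongrightarrow> (\<integral>\<omega>. 0 \<partial>M)"
  proof (rule integral_dominated_convergence)
    show "integrable M (\<lambda>\<omega>. 2 * \<bar>W \<omega>\<bar>)" using absW by simp
    show "AE \<omega> in M. (\<lambda>n. \<bar>Xn n \<omega> - X0 \<omega>\<bar>) \<longlonglongrightarrow> 0"
      using lim by eventually_elim (simp add: tendsto_rabs_zero LIM_zero)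
    show "AE \<omega> in M. norm \<bar>Xn n \<omega> - X0 \<omega>\<bar> \<le> 2 * \<bar>W \<omega>\<bar>" for n
      using Xn_dom[of n] X0_dom by eventually_elim auto
  qed auto
  then have L1: "(\<lambda>n. \<integral>\<omega>. \<bar>Xn n \<omega> - X0 \<omega>\<bar> \<partial>M) \<longlonglongrightarrow> 0" by simp
  define u where "u n \<omega> = real_cond_exp M ?H (Xn n) \<omega> - real_cond_exp M ?H X0 \<omega>" for n \<omega>
  have ui: "integrable M (u n)" for n
    unfolding u_def[abs_def] by (intro Bochner_Integration.integrable_diff H.real_cond_exp_int intn int0)
  have "(\<lambda>n. \<integral>\<omega>. norm (u n \<omega>) \<partial>M) \<longlonglongrightarrow> 0"
  proof (rule tendsto_sandwich[OF _ _ tendsto_const L1])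
    show "\<forall>\<^sub>F n in sequentially. (\<integral>\<omega>. norm (u n \<omega>) \<partial>M) \<le> (\<integral>\<omega>. \<bar>Xn n \<omega> - X0 \<omega>\<bar> \<partial>M)"
      unfolding u_def using H.real_cond_exp_L1_contraction[OF intn int0] by simp
  qed simp
  then obtain r where r: "strict_mono r" "AE \<omega> in M. (\<lambda>n. u (r n) \<omega>) \<longlonglongrightarrow> 0"
    using tendsto_L1_AE_subseq[of M u] ui by blast
  have all: "AE \<omega> in M. \<forall>n. \<omega> \<in> D \<longrightarrow> g (dyadic_above n (T \<omega>)) (U \<omega>) = real_cond_exp M ?H (Xn n) \<omega>"
    unfolding AE_all_countable using dyadic by blast
  have cad: "AE \<omega> in M. cadlag (\<lambda>t. g t (U \<omega>))" using g by (simp add: cond_exp_process_cadlag_def)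
  have "AE \<omega> in M. \<omega> \<in> D \<longrightarrow> g (T \<omega>) (U \<omega>) = real_cond_exp M ?H X0 \<omega>"
    using r(2) all cad
  proof eventually_elim
    case (elim \<omega>)
    show ?case
    proof
      assume \<omega>: "\<omega> \<in> D"
      have "(\<lambda>n. g (dyadic_above n (T \<omega>)) (U \<omega>)) \<longlonglongrightarrow> g (T \<omega>) (U \<omega>)"
        using elim(3) TD[OF \<omega>] by (intro tendsto_dyadic_above[of "T \<omega>" "\<lambda>t. g t (U \<omega>)"]) (auto simp: cadlag_def)
      from LIMSEQ_subseq_LIMSEQ[OF this r(1)]
      have 1: "(\<lambda>n. real_cond_exp M ?H (Xn (r n)) \<omega>) \<longlonglongrightarrow> g (T \<omega>) (U \<omega>)"
        using elim(2) \<omega> by (simp add: comp_def)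
      have 2: "(\<lambda>n. real_cond_exp M ?H (Xn (r n)) \<omega>) \<longlonglongrightarrow> real_cond_exp M ?H X0 \<omega>"
        using elim(1) unfolding u_def by (rule LIM_zero_cancel)
      show "g (T \<omega>) (U \<omega>) = real_cond_exp M ?H X0 \<omega>" by (rule LIMSEQ_unique[OF 1 2])
    qed
  qed
  then show "AE \<omega> in M. \<omega> \<in> D \<longrightarrow> g (T \<omega>) (U \<omega>) =
      real_cond_exp M ?H (\<lambda>\<omega>. indicator D \<omega> * X (T \<omega>) \<omega>) \<omega>"
    by (simp add: X0_def[abs_def])
qed

text \<open>Up to the exit time, the conditional survival probability stays away from zero, including its left
  limit at the exit time: the first time after \<open>T\<close>, among finitely many, at which it is at most \<open>\<epsilon>\<close> is
  known to \<open>U\<close>, so survival up to that time has probability at most \<open>\<epsilon>\<close>.\<close>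

lemma (in prob_space) cond_survival_bounded_below:
  fixes I :: "real \<Rightarrow> 'a set"
  assumes U: "U \<in> M \<rightarrow>\<^sub>M N" and I: "\<And>q. 0 \<le> q \<Longrightarrow> I q \<in> sets M"
    and h: "\<And>q. 0 \<le> q \<Longrightarrow> factorized_cond_exp M (indicator (I q)) U N (h q)"
    and T: "T \<in> borel_measurable (vimage_algebra (space M) U N)"
    and entered: "\<And>q \<omega>. 0 \<le> q \<Longrightarrow> \<omega> \<in> I q \<Longrightarrow> T \<omega> \<le> ereal q"
    and stay: "\<And>p q \<omega>. 0 \<le> p \<Longrightarrow> p \<le> q \<Longrightarrow> T \<omega> \<le> ereal p \<Longrightarrow> \<omega> \<in> I q \<Longrightarrow> \<omega> \<in> I p"
  shows "AE \<omega> in M. \<exists>\<epsilon>>0. \<forall>q\<in>\<rat>. 0 \<le> q \<longrightarrow> \<omega> \<in> I q \<longrightarrow> \<epsilon> \<le> h q (U \<omega>)"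
proof -
  let ?H = "vimage_algebra (space M) U N"
  have H: "subalgebra M ?H" by (rule subalgebra_vimage_algebra[OF U])
  interpret H: sigma_finite_subalgebra M ?H by (rule sigma_finite_subalgebraI[OF H])
  have HM: "A \<in> sets M" if "A \<in> sets ?H" for A using H that by (auto simp: subalgebra_def)
  define B where "B \<epsilon> q = {\<omega> \<in> space M. T \<omega> \<le> ereal q \<and> h q (U \<omega>) \<le> \<epsilon>}" for \<epsilon> q
  have BH: "B \<epsilon> q \<in> sets ?H" if "0 \<le> q" for \<epsilon> q
  proof -
    have [measurable]: "(\<lambda>\<omega>. h q (U \<omega>)) \<in> borel_measurable ?H"
      using h[OF that] U by (intro factorized_cond_exp_vimage_measurable) (auto simp: factorized_cond_exp_def)
    have "{\<omega> \<in> space ?H. T \<omega> \<le> ereal q \<and> h q (U \<omega>) \<le> \<epsilon>} \<in> sets ?H" using T by measurable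
    then show ?thesis unfolding B_def space_vimage_algebra .
  qed
  have BM: "B \<epsilon> q \<in> sets M" if "0 \<le> q" for \<epsilon> q by (rule HM[OF BH[OF that]])
  have fin: "measure M (\<Union>q\<in>Q. I q \<inter> B \<epsilon> q) \<le> \<epsilon>" if Q: "finite Q" "Q \<subseteq> {0..}" and "0 < \<epsilon>" for Q \<epsilon>
  proof -
    \<comment> \<open>\<open>q\<close> is the first time in \<open>Q\<close> at which the survival probability is at most \<open>\<epsilon>\<close>.\<close>
    define C where "C q = B \<epsilon> q - (\<Union>p\<in>{p\<in>Q. p < q}. B \<epsilon> p)" for q
    have CH: "C q \<in> sets ?H" if "q \<in> Q" for q
    proof -
      have "(\<Union>p\<in>{p\<in>Q. p < q}. B \<epsilon> p) \<in> sets ?H" using Q by (intro sets.finite_UN BH) auto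
      then show ?thesis unfolding C_def using BH[of q \<epsilon>] Q that by auto
    qed
    have CM: "C q \<in> sets M" if "q \<in> Q" for q by (rule HM[OF CH[OF that]])
    have disj: "disjoint_family_on C Q"
      unfolding disjoint_family_on_def
    proof (intro ballI impI)
      fix p q assume pq: "p \<in> Q" "q \<in> Q" "p \<noteq> q"
      then consider "p < q" | "q < p" by linarith
      then show "C p \<inter> C q = {}" by cases (use pq in \<open>auto simp: C_def\<close>)
    qed
    have sub: "(\<Union>q\<in>Q. I q \<inter> B \<epsilon> q) \<subseteq> (\<Union>q\<in>Q. I q \<inter> C q)"
    proof
      fix \<omega> assume "\<omega> \<in> (\<Union>q\<in>Q. I q \<inter> B \<epsilon> q)"
      then obtain q where q: "q \<in> Q" "\<omega> \<in> I q" "\<omega> \<in> B \<epsilon> q" by auto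
      define P where "P = {p\<in>Q. \<omega> \<in> B \<epsilon> p}"
      have P: "finite P" "q \<in> P" using Q q by (auto simp: P_def)
      define p where "p = Min P"
      have p: "p \<in> P" "p \<le> q" using P unfolding p_def by (auto intro: Min_in)
      have "\<omega> \<in> I p" using stay[of p q \<omega>] p q Q by (auto simp: P_def B_def)
      moreover have "\<omega> \<in> C p"
      proof -
        have "\<not> r < p" if "r \<in> P" for r using P that by (auto simp: p_def not_less)
        then show ?thesis using p by (auto simp: C_def P_def)
      qed
      ultimately show "\<omega> \<in> (\<Union>q\<in>Q. I q \<inter> C q)" using p by (auto simp: P_def)
    qed
    have le: "measure M (I q \<inter> C q) \<le> \<epsilon> * measure M (C q)" if "q \<in> Q" for q
    proof -
      have q0: "0 \<le> q" using that Q by auto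
      note [measurable] = CM[OF that] I[OF q0]
      have i: "integrable M (indicator (I q) :: 'a \<Rightarrow> real)" by (simp add: emeasure_eq_measure)
      have "measure M (I q \<inter> C q) = (LINT \<omega>:C q|M. indicator (I q) \<omega>)"
        unfolding set_lebesgue_integral_def
        by (simp add: indicator_inter_arith[symmetric] Int_commute)
      also have "\<dots> = (LINT \<omega>:C q|M. real_cond_exp M ?H (indicator (I q)) \<omega>)"
        by (rule H.real_cond_exp_intA[OF i CH[OF that]])
      also have "\<dots> \<le> (LINT \<omega>:C q|M. \<epsilon>)"
        unfolding set_lebesgue_integral_def
      proof (rule integral_mono_AE)
        show "integrable M (\<lambda>x. indicator (C q) x *\<^sub>R real_cond_exp M ?H (indicator (I q)) x)"
          by (rule integrable_mult_indicator[OF CM[OF that] H.real_cond_exp_int(1)[OF i]])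
        have "AE \<omega> in M. h q (U \<omega>) = real_cond_exp M ?H (indicator (I q)) \<omega>"
          using h[OF q0] by (simp add: factorized_cond_exp_def)
        then show "AE \<omega> in M. indicator (C q) \<omega> *\<^sub>R real_cond_exp M ?H (indicator (I q)) \<omega> \<le>
            indicator (C q) \<omega> *\<^sub>R \<epsilon>"
          by eventually_elim (auto simp: C_def B_def indicator_def)
      qed (simp add: emeasure_eq_measure)
      also have "\<dots> = \<epsilon> * measure M (C q)" by (simp add: set_lebesgue_integral_def)
      finally show ?thesis .
    qed
    have "measure M (\<Union>q\<in>Q. I q \<inter> B \<epsilon> q) \<le> measure M (\<Union>q\<in>Q. I q \<inter> C q)"
      using sub Q CM I by (intro finite_measure_mono sets.finite_UN) auto
    also have "\<dots> \<le> (\<Sum>q\<in>Q. measure M (I q \<inter> C q))"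
      using Q CM I by (intro finite_measure_subadditive_finite) auto
    also have "\<dots> \<le> (\<Sum>q\<in>Q. \<epsilon> * measure M (C q))" by (rule sum_mono) (rule le)
    also have "\<dots> = \<epsilon> * measure M (\<Union>q\<in>Q. C q)"
      using finite_measure_finite_Union[OF Q(1) _ disj] CM by (simp add: sum_distrib_left image_subset_iff)
    also have "\<dots> \<le> \<epsilon>" using \<open>0 < \<epsilon>\<close> by simp
    finally show ?thesis .
  qed
  define Q where "Q n = {q \<in> real_of_rat ` from_nat ` {..<n}. 0 \<le> q}" for n :: nat
  have Q: "finite (Q n)" "Q n \<subseteq> {0..}" for n by (auto simp: Q_def)
  have Q_mono: "Q m \<subseteq> Q n" if "m \<le> n" for m n using that by (auto simp: Q_def)
  have Q_all: "\<exists>n. q \<in> Q n" if q: "q \<in> \<rat>" "0 \<le> q" for q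
  proof -
    obtain r where "q = real_of_rat r" using q(1) by (auto simp: Rats_def)
    then have "q \<in> Q (Suc (to_nat r))" using q(2) by (force simp: Q_def image_iff)
    then show ?thesis by blast
  qed
  define A where "A \<epsilon> n = (\<Union>q\<in>Q n. I q \<inter> B \<epsilon> q)" for \<epsilon> n
  have AM: "A \<epsilon> n \<in> sets M" for \<epsilon> n
    unfolding A_def using Q I BM by (intro sets.finite_UN) (auto intro!: sets.Int, (metis Q_def mem_Collect_eq)+)
  have AU: "measure M (\<Union>n. A \<epsilon> n) \<le> \<epsilon>" if "0 < \<epsilon>" for \<epsilon>
  proof (rule LIMSEQ_le_const2)
    show "(\<lambda>n. measure M (A \<epsilon> n)) \<longlonglongrightarrow> measure M (\<Union>n. A \<epsilon> n)"
    proof (rule finite_Lim_measure_incseq)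
      show "incseq (A \<epsilon>)" unfolding incseq_def A_def by (intro allI impI UN_mono Q_mono) auto
    qed (use AM in auto)
    show "\<exists>N. \<forall>n\<ge>N. measure M (A \<epsilon> n) \<le> \<epsilon>"
      unfolding A_def using fin[OF Q that] by blast
  qed
  define E where "E = (\<Inter>k. \<Union>n. A (1 / Suc k) n)"
  have EM: "E \<in> sets M" unfolding E_def using AM by auto
  have "measure M E \<le> 1 / Suc k" for k
  proof -
    have "measure M E \<le> measure M (\<Union>n. A (1 / Suc k) n)"
      using AM by (intro finite_measure_mono) (auto simp: E_def)
    also have "\<dots> \<le> 1 / Suc k" by (rule AU) simp
    finally show ?thesis .
  qed
  then have "measure M E \<le> 0"
    by (intro LIMSEQ_le_const[OF LIMSEQ_Suc[OF lim_1_over_n]]) auto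
  then have "measure M E = 0" using measure_nonneg[of M E] by linarith
  then have "E \<in> null_sets M" using EM by (auto simp: emeasure_eq_measure)
  then have "AE \<omega> in M. \<omega> \<notin> E" by (rule AE_not_in)
  then show ?thesis
    using AE_space
  proof eventually_elim
    case (elim \<omega>)
    then obtain k where k: "\<And>n. \<omega> \<notin> A (1 / Suc k) n" by (auto simp: E_def)
    have "1 / Suc k \<le> h q (U \<omega>)" if q: "q \<in> \<rat>" "0 \<le> q" "\<omega> \<in> I q" for q
    proof -
      obtain n where "q \<in> Q n" using Q_all q by blast
      then have "\<omega> \<notin> B (1 / Suc k) q" using k[of n] q by (auto simp: A_def)
      then show ?thesis using entered[OF q(2,3)] elim by (auto simp: B_def)
    qed
    then show ?case by (intro exI[of _ "1 / Suc k"]) auto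
  qed
qed

lemma countable_rational_lists: "countable {xs :: real list. set xs \<subseteq> \<rat>}"
  using countable_lists[OF countable_rat] by (simp add: lists_eq_set)

text \<open>Increments of a version are conditional expectations of increments, so each single partition sum is
  bounded by the conditional expectation of a common bound.\<close>

lemma (in prob_space) cond_exp_process_finite_variation:
  assumes U: "U \<in> M \<rightarrow>\<^sub>M N" and g: "cond_exp_process_cadlag M X U N g"
    and X: "\<And>t. 0 \<le> t \<Longrightarrow> integrable M (X t)"
    and W: "\<And>n::nat. integrable M (W n)"
    and dom: "\<And>n. AE \<omega> in M. \<forall>xs. sorted xs \<longrightarrow> set xs \<subseteq> {0..real n} \<longrightarrow>
      partition_sum (\<lambda>t. X t \<omega>) xs \<le> W n \<omega>"
  shows "AE \<omega> in M. finite_variation_on_compacts (\<lambda>t. g t (U \<omega>))"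
proof -
  let ?H = "vimage_algebra (space M) U N"
  have H: "subalgebra M ?H" by (rule subalgebra_vimage_algebra[OF U])
  interpret H: sigma_finite_subalgebra M ?H by (rule sigma_finite_subalgebraI[OF H])
  have "AE \<omega> in M. sorted xs \<and> set xs \<subseteq> {0..real n} \<longrightarrow>
      partition_sum (\<lambda>t. g t (U \<omega>)) xs \<le> real_cond_exp M ?H (W n) \<omega>" for xs n
  proof (cases "sorted xs \<and> set xs \<subseteq> {0..real n}")
    case True
    let ?I = "{..<length xs - 1}"
    define d where "d i \<omega> = (if i \<in> ?I then \<bar>X (xs ! Suc i) \<omega> - X (xs ! i) \<omega>\<bar> else 0)" for i \<omega>
    have pos: "0 \<le> xs ! i" if "i < length xs" for i using True nth_mem[OF that] by auto
    have di: "integrable M (d i)" for i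
    proof (cases "i \<in> ?I")
      case True
      then have "integrable M (X (xs ! i))" "integrable M (X (xs ! Suc i))" using pos X by auto
      then show ?thesis using True by (simp add: d_def[abs_def])
    qed (simp add: d_def[abs_def])
    have gd: "AE \<omega> in M. \<bar>g (xs ! Suc i) (U \<omega>) - g (xs ! i) (U \<omega>)\<bar> \<le> real_cond_exp M ?H (d i) \<omega>"
      if "i \<in> ?I" for i
    proof -
      have i: "0 \<le> xs ! i" "0 \<le> xs ! Suc i" using that pos by auto
      have di_eq: "d i = (\<lambda>\<omega>. \<bar>X (xs ! Suc i) \<omega> - X (xs ! i) \<omega>\<bar>)"
        using that by (auto simp: d_def)
      have "AE \<omega> in M. g (xs ! i) (U \<omega>) = real_cond_exp M ?H (X (xs ! i)) \<omega>"
        "AE \<omega> in M. g (xs ! Suc i) (U \<omega>) = real_cond_exp M ?H (X (xs ! Suc i)) \<omega>"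
        using g i by (auto simp: cond_exp_process_cadlag_def factorized_cond_exp_def)
      moreover have "AE \<omega> in M. real_cond_exp M ?H (\<lambda>\<omega>. X (xs ! Suc i) \<omega> - X (xs ! i) \<omega>) \<omega> =
          real_cond_exp M ?H (X (xs ! Suc i)) \<omega> - real_cond_exp M ?H (X (xs ! i)) \<omega>"
        using i X by (intro H.real_cond_exp_diff) auto
      moreover have "AE \<omega> in M. \<bar>real_cond_exp M ?H (\<lambda>\<omega>. X (xs ! Suc i) \<omega> - X (xs ! i) \<omega>) \<omega>\<bar> \<le>
          real_cond_exp M ?H (\<lambda>\<omega>. \<bar>X (xs ! Suc i) \<omega> - X (xs ! i) \<omega>\<bar>) \<omega>"
        using i X by (intro H.real_cond_exp_abs_le) auto
      ultimately show ?thesis unfolding di_eq by eventually_elim simp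
    qed
    have "AE \<omega> in M. \<forall>i\<in>?I. \<bar>g (xs ! Suc i) (U \<omega>) - g (xs ! i) (U \<omega>)\<bar> \<le> real_cond_exp M ?H (d i) \<omega>"
      using gd by (intro AE_finite_allI) auto
    moreover have "AE \<omega> in M. real_cond_exp M ?H (\<lambda>\<omega>. \<Sum>i\<in>?I. d i \<omega>) \<omega> =
        (\<Sum>i\<in>?I. real_cond_exp M ?H (d i) \<omega>)"
      by (rule H.real_cond_exp_sum) (rule di)
    moreover have "AE \<omega> in M. real_cond_exp M ?H (\<lambda>\<omega>. \<Sum>i\<in>?I. d i \<omega>) \<omega> \<le> real_cond_exp M ?H (W n) \<omega>"
    proof (rule H.real_cond_exp_mono)
      show "AE \<omega> in M. (\<Sum>i\<in>?I. d i \<omega>) \<le> W n \<omega>"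
        using dom[of n] by eventually_elim (use True in \<open>auto simp: partition_sum_def d_def\<close>)
    qed (use di W in auto)
    ultimately show ?thesis
    proof eventually_elim
      case (elim \<omega>)
      have "partition_sum (\<lambda>t. g t (U \<omega>)) xs \<le> (\<Sum>i\<in>?I. real_cond_exp M ?H (d i) \<omega>)"
        unfolding partition_sum_def using elim(1) by (intro sum_mono) auto
      then show ?case using elim by simp
    qed
  qed auto
  then have "AE \<omega> in M. \<forall>xs\<in>{xs. set xs \<subseteq> \<rat>}. sorted xs \<and> set xs \<subseteq> {0..real n} \<longrightarrow>
      partition_sum (\<lambda>t. g t (U \<omega>)) xs \<le> real_cond_exp M ?H (W n) \<omega>" for n
    by (intro AE_ball_countable[THEN iffD2] countable_rational_lists ballI)
  then have "AE \<omega> in M. \<forall>n. \<forall>xs\<in>{xs. set xs \<subseteq> \<rat>}. sorted xs \<and> set xs \<subseteq> {0..real n} \<longrightarrow>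
      partition_sum (\<lambda>t. g t (U \<omega>)) xs \<le> real_cond_exp M ?H (W n) \<omega>"
    by (simp only: AE_all_countable) simp
  moreover have "AE \<omega> in M. cadlag (\<lambda>t. g t (U \<omega>))" using g by (simp add: cond_exp_process_cadlag_def)
  ultimately show ?thesis
  proof eventually_elim
    case (elim \<omega>)
    show ?case
    proof (rule finite_variationI, intro exI allI impI)
      fix t :: real and xs assume "0 \<le> t" and xs: "sorted xs" "set xs \<subseteq> {0..t}"
      show "partition_sum (\<lambda>t. g t (U \<omega>)) xs \<le> real_cond_exp M ?H (W (nat \<lceil>t + 1\<rceil>)) \<omega>"
      proof (rule partition_sum_le_of_rational[OF _ _ xs])
        show "continuous (at_right s) (\<lambda>t. g t (U \<omega>))" if "0 \<le> s" for s
          using elim(2) that by (simp add: cadlag_def)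
        fix ys assume ys: "sorted ys" "set ys \<subseteq> {0..t+1} \<inter> \<rat>"
        have "t + 1 \<le> real (nat \<lceil>t + 1\<rceil>)" using \<open>0 \<le> t\<close> by linarith
        then have "set ys \<subseteq> {0..real (nat \<lceil>t + 1\<rceil>)}" using ys by auto
        then show "partition_sum (\<lambda>t. g t (U \<omega>)) ys \<le> real_cond_exp M ?H (W (nat \<lceil>t + 1\<rceil>)) \<omega>"
          using elim(1) ys by auto
      qed
    qed
  qed
qed

text \<open>The lower integral of the possibly non-measurable variation bounds the integral of a supremum over
  countably many partitions, which in turn dominates all partitions of a slightly smaller interval.\<close>

lemma (in prob_space) integrable_variation_bound:
  assumes Y: "\<And>t. 0 \<le> t \<Longrightarrow> Y t \<in> borel_measurable M"
    and rc: "AE \<omega> in M. \<forall>t\<ge>0. continuous (at_right t) (\<lambda>t. Y t \<omega>)"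
    and fin: "(\<integral>\<^sup>+\<omega>. variation (\<lambda>s. Y s \<omega>) 0 (t + 1) \<partial>M) < \<infinity>"
  shows "\<exists>W. integrable M W \<and> (\<forall>\<omega>. 0 \<le> W \<omega>) \<and>
    (AE \<omega> in M. \<forall>xs. sorted xs \<longrightarrow> set xs \<subseteq> {0..t} \<longrightarrow> partition_sum (\<lambda>t. Y t \<omega>) xs \<le> W \<omega>)"
proof -
  define L where "L = {xs. sorted xs \<and> set xs \<subseteq> {0..t+1} \<inter> \<rat>}"
  have cL: "countable L" unfolding L_def by (rule countable_subset[OF _ countable_rational_lists]) auto
  define V where "V \<omega> = (\<Squnion>xs\<in>L. ennreal (partition_sum (\<lambda>t. Y t \<omega>) xs))" for \<omega>
  have "(\<lambda>\<omega>. ennreal (partition_sum (\<lambda>t. Y t \<omega>) xs)) \<in> borel_measurable M" if "xs \<in> L" for xs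
  proof -
    have pos: "0 \<le> xs ! i" if "i < length xs" for i using \<open>xs \<in> L\<close> nth_mem[OF that] by (auto simp: L_def)
    show ?thesis
      unfolding partition_sum_def
      by (intro measurable_compose[OF _ measurable_ennreal] borel_measurable_sum borel_measurable_abs
          borel_measurable_diff Y pos) auto
  qed
  then have Vm[measurable]: "V \<in> borel_measurable M"
    unfolding V_def[abs_def] by (intro borel_measurable_SUP cL)
  have "V \<omega> \<le> variation (\<lambda>s. Y s \<omega>) 0 (t + 1)" for \<omega>
    unfolding V_def by (intro SUP_least partition_sum_le_variation) (auto simp: L_def)
  then have "(\<integral>\<^sup>+\<omega>. V \<omega> \<partial>M) \<le> (\<integral>\<^sup>+\<omega>. variation (\<lambda>s. Y s \<omega>) 0 (t + 1) \<partial>M)"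
    by (intro nn_integral_mono)
  then have Vfin: "(\<integral>\<^sup>+\<omega>. V \<omega> \<partial>M) < \<infinity>" using fin by (rule le_less_trans)
  then have "AE \<omega> in M. V \<omega> \<noteq> \<infinity>" by (intro nn_integral_PInf_AE) auto
  define W where "W \<omega> = enn2real (V \<omega>)" for \<omega>
  have "integrable M W"
  proof (rule integrableI_bounded)
    have "(\<integral>\<^sup>+\<omega>. ennreal (norm (W \<omega>)) \<partial>M) \<le> (\<integral>\<^sup>+\<omega>. V \<omega> \<partial>M)"
      by (intro nn_integral_mono) (auto simp: W_def ennreal_enn2real_if)
    then show "(\<integral>\<^sup>+\<omega>. ennreal (norm (W \<omega>)) \<partial>M) < \<infinity>" using Vfin by (rule le_less_trans)
  qed (simp add: W_def[abs_def])
  moreover have "AE \<omega> in M. \<forall>xs. sorted xs \<longrightarrow> set xs \<subseteq> {0..t} \<longrightarrow> partition_sum (\<lambda>t. Y t \<omega>) xs \<le> W \<omega>"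
    using \<open>AE \<omega> in M. V \<omega> \<noteq> \<infinity>\<close> rc
  proof eventually_elim
    case (elim \<omega>)
    show ?case
    proof (intro allI impI)
      fix xs assume xs: "sorted xs" "set xs \<subseteq> {0..t}"
      show "partition_sum (\<lambda>t. Y t \<omega>) xs \<le> W \<omega>"
      proof (rule partition_sum_le_of_rational[OF _ _ xs])
        fix ys assume "sorted ys" "set ys \<subseteq> {0..t+1} \<inter> \<rat>"
        then have "ennreal (partition_sum (\<lambda>t. Y t \<omega>) ys) \<le> V \<omega>"
          unfolding V_def by (intro SUP_upper) (auto simp: L_def)
        also have "V \<omega> = ennreal (W \<omega>)" using elim(1) by (simp add: W_def ennreal_enn2real_if)
        finally show "partition_sum (\<lambda>t. Y t \<omega>) ys \<le> W \<omega>" by (subst (asm) ennreal_le_iff) (auto simp: W_def)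
      qed (use elim in blast)
    qed
  qed
  moreover have "0 \<le> W \<omega>" for \<omega> by (simp add: W_def)
  ultimately show ?thesis by blast
qed

section \<open>Measurability of the jump process\<close>

locale jump_process = prob_space M for M :: "'a measure" +
  fixes Z :: "real \<Rightarrow> 'a \<Rightarrow> 's::{countable,discrete_topology}"
  assumes complete: "complete_measure M" and jump: "pure_jump_process M Z"
begin

lemma path: "\<omega> \<in> space M \<Longrightarrow> jump_path Z \<omega>"
  using jump by (auto simp: pure_jump_process_def jump_path_def)

lemma Z_measurable: "0 \<le> t \<Longrightarrow> Z t \<in> M \<rightarrow>\<^sub>M count_space UNIV"
  using jump by (auto simp: pure_jump_process_def)

text \<open>Sigma-algebras that observe the process up to time \<open>t\<close>; both the natural filtration and \<open>M\<close> itself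
  are of this kind.\<close>

definition observes :: "'a measure \<Rightarrow> real \<Rightarrow> bool" where
  "observes G t \<longleftrightarrow> space G = space M \<and> (\<forall>s. 0 \<le> s \<longrightarrow> s \<le> t \<longrightarrow> Z s \<in> G \<rightarrow>\<^sub>M count_space UNIV)"

lemma observes_M: "observes M t"
  by (simp add: observes_def Z_measurable)

lemma observes_mono: "observes G t \<Longrightarrow> s \<le> t \<Longrightarrow> observes G s"
  by (auto simp: observes_def)

lemma observes_exits_ge:
  assumes "observes G t"
  shows "{\<omega> \<in> space M. n \<le> exits Z j t \<omega>} \<in> sets G"
  using assms
proof (induction n arbitrary: t)
  case 0
  then have "space M = space G" by (simp add: observes_def)
  then show ?case by simp
next
  case (Suc n)
  have sp: "space G = space M" using Suc.prems by (simp add: observes_def)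
  let ?A = "\<lambda>q r. {\<omega> \<in> space M. n \<le> exits Z j q \<omega>} \<inter>
    ((Z q -` {j} \<inter> space G) \<inter> (Z r -` (-{j}) \<inter> space G))"
  have "{\<omega> \<in> space M. Suc n \<le> exits Z j t \<omega>} = (\<Union>q\<in>{q\<in>\<rat>. 0 \<le> q}. \<Union>r\<in>{r\<in>\<rat>. q < r \<and> r < t}. ?A q r)"
  proof (rule set_eqI)
    fix \<omega>
    show "\<omega> \<in> {\<omega> \<in> space M. Suc n \<le> exits Z j t \<omega>} \<longleftrightarrow>
        \<omega> \<in> (\<Union>q\<in>{q\<in>\<rat>. 0 \<le> q}. \<Union>r\<in>{r\<in>\<rat>. q < r \<and> r < t}. ?A q r)"
    proof (cases "\<omega> \<in> space M")
      case True
      show ?thesis by (simp add: True sp jump_path.Suc_le_exits_iff[OF path[OF True]]) blast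
    qed auto
  qed
  also have "\<dots> \<in> sets G"
  proof (intro sets.countable_UN'')
    fix q r assume "q \<in> {q\<in>\<rat>. 0 \<le> q}" "r \<in> {r\<in>\<rat>. q < r \<and> r < t}"
    then have qr: "0 \<le> q" "q \<le> t" "0 \<le> r" "r \<le> t" by auto
    have 1: "{\<omega> \<in> space M. n \<le> exits Z j q \<omega>} \<in> sets G"
      by (rule Suc.IH[OF observes_mono[OF Suc.prems qr(2)]])
    have "Z q \<in> G \<rightarrow>\<^sub>M count_space UNIV" "Z r \<in> G \<rightarrow>\<^sub>M count_space UNIV"
      using Suc.prems qr by (auto simp: observes_def)
    then have 2: "Z q -` {j} \<inter> space G \<in> sets G" "Z r -` (-{j}) \<inter> space G \<in> sets G"
      by (auto intro!: measurable_sets)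
    show "?A q r \<in> sets G" by (rule sets.Int[OF 1 sets.Int[OF 2]])
  qed (auto intro: countable_subset[OF _ countable_rat])
  finally show ?case .
qed

lemma observes_ZJ:
  assumes "observes G t" "0 \<le> t"
  shows "{\<omega> \<in> space M. ZJ Z t \<omega> = x} \<in> sets G"
proof -
  obtain j n where x: "x = (j, n)" by (cases x)
  have sp: "space G = space M" using assms by (simp add: observes_def)
  have "{\<omega> \<in> space M. ZJ Z t \<omega> = x} = (Z t -` {j} \<inter> space G) \<inter>
     ({\<omega> \<in> space M. n \<le> exits Z j t \<omega>} - {\<omega> \<in> space M. Suc n \<le> exits Z j t \<omega>})"
    by (auto simp: x jump_path.ZJ_eq_iff[OF path] sp)
  also have "\<dots> \<in> sets G"
  proof (rule sets.Int)
    show "{\<omega> \<in> space M. n \<le> exits Z j t \<omega>} - {\<omega> \<in> space M. Suc n \<le> exits Z j t \<omega>} \<in> sets G"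
      by (intro sets.Diff observes_exits_ge[OF assms(1)])
    have "Z t \<in> G \<rightarrow>\<^sub>M count_space UNIV" using assms by (simp add: observes_def)
    then show "Z t -` {j} \<inter> space G \<in> sets G" by (rule measurable_sets) simp
  qed
  finally show ?thesis .
qed

lemma ZJ_measurable:
  assumes "0 \<le> t"
  shows "ZJ Z t \<in> M \<rightarrow>\<^sub>M count_space UNIV"
  unfolding measurable_count_space_eq2_countable
proof (intro conjI ballI)
  fix x
  have "{\<omega> \<in> space M. ZJ Z t \<omega> = x} \<in> sets M" by (rule observes_ZJ[OF observes_M assms])
  moreover have "ZJ Z t -` {x} \<inter> space M = {\<omega> \<in> space M. ZJ Z t \<omega> = x}" by auto
  ultimately show "ZJ Z t -` {x} \<inter> space M \<in> sets M" by simp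
qed simp

lemma entry_nonneg: "\<omega> \<in> space M \<Longrightarrow> 0 \<le> entry_time Z x \<omega>"
  by (rule jump_path.entry_time_nonneg[OF path])

lemma not_entry_le: "\<omega> \<in> space M \<Longrightarrow> a < 0 \<Longrightarrow> \<not> entry_time Z x \<omega> \<le> a"
  using entry_nonneg[of \<omega> x] by (auto simp: not_le)

lemma observes_entry_le:
  assumes "observes G t" "s \<le> t"
  shows "{\<omega> \<in> space M. entry_time Z x \<omega> \<le> ereal s} \<in> sets G"
proof (cases "0 \<le> s")
  case False
  then have "{\<omega> \<in> space M. entry_time Z x \<omega> \<le> ereal s} = {}"
    using not_entry_le[of _ "ereal s" x] by auto
  then show ?thesis by (simp only: sets.empty_sets)
next
  case True
  have "entry_time Z x \<omega> \<le> ereal s \<longleftrightarrow> ZJ Z s \<omega> = x \<or> (\<exists>q\<in>{q\<in>\<rat>. 0 \<le> q \<and> q < s}. ZJ Z q \<omega> = x)"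
    if \<omega>: "\<omega> \<in> space M" for \<omega>
  proof
    interpret jump_path Z \<omega> by (rule path[OF \<omega>])
    assume le: "entry_time Z x \<omega> \<le> ereal s"
    then obtain T where T: "0 \<le> T" "T \<le> s" "ZJ Z T \<omega> = x"
      by (cases x rule: entry_time_cases) auto
    obtain u where u: "T < u" "\<And>r. T \<le> r \<Longrightarrow> r < u \<Longrightarrow> ZJ Z r \<omega> = ZJ Z T \<omega>"
      using ZJ_right_constant[OF T(1)] by blast
    show "ZJ Z s \<omega> = x \<or> (\<exists>q\<in>{q\<in>\<rat>. 0 \<le> q \<and> q < s}. ZJ Z q \<omega> = x)"
    proof (cases "T = s")
      case False
      then obtain q where "q \<in> \<rat>" "T < q" "q < min u s"
        using Rats_dense_in_real[of T "min u s"] u(1) T by auto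
      then show ?thesis using u(2)[of q] T by (intro disjI2 bexI[of _ q]) auto
    qed (use T in simp)
  next
    interpret jump_path Z \<omega> by (rule path[OF \<omega>])
    assume "ZJ Z s \<omega> = x \<or> (\<exists>q\<in>{q\<in>\<rat>. 0 \<le> q \<and> q < s}. ZJ Z q \<omega> = x)"
    then obtain q where "0 \<le> q" "q \<le> s" "ZJ Z q \<omega> = x" using True by force
    then show "entry_time Z x \<omega> \<le> ereal s"
      using entry_time_le[of q x] by (meson ereal_less_eq(3) order_trans)
  qed
  then have "{\<omega> \<in> space M. entry_time Z x \<omega> \<le> ereal s} = {\<omega> \<in> space M. ZJ Z s \<omega> = x} \<union>
      (\<Union>q\<in>{q\<in>\<rat>. 0 \<le> q \<and> q < s}. {\<omega> \<in> space M. ZJ Z q \<omega> = x})" by blast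
  also have "\<dots> \<in> sets G"
    using assms True by (intro sets.Un sets.countable_UN'' observes_ZJ observes_mono[OF assms(1)])
      (auto intro: countable_subset[OF _ countable_rat])
  finally show ?thesis .
qed

text \<open>Entry times after \<open>t\<close> are replaced by infinity, which leaves the part of the entry times and of the
  information variables that is known at time \<open>t\<close>.\<close>

definition stopped_entry :: "real \<Rightarrow> 's \<times> nat \<Rightarrow> 'a \<Rightarrow> ereal" where
  "stopped_entry t x \<omega> = (if entry_time Z x \<omega> \<le> ereal t then entry_time Z x \<omega> else \<infinity>)"

definition stopped_info :: "real \<Rightarrow> 's \<times> nat \<Rightarrow> 'a \<Rightarrow> ('s \<times> nat \<Rightarrow> ereal)" where
  "stopped_info t x \<omega> =
     (\<lambda>y. stopped_entry t y \<omega> * of_bool (stopped_entry t y \<omega> \<le> stopped_entry t x \<omega>))"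

lemma observes_stopped_entry:
  assumes "observes G t"
  shows "stopped_entry t x \<in> borel_measurable G"
proof (rule borel_measurableI_le)
  have sp: "space G = space M" using assms by (simp add: observes_def)
  fix a :: ereal
  show "{\<omega> \<in> space G. stopped_entry t x \<omega> \<le> a} \<in> sets G"
  proof (cases a)
    case (real r)
    have "{\<omega> \<in> space G. stopped_entry t x \<omega> \<le> a} = {\<omega> \<in> space M. entry_time Z x \<omega> \<le> ereal (min r t)}"
      unfolding real sp
      by (cases "r \<le> t")
        (auto simp: stopped_entry_def min_def intro: order_trans[where y = "ereal t"] order_trans[where y = "ereal r"])
    then show ?thesis using observes_entry_le[OF assms, of "min r t" x] by simp
  next
    case MInf
    have "{\<omega> \<in> space G. stopped_entry t x \<omega> \<le> a} = {}"
      unfolding MInf sp using not_entry_le[of _ "-\<infinity>" x] by (auto simp: stopped_entry_def)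
    then show ?thesis by (simp only: sets.empty_sets)
  qed auto
qed

lemma entry_time_measurable: "entry_time Z x \<in> borel_measurable M"
proof (rule borel_measurableI_le)
  fix a :: ereal
  show "{\<omega> \<in> space M. entry_time Z x \<omega> \<le> a} \<in> sets M"
  proof (cases a)
    case (real r)
    then show ?thesis using observes_entry_le[OF observes_M order_refl] by simp
  next
    case MInf
    have "{\<omega> \<in> space M. entry_time Z x \<omega> \<le> a} = {}"
      unfolding MInf using not_entry_le[of _ "-\<infinity>" x] by auto
    then show ?thesis by (simp only: sets.empty_sets)
  qed auto
qed

lemma observes_stopped_info:
  assumes "observes G t"
  shows "stopped_info t x \<in> borel_measurable G"
proof (rule measurable_coordinatewise_then_product)
  note [measurable] = observes_stopped_entry[OF assms]
  show "(\<lambda>\<omega>. stopped_info t x \<omega> y) \<in> borel_measurable G" for y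
    unfolding stopped_info_def of_bool_def by measurable
qed

lemma stopped_info_eq:
  "entry_time Z x \<omega> \<le> ereal t \<Longrightarrow> stopped_info t x \<omega> = full_info Z x \<omega>"
  by (auto simp: stopped_info_def full_info_def stopped_entry_def fun_eq_iff dest: order_trans)

lemma full_info_measurable [measurable]: "full_info Z x \<in> borel_measurable M"
proof (rule measurable_coordinatewise_then_product)
  note [measurable] = entry_time_measurable
  show "(\<lambda>\<omega>. full_info Z x \<omega> y) \<in> borel_measurable M" for y
    unfolding full_info_def of_bool_def by measurable
qed

lemma full_info_self: "full_info Z x \<omega> x = entry_time Z x \<omega>"
  by (simp add: full_info_def)

abbreviation "info_algebra x \<equiv> vimage_algebra (space M) (full_info Z x) borel"

lemma coordinate_measurable: "(\<lambda>u. u y) \<in> borel_measurable (borel :: ('s \<times> nat \<Rightarrow> ereal) measure)"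
  by measurable

lemma full_info_info_algebra: "full_info Z x \<in> borel_measurable (info_algebra x)"
  by (rule measurable_vimage_algebra1) simp

lemma entry_time_info_algebra: "entry_time Z x \<in> borel_measurable (info_algebra x)"
  using measurable_compose[OF full_info_info_algebra coordinate_measurable[of x], of x]
  by (simp add: full_info_self)

lemma subalgebra_info: "subalgebra M (info_algebra x)"
  by (rule subalgebra_vimage_algebra) measurable

lemma natural_generators:
  "{Z s -` {j} \<inter> space M |s j. 0 \<le> s \<and> s \<le> t} \<union> null_sets M \<subseteq> sets M"
  using measurable_sets[OF Z_measurable] by auto

lemma sets_natural_filtration:
  "sets (natural_filtration M Z t) =
    sigma_sets (space M) ({Z s -` {j} \<inter> space M |s j. 0 \<le> s \<and> s \<le> t} \<union> null_sets M)"
  unfolding natural_filtration_def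
  using natural_generators sets.space_closed[of M] by (intro sets_measure_of) blast

lemma space_natural_filtration: "space (natural_filtration M Z t) = space M"
  unfolding natural_filtration_def by (simp add: space_measure_of_conv)

lemma subalgebra_natural_filtration: "subalgebra M (natural_filtration M Z t)"
  unfolding subalgebra_def space_natural_filtration sets_natural_filtration
  using sets.sigma_sets_subset[OF natural_generators] by auto

lemma null_sets_natural_filtration: "null_sets M \<subseteq> sets (natural_filtration M Z t)"
  unfolding sets_natural_filtration by (auto intro: sigma_sets.Basic)

lemma observes_natural_filtration: "observes (natural_filtration M Z t) t"
  unfolding observes_def space_natural_filtration
proof (intro conjI allI impI refl)
  fix s assume s: "0 \<le> s" "s \<le> t"
  show "Z s \<in> natural_filtration M Z t \<rightarrow>\<^sub>M count_space UNIV"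
    unfolding measurable_count_space_eq2_countable
    using s by (auto simp: space_natural_filtration sets_natural_filtration intro!: sigma_sets.Basic)
qed

lemma info_pair_measurable:
  assumes "0 \<le> t"
  shows "(\<lambda>\<omega>. (ZJ Z t \<omega>, full_info Z (ZJ Z t \<omega>) \<omega>)) \<in> M \<rightarrow>\<^sub>M count_space UNIV \<Otimes>\<^sub>M borel"
  by (intro measurable_Pair ZJ_measurable[OF assms]
      measurable_compose_countable[OF full_info_measurable ZJ_measurable[OF assms]])

text \<open>While \<open>x\<close> is occupied, the pair that generates \<open>\<G>\<^sub>t\<close> is \<open>(x, \<xi>\<^sub>x)\<close>. This and the next lemma are the two
  inclusions between the traces of \<open>\<G>\<^sub>t\<close> and \<open>\<sigma>(\<xi>\<^sub>x)\<close>.\<close>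

lemma info_family_trace:
  assumes t: "0 \<le> t" and A: "A \<in> sets (info_family M Z (full_info Z) t)"
  shows "\<exists>B\<in>sets borel. AE \<omega> in M. ZJ Z t \<omega> = x \<longrightarrow> (\<omega> \<in> A \<longleftrightarrow> full_info Z x \<omega> \<in> B)"
proof -
  obtain B where B: "B \<in> sets (count_space UNIV \<Otimes>\<^sub>M borel)"
    "AE \<omega> in M. \<omega> \<in> A \<longleftrightarrow> (ZJ Z t \<omega>, full_info Z (ZJ Z t \<omega>) \<omega>) \<in> B"
    using sigma_gen_null_AE[OF info_pair_measurable[OF t]] A by (auto simp: info_family_def)
  have "Pair x -` B \<in> sets borel" using B(1) by (rule sets_Pair1)
  moreover have "AE \<omega> in M. ZJ Z t \<omega> = x \<longrightarrow> (\<omega> \<in> A \<longleftrightarrow> full_info Z x \<omega> \<in> Pair x -` B)"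
    using B(2) by eventually_elim auto
  ultimately show ?thesis by blast
qed

lemma info_family_occupied:
  assumes t: "0 \<le> t" and B: "B \<in> sets (info_algebra x)"
  shows "B \<inter> {\<omega> \<in> space M. ZJ Z t \<omega> = x} \<in> sets (info_family M Z (full_info Z) t)"
proof -
  let ?U = "\<lambda>\<omega>. (ZJ Z t \<omega>, full_info Z (ZJ Z t \<omega>) \<omega>)"
  obtain B' where B': "B' \<in> sets borel" "B = full_info Z x -` B' \<inter> space M"
    using B by (auto simp: sets_vimage_algebra2)
  have "{x} \<times> B' \<in> sets (count_space UNIV \<Otimes>\<^sub>M borel)" using B' by (intro pair_measureI) auto
  then have 1: "?U -` ({x} \<times> B') \<inter> space M \<in> sets (vimage_algebra (space M) ?U (count_space UNIV \<Otimes>\<^sub>M borel))"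
    by (rule in_vimage_algebra)
  have 2: "?U -` ({x} \<times> B') \<inter> space M = B \<inter> {\<omega> \<in> space M. ZJ Z t \<omega> = x}"
    using B' by auto
  have 3: "sets (vimage_algebra (space M) ?U (count_space UNIV \<Otimes>\<^sub>M borel))
      \<subseteq> sets (info_family M Z (full_info Z) t)"
    using vimage_subalgebra_sigma_gen_null[of M ?U "count_space UNIV \<Otimes>\<^sub>M borel"]
    by (simp only: info_family_def subalgebra_def)
  show ?thesis using subsetD[OF 3 1] unfolding 2 .
qed

lemma subalgebra_info_family: "0 \<le> t \<Longrightarrow> subalgebra M (info_family M Z (full_info Z) t)"
  unfolding info_family_def by (rule subalgebra_sigma_gen_null[OF info_pair_measurable])

end

section \<open>Occupation of a state and its payments\<close>

context jump_path
begin

lemma occupation_eq: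
  assumes "0 \<le> t"
  shows "of_bool (ZJ Z t \<omega> = x) = (of_bool (entry_time Z x \<omega> \<le> ereal t) - of_bool (exit_time Z x \<omega> \<le> ereal t) :: real)"
proof -
  have "entry_time Z x \<omega> \<le> ereal t" if "exit_time Z x \<omega> \<le> ereal t"
  proof -
    have "entry_time Z x \<omega> \<le> exit_time Z x \<omega>"
      unfolding exit_time_def by (rule INF_greatest) auto
    then show ?thesis using that by (rule order_trans)
  qed
  then show ?thesis unfolding ZJ_iff_times[OF assms] by (auto simp: not_less not_le)
qed

lemma cadlag_fv_occupation: "cadlag_fv (\<lambda>t. of_bool (ZJ Z t \<omega> = x) :: real)"
  by (rule cadlag_fv_cong[OF cadlag_fv_diff[OF cadlag_fv_step cadlag_fv_step] occupation_eq])

lemma partition_sum_occupation: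
  assumes xs: "sorted xs" "set xs \<subseteq> {0..t}"
  shows "partition_sum (\<lambda>t. of_bool (ZJ Z t \<omega> = x)) xs \<le> 2"
proof -
  let ?e = "\<lambda>t. of_bool (entry_time Z x \<omega> \<le> ereal t) :: real"
    and ?s = "\<lambda>t. of_bool (exit_time Z x \<omega> \<le> ereal t) :: real"
  have "partition_sum (\<lambda>t. of_bool (ZJ Z t \<omega> = x)) xs \<le> 1 * partition_sum ?e xs + 1 * partition_sum ?s xs"
    using xs by (rule partition_sum_dominated) (simp add: occupation_eq)
  also have "\<dots> \<le> 1 * 1 + 1 * 1"
    by (intro add_mono mult_left_mono partition_sum_step xs(1)) auto
  finally show ?thesis by simp
qed

text \<open>The contribution of a sojourn in \<open>x\<close> to the integral. The denominator is bounded away from zero up to the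
  exit, where the contribution jumps to its final value, whatever that is.\<close>

lemma cadlag_fv_sojourn_contribution:
  assumes g: "cadlag_fv g" and h: "cadlag_fv h" and "0 < \<epsilon>"
    and low: "\<And>t. 0 \<le> t \<Longrightarrow> ZJ Z t \<omega> = x \<Longrightarrow> \<epsilon> \<le> h t"
    and f: "\<And>t. 0 \<le> t \<Longrightarrow> f t = g t / h t"
  shows "cadlag_fv (\<lambda>t. of_bool (entry_time Z x \<omega> < ereal t) *
    (f (real_of_ereal (min (exit_time Z x \<omega>) (ereal t))) - f (real_of_ereal (entry_time Z x \<omega>))))"
    (is "cadlag_fv ?X")
proof (cases x rule: entry_time_cases)
  case never
  then show ?thesis by (simp add: cadlag_fv_const)
next
  case (visit T)
  let ?S = "exit_time Z x \<omega>"
  define e where "e t = (of_bool (ZJ Z t \<omega> = x) :: real)" for t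
  define s where "s t = (of_bool (?S \<le> ereal t) :: real)" for t
  have TS: "ereal T < ?S" using entry_less_exit[of x] visit by simp
  \<comment> \<open>During the sojourn the maximum is \<open>h t\<close>; elsewhere it keeps the quotient regular.\<close>
  have "cadlag_fv (\<lambda>t. e t * (g t * (1 / max \<epsilon> (h t)) + - f T) + s t * (f (real_of_ereal ?S) - f T))"
    unfolding e_def s_def
    by (intro cadlag_fv_add cadlag_fv_mult cadlag_fv_occupation cadlag_fv_const g cadlag_fv_step
        cadlag_fv_inverse_max h \<open>0 < \<epsilon>\<close>)
  then show ?thesis
  proof (rule cadlag_fv_cong)
    fix t :: real assume t: "0 \<le> t"
    consider "t < T" | "T \<le> t" "ereal t < ?S" | "?S \<le> ereal t" by (metis not_le)
    then show "?X t = e t * (g t * (1 / max \<epsilon> (h t)) + - f T) + s t * (f (real_of_ereal ?S) - f T)"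
    proof cases
      case 1
      then have "ereal t < ?S" using TS by (metis less_ereal.simps(1) less_trans)
      then show ?thesis using 1 visit t by (auto simp: e_def s_def not_le)
    next
      case 2
      then have x: "ZJ Z t \<omega> = x" using visit t by (simp add: ZJ_iff_times)
      have "max \<epsilon> (h t) = h t" using low[OF t x] by simp
      then have "g t * (1 / max \<epsilon> (h t)) = f t" using f[OF t] by simp
      moreover have "min ?S (ereal t) = ereal t" using less_imp_le[OF 2(2)] by (rule min_absorb2)
      moreover have "s t = 0" "e t = 1" using 2 x by (auto simp: s_def e_def not_le)
      ultimately show ?thesis using 2 visit by (cases "t = T") auto
    next
      case 3
      then have "s t = 1" "e t = 0" "min ?S (ereal t) = ?S"
        using t by (auto simp: s_def e_def min_def ZJ_iff_times not_less)
      moreover have "ereal T < ereal t" using TS 3 by (rule less_le_trans)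
      ultimately show ?thesis using visit by simp
    qed
  qed
qed

end

text \<open>The properties of the future payments that carry the argument\<close>

locale jump_payments = jump_process M Z
  for M :: "'a measure" and Z :: "real \<Rightarrow> 'a \<Rightarrow> 's::{countable,discrete_topology}" +
  fixes Y :: "real \<Rightarrow> 'a \<Rightarrow> real"
  assumes Y_integrable: "0 \<le> t \<Longrightarrow> integrable M (Y t)"
    and Y_right_continuous: "AE \<omega> in M. \<forall>t\<ge>0. continuous (at_right t) (\<lambda>t. Y t \<omega>)"
    and Y_variation: "0 \<le> t \<Longrightarrow> (\<integral>\<^sup>+\<omega>. variation (\<lambda>s. Y s \<omega>) 0 t \<partial>M) < \<infinity>"
begin

abbreviation "occ x t \<omega> \<equiv> (of_bool (ZJ Z t \<omega> = x) :: real)"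

lemma occ_measurable: "0 \<le> t \<Longrightarrow> occ x t \<in> borel_measurable M"
  by (rule measurable_compose[OF ZJ_measurable, of t "\<lambda>y. of_bool (y = x)"]) auto

lemma occ_integrable: "0 \<le> t \<Longrightarrow> integrable M (occ x t)"
  by (rule Bochner_Integration.integrable_bound[OF integrable_const[of "1::real"] occ_measurable]) auto

lemma occ_Y_integrable:
  assumes "0 \<le> t"
  shows "integrable M (\<lambda>\<omega>. occ x t \<omega> * Y t \<omega>)"
proof (rule Bochner_Integration.integrable_bound[OF Y_integrable[OF assms]])
  show "(\<lambda>\<omega>. occ x t \<omega> * Y t \<omega>) \<in> borel_measurable M"
    using occ_measurable[OF assms] Y_integrable[OF assms] by (intro borel_measurable_times) auto
qed auto

lemma occ_right_continuous: "AE \<omega> in M. \<forall>t\<ge>0. continuous (at_right t) (\<lambda>t. occ x t \<omega>)"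
  using AE_space
proof eventually_elim
  case (elim \<omega>)
  show ?case
    using jump_path.cadlag_fv_occupation[OF path[OF elim], of x] by (simp add: cadlag_fv_def cadlag_def)
qed

lemma occ_Y_right_continuous:
  "AE \<omega> in M. \<forall>t\<ge>0. continuous (at_right t) (\<lambda>t. occ x t \<omega> * Y t \<omega>)"
  using occ_right_continuous[of x] Y_right_continuous
  by eventually_elim (auto intro: continuous_mult)

text \<open>By the product rule for increments: the indicator has variation at most 2, and the path of \<open>Y\<close> is
  bounded by its initial value and its variation.\<close>

lemma ex_bound_occ_Y:
  obtains W where "\<And>n::nat. integrable M (W n)"
    "\<And>n. AE \<omega> in M. \<forall>xs. sorted xs \<longrightarrow> set xs \<subseteq> {0..real n} \<longrightarrow>
      partition_sum (\<lambda>t. occ x t \<omega> * Y t \<omega>) xs \<le> W n \<omega>"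
    "\<And>n. AE \<omega> in M. \<forall>t\<in>{0..real n}. \<bar>occ x t \<omega> * Y t \<omega>\<bar> \<le> W n \<omega>"
proof -
  have "\<exists>W. integrable M W \<and> (\<forall>\<omega>. 0 \<le> W \<omega>) \<and>
    (AE \<omega> in M. \<forall>xs. sorted xs \<longrightarrow> set xs \<subseteq> {0..real n} \<longrightarrow> partition_sum (\<lambda>t. Y t \<omega>) xs \<le> W \<omega>)"
    for n
    by (rule integrable_variation_bound[OF _ Y_right_continuous Y_variation]) (use Y_integrable in auto)
  then have "\<exists>W. \<forall>n. integrable M (W n) \<and> (\<forall>\<omega>. 0 \<le> W n \<omega>) \<and>
    (AE \<omega> in M. \<forall>xs. sorted xs \<longrightarrow> set xs \<subseteq> {0..real n} \<longrightarrow>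
      partition_sum (\<lambda>t. Y t \<omega>) xs \<le> W n \<omega>)"
    by (intro choice allI)
  then obtain W where "\<forall>n. integrable M (W n) \<and> (\<forall>\<omega>. 0 \<le> W n \<omega>) \<and>
    (AE \<omega> in M. \<forall>xs. sorted xs \<longrightarrow> set xs \<subseteq> {0..real n} \<longrightarrow>
      partition_sum (\<lambda>t. Y t \<omega>) xs \<le> W n \<omega>)"
    by (elim exE)
  then have W: "\<And>n::nat. integrable M (W n)" "\<And>n \<omega>. 0 \<le> W n \<omega>"
    "\<And>n. AE \<omega> in M. \<forall>xs. sorted xs \<longrightarrow> set xs \<subseteq> {0..real n} \<longrightarrow>
      partition_sum (\<lambda>t. Y t \<omega>) xs \<le> W n \<omega>"
    by blast+
  define K where "K n \<omega> = \<bar>Y 0 \<omega>\<bar> + W n \<omega>" for n \<omega>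
  have K: "\<bar>Y t \<omega>\<bar> \<le> K n \<omega>"
    if "\<forall>xs. sorted xs \<longrightarrow> set xs \<subseteq> {0..real n} \<longrightarrow> partition_sum (\<lambda>t. Y t \<omega>) xs \<le> W n \<omega>"
      "0 \<le> t" "t \<le> real n" for n \<omega> t
    unfolding K_def by (rule abs_le_of_partition_sums[OF that(2,3)]) (use that(1) in blast)
  show thesis
  proof (rule that[of "\<lambda>n \<omega>. K n \<omega> * 2 + 1 * W n \<omega>"])
    show "integrable M (\<lambda>\<omega>. K n \<omega> * 2 + 1 * W n \<omega>)" for n
      unfolding K_def using W(1) Y_integrable[of 0] by simp
    show "AE \<omega> in M. \<forall>xs. sorted xs \<longrightarrow> set xs \<subseteq> {0..real n} \<longrightarrow>
      partition_sum (\<lambda>t. occ x t \<omega> * Y t \<omega>) xs \<le> K n \<omega> * 2 + 1 * W n \<omega>" for n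
      using W(3)[of n] AE_space
    proof eventually_elim
      case (elim \<omega>)
      interpret jump_path Z \<omega> using elim by (intro path)
      have K0: "0 \<le> K n \<omega>" using W(2)[of n \<omega>] by (simp add: K_def)
      show ?case
      proof (intro allI impI)
        fix xs assume xs: "sorted xs" "set xs \<subseteq> {0..real n}"
        have "partition_sum (\<lambda>t. occ x t \<omega> * Y t \<omega>) xs \<le>
            K n \<omega> * partition_sum (\<lambda>t. occ x t \<omega>) xs + 1 * partition_sum (\<lambda>t. Y t \<omega>) xs"
          using xs
        proof (rule partition_sum_dominated)
          fix a b :: real assume ab: "0 \<le> a" "a \<le> b" "b \<le> real n"
          have "occ x b \<omega> * Y b \<omega> - occ x a \<omega> * Y a \<omega> =
              (occ x b \<omega> - occ x a \<omega>) * Y b \<omega> + occ x a \<omega> * (Y b \<omega> - Y a \<omega>)" by (simp add: algebra_simps)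
          also have "\<bar>\<dots>\<bar> \<le> \<bar>Y b \<omega>\<bar> * \<bar>occ x b \<omega> - occ x a \<omega>\<bar> + \<bar>occ x a \<omega>\<bar> * \<bar>Y b \<omega> - Y a \<omega>\<bar>"
            by (rule order_trans[OF abs_triangle_ineq]) (simp add: abs_mult)
          also have "\<dots> \<le> K n \<omega> * \<bar>occ x b \<omega> - occ x a \<omega>\<bar> + 1 * \<bar>Y b \<omega> - Y a \<omega>\<bar>"
            using K[OF elim(1), of b] ab by (intro add_mono mult_right_mono) auto
          finally show "\<bar>occ x b \<omega> * Y b \<omega> - occ x a \<omega> * Y a \<omega>\<bar> \<le>
              K n \<omega> * \<bar>occ x b \<omega> - occ x a \<omega>\<bar> + 1 * \<bar>Y b \<omega> - Y a \<omega>\<bar>" .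
        qed
        also have "\<dots> \<le> K n \<omega> * 2 + 1 * W n \<omega>"
          using partition_sum_occupation[OF xs, of x] elim(1) xs K0
          by (intro add_mono mult_left_mono) auto
        finally show "partition_sum (\<lambda>t. occ x t \<omega> * Y t \<omega>) xs \<le> K n \<omega> * 2 + 1 * W n \<omega>" .
      qed
    qed
    show "AE \<omega> in M. \<forall>t\<in>{0..real n}. \<bar>occ x t \<omega> * Y t \<omega>\<bar> \<le> K n \<omega> * 2 + 1 * W n \<omega>" for n
      using W(3)[of n]
    proof eventually_elim
      case (elim \<omega>)
      show ?case
      proof
        fix t assume "t \<in> {0..real n}"
        then have "\<bar>Y t \<omega>\<bar> \<le> K n \<omega>" using K[OF elim, of t] by simp
        then have "\<bar>occ x t \<omega> * Y t \<omega>\<bar> \<le> K n \<omega>" by (cases "ZJ Z t \<omega> = x") auto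
        then show "\<bar>occ x t \<omega> * Y t \<omega>\<bar> \<le> K n \<omega> * 2 + 1 * W n \<omega>"
          using W(2)[of n \<omega>] by (simp add: K_def)
      qed
    qed
  qed
qed

abbreviation "entry_before x m \<equiv> {\<omega> \<in> space M. entry_time Z x \<omega> < ereal m}"
abbreviation "entry_real x \<omega> \<equiv> real_of_ereal (entry_time Z x \<omega>)"

lemma entry_before_info: "entry_before x m \<in> sets (info_algebra x)"
proof -
  note [measurable] = entry_time_info_algebra[of x]
  have "{\<omega> \<in> space (info_algebra x). entry_time Z x \<omega> < ereal m} \<in> sets (info_algebra x)" by measurable
  then show ?thesis unfolding space_vimage_algebra .
qed

lemma entry_before_measurable: "entry_before x m \<in> sets M"
  using entry_before_info[of x m] subalgebra_info[of x] unfolding subalgebra_def by blast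

lemma entry_before_real:
  assumes "\<omega> \<in> entry_before x m"
  shows "entry_time Z x \<omega> = ereal (entry_real x \<omega>)" "0 \<le> entry_real x \<omega>" "entry_real x \<omega> \<le> m"
    "ZJ Z (entry_real x \<omega>) \<omega> = x"
proof -
  interpret jump_path Z \<omega> using assms by (intro path) simp
  obtain T where T: "entry_time Z x \<omega> = ereal T"
    using assms entry_time_nonneg[of x] by (cases "entry_time Z x \<omega>") auto
  show "entry_time Z x \<omega> = ereal (entry_real x \<omega>)" "0 \<le> entry_real x \<omega>" "entry_real x \<omega> \<le> m"
    "ZJ Z (entry_real x \<omega>) \<omega> = x"
    using T entry_time_leD[OF T] assms by auto
qed

lemma subalgebra_refl: "subalgebra M M"
  by (simp add: subalgebra_def)

lemma value_at_entry:
  assumes g: "cond_exp_process_cadlag M X (full_info Z x) borel g"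
    and X: "\<And>t. 0 \<le> t \<Longrightarrow> integrable M (X t)"
    and rc: "AE \<omega> in M. \<forall>t\<ge>0. continuous (at_right t) (\<lambda>t. X t \<omega>)"
    and W: "integrable M W" and dom: "AE \<omega> in M. \<forall>t\<in>{0..m+1}. \<bar>X t \<omega>\<bar> \<le> W \<omega>"
  shows "integrable M (\<lambda>\<omega>. indicator (entry_before x m) \<omega> * X (entry_real x \<omega>) \<omega>)"
    and "AE \<omega> in M. \<omega> \<in> entry_before x m \<longrightarrow> g (entry_real x \<omega>) (full_info Z x \<omega>) =
      real_cond_exp M (info_algebra x) (\<lambda>\<omega>. indicator (entry_before x m) \<omega> * X (entry_real x \<omega>) \<omega>) \<omega>"
proof -
  have T: "entry_real x \<in> borel_measurable (info_algebra x)"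
    using entry_time_info_algebra by measurable
  have TM: "entry_real x \<in> borel_measurable M"
    using entry_time_measurable by measurable
  have meas: "(\<lambda>\<omega>. indicator (entry_before x m) \<omega> * X (entry_real x \<omega>) \<omega>) \<in> borel_measurable M"
  proof (rule measurable_at_random_time[OF complete subalgebra_refl _ TM])
    show "(\<lambda>\<omega>. indicator (entry_before x m) \<omega> * X q \<omega>) \<in> borel_measurable M" if "0 \<le> q" for q
      using entry_before_measurable[of x m] X[OF that] by (intro borel_measurable_times borel_measurable_indicator) auto
    show "AE \<omega> in M. \<omega> \<in> entry_before x m \<longrightarrow> (\<forall>t\<ge>0. continuous (at_right t) (\<lambda>t. X t \<omega>))"
      using rc by eventually_elim blast
  qed (use entry_before_real(2)[of _ x m] in auto)
  note * = cond_exp_process_at_time[OF full_info_measurable g X rc W dom entry_before_info T _ meas]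
  show "integrable M (\<lambda>\<omega>. indicator (entry_before x m) \<omega> * X (entry_real x \<omega>) \<omega>)"
    by (rule *(1)) (use entry_before_real(2,3)[of _ x m] in auto)
  show "AE \<omega> in M. \<omega> \<in> entry_before x m \<longrightarrow> g (entry_real x \<omega>) (full_info Z x \<omega>) =
      real_cond_exp M (info_algebra x) (\<lambda>\<omega>. indicator (entry_before x m) \<omega> * X (entry_real x \<omega>) \<omega>) \<omega>"
    by (rule *(2)) (use entry_before_real(2,3)[of _ x m] in auto)
qed

abbreviation "Y_at_entry x m \<omega> \<equiv> indicator (entry_before x m) \<omega> * Y (entry_real x \<omega>) \<omega>"

lemma indicator_entry_occ:
  "indicator (entry_before x m) \<omega> * (occ x (entry_real x \<omega>) \<omega> * c) = indicator (entry_before x m) \<omega> * c"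
  using entry_before_real(4)[of \<omega> x m] by (cases "\<omega> \<in> entry_before x m") auto

text \<open>At its entry time \<open>x\<close> is occupied, so the indicator disappears. The restriction to entries before \<open>m\<close>
  is there because \<open>Y(T\<^sub>x)\<close> need not be integrable.\<close>

lemma occ_Y_at_entry:
  fixes m :: nat
  assumes g: "cond_exp_process_cadlag M (\<lambda>t \<omega>. occ x t \<omega> * Y t \<omega>) (full_info Z x) borel g"
  shows "integrable M (Y_at_entry x m)"
    and "AE \<omega> in M. \<omega> \<in> entry_before x m \<longrightarrow>
      g (entry_real x \<omega>) (full_info Z x \<omega>) = real_cond_exp M (info_algebra x) (Y_at_entry x m) \<omega>"
proof -
  obtain W where W: "\<And>n::nat. integrable M (W n)"
    "\<And>n. AE \<omega> in M. \<forall>xs. sorted xs \<longrightarrow> set xs \<subseteq> {0..real n} \<longrightarrow>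
      partition_sum (\<lambda>t. occ x t \<omega> * Y t \<omega>) xs \<le> W n \<omega>"
    "\<And>n. AE \<omega> in M. \<forall>t\<in>{0..real n}. \<bar>occ x t \<omega> * Y t \<omega>\<bar> \<le> W n \<omega>"
    using ex_bound_occ_Y[of x] by blast
  have "AE \<omega> in M. \<forall>t\<in>{0..real m+1}. \<bar>occ x t \<omega> * Y t \<omega>\<bar> \<le> W (Suc m) \<omega>"
    using W(3)[of "Suc m"] by (simp add: add.commute)
  note * = value_at_entry[OF g occ_Y_integrable occ_Y_right_continuous W(1) this]
  show "integrable M (Y_at_entry x m)" using *(1) unfolding indicator_entry_occ by simp
  show "AE \<omega> in M. \<omega> \<in> entry_before x m \<longrightarrow>
      g (entry_real x \<omega>) (full_info Z x \<omega>) = real_cond_exp M (info_algebra x) (Y_at_entry x m) \<omega>"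
    using *(2) unfolding indicator_entry_occ by simp
qed

lemma occ_at_entry:
  fixes m :: nat
  assumes h: "cond_exp_process_cadlag M (\<lambda>t \<omega>. occ x t \<omega>) (full_info Z x) borel h"
  shows "AE \<omega> in M. \<omega> \<in> entry_before x m \<longrightarrow> h (entry_real x \<omega>) (full_info Z x \<omega>) = 1"
proof -
  interpret H: sigma_finite_subalgebra M "info_algebra x"
    by (rule sigma_finite_subalgebraI[OF subalgebra_info])
  have "AE \<omega> in M. \<forall>t\<in>{0..real m+1}. \<bar>occ x t \<omega>\<bar> \<le> 1" by simp
  note * = value_at_entry[OF h occ_integrable occ_right_continuous integrable_const this]
  have eq: "(\<lambda>\<omega>. indicator (entry_before x m) \<omega> * occ x (entry_real x \<omega>) \<omega>) = indicator (entry_before x m)"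
    using indicator_entry_occ[of x m _ 1] by auto
  have "AE \<omega> in M. real_cond_exp M (info_algebra x) (indicator (entry_before x m)) \<omega> = indicator (entry_before x m) \<omega>"
    using entry_before_info[of x m] entry_before_measurable[of x m]
    by (intro H.real_cond_exp_F_meas) (auto simp: emeasure_eq_measure)
  moreover have "AE \<omega> in M. \<omega> \<in> entry_before x m \<longrightarrow> h (entry_real x \<omega>) (full_info Z x \<omega>) =
      real_cond_exp M (info_algebra x) (indicator (entry_before x m)) \<omega>"
    using *(2) unfolding eq by simp
  ultimately show ?thesis by eventually_elim auto
qed

lemma survival_bounded_below:
  assumes h: "cond_exp_process_cadlag M (\<lambda>t \<omega>. occ x t \<omega>) (full_info Z x) borel h"
  shows "AE \<omega> in M. \<exists>\<epsilon>>0. \<forall>t\<ge>0. ZJ Z t \<omega> = x \<longrightarrow> \<epsilon> \<le> h t (full_info Z x \<omega>)"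
proof -
  interpret H: sigma_finite_subalgebra M "info_algebra x"
    by (rule sigma_finite_subalgebraI[OF subalgebra_info])
  define I where "I t = {\<omega> \<in> space M. ZJ Z t \<omega> = x}" for t
  have IM: "I t \<in> sets M" if "0 \<le> t" for t unfolding I_def by (rule observes_ZJ[OF observes_M that])
  have fce: "factorized_cond_exp M (indicator (I q)) (full_info Z x) borel (h q)" if "0 \<le> q" for q
  proof -
    have "AE \<omega> in M. real_cond_exp M (info_algebra x) (indicator (I q)) \<omega> =
        real_cond_exp M (info_algebra x) (occ x q) \<omega>"
    proof (rule H.real_cond_exp_cong)
      show "AE \<omega> in M. indicator (I q) \<omega> = occ x q \<omega>"
        using AE_space by eventually_elim (auto simp: I_def indicator_def)
      show "indicator (I q) \<in> borel_measurable M" using IM[OF that] by simp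
    qed (rule occ_measurable[OF that])
    moreover have "h q \<in> borel_measurable borel"
      "AE \<omega> in M. h q (full_info Z x \<omega>) = real_cond_exp M (info_algebra x) (occ x q) \<omega>"
      using h that by (auto simp: cond_exp_process_cadlag_def factorized_cond_exp_def)
    ultimately show ?thesis unfolding factorized_cond_exp_def by auto
  qed
  have "AE \<omega> in M. \<exists>\<epsilon>>0. \<forall>q\<in>\<rat>. 0 \<le> q \<longrightarrow> \<omega> \<in> I q \<longrightarrow> \<epsilon> \<le> h q (full_info Z x \<omega>)"
  proof (rule cond_survival_bounded_below[OF full_info_measurable IM fce entry_time_info_algebra[of x]])
    fix p q \<omega>
    show "entry_time Z x \<omega> \<le> ereal q" if "0 \<le> q" "\<omega> \<in> I q" for q \<omega>
      using that jump_path.entry_time_le[OF path, of \<omega> q x] by (auto simp: I_def)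
    assume *: "0 \<le> p" "p \<le> q" "entry_time Z x \<omega> \<le> ereal p" "\<omega> \<in> I q"
    then interpret jump_path Z \<omega> by (intro path) (simp add: I_def)
    have "ereal q < exit_time Z x \<omega>" using * ZJ_iff_times[of q x] by (simp add: I_def)
    then have "ereal p < exit_time Z x \<omega>" using *(2) by (meson ereal_less_eq(3) le_less_trans)
    then show "\<omega> \<in> I p" using * ZJ_iff_times[of p x] by (simp add: I_def)
  qed auto
  moreover have "AE \<omega> in M. cadlag (\<lambda>t. h t (full_info Z x \<omega>))"
    using h by (simp add: cond_exp_process_cadlag_def)
  ultimately show ?thesis
    using AE_space
  proof eventually_elim
    case (elim \<omega>)
    interpret jump_path Z \<omega> by (rule path[OF elim(3)])
    obtain \<epsilon> where \<epsilon>: "0 < \<epsilon>" "\<And>q. q \<in> \<rat> \<Longrightarrow> 0 \<le> q \<Longrightarrow> \<omega> \<in> I q \<Longrightarrow> \<epsilon> \<le> h q (full_info Z x \<omega>)"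
      using elim(1) by blast
    have "\<epsilon> \<le> h t (full_info Z x \<omega>)" if t: "0 \<le> t" "ZJ Z t \<omega> = x" for t
    proof (rule LIMSEQ_le_const)
      show "(\<lambda>n. h (dyadic_above n t) (full_info Z x \<omega>)) \<longlonglongrightarrow> h t (full_info Z x \<omega>)"
        using elim(2) t by (intro tendsto_dyadic_above[of t "\<lambda>t. h t (full_info Z x \<omega>)"]) (auto simp: cadlag_def)
      obtain u where u: "t < u" "\<And>s. t \<le> s \<Longrightarrow> s < u \<Longrightarrow> ZJ Z s \<omega> = ZJ Z t \<omega>"
        using ZJ_right_constant[OF t(1)] by blast
      have "eventually (\<lambda>s. s < u) (at_right t)"
        using u(1) by (auto simp: eventually_at_right_field)
      then have "eventually (\<lambda>n. dyadic_above n t < u) sequentially"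
        by (rule eventually_compose_filterlim[OF _ dyadic_above_at_right])
      then have "eventually (\<lambda>n. \<epsilon> \<le> h (dyadic_above n t) (full_info Z x \<omega>)) sequentially"
      proof eventually_elim
        case (elim n)
        then have "ZJ Z (dyadic_above n t) \<omega> = x"
          using u(2)[of "dyadic_above n t"] dyadic_above_gt[of t n] t by simp
        then show ?case
          using \<open>\<omega> \<in> space M\<close> t dyadic_above_gt[of t n] by (intro \<epsilon>(2) dyadic_above_Rats) (auto simp: I_def)
      qed
      then show "\<exists>N. \<forall>n\<ge>N. \<epsilon> \<le> h (dyadic_above n t) (full_info Z x \<omega>)"
        by (simp add: eventually_sequentially)
    qed
    then show ?case using \<epsilon>(1) by blast
  qed
qed

lemma occ_Y_version_cadlag_fv:
  assumes g: "cond_exp_process_cadlag M (\<lambda>t \<omega>. occ x t \<omega> * Y t \<omega>) (full_info Z x) borel g"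
  shows "AE \<omega> in M. cadlag_fv (\<lambda>t. g t (full_info Z x \<omega>))"
proof -
  obtain W where W: "\<And>n::nat. integrable M (W n)"
    "\<And>n. AE \<omega> in M. \<forall>xs. sorted xs \<longrightarrow> set xs \<subseteq> {0..real n} \<longrightarrow>
      partition_sum (\<lambda>t. occ x t \<omega> * Y t \<omega>) xs \<le> W n \<omega>"
    "\<And>n. AE \<omega> in M. \<forall>t\<in>{0..real n}. \<bar>occ x t \<omega> * Y t \<omega>\<bar> \<le> W n \<omega>"
    using ex_bound_occ_Y[of x] by blast
  have "AE \<omega> in M. finite_variation_on_compacts (\<lambda>t. g t (full_info Z x \<omega>))"
    using W(1,2) by (intro cond_exp_process_finite_variation[OF full_info_measurable g occ_Y_integrable])
  moreover have "AE \<omega> in M. cadlag (\<lambda>t. g t (full_info Z x \<omega>))"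
    using g by (simp add: cond_exp_process_cadlag_def)
  ultimately show ?thesis by eventually_elim (simp add: cadlag_fv_def)
qed

lemma occ_version_cadlag_fv:
  assumes h: "cond_exp_process_cadlag M (\<lambda>t \<omega>. occ x t \<omega>) (full_info Z x) borel h"
  shows "AE \<omega> in M. cadlag_fv (\<lambda>t. h t (full_info Z x \<omega>))"
proof -
  have "AE \<omega> in M. \<forall>xs. sorted xs \<longrightarrow> set xs \<subseteq> {0..real n} \<longrightarrow>
      partition_sum (\<lambda>t. occ x t \<omega>) xs \<le> 2" for n
    using AE_space by eventually_elim (use jump_path.partition_sum_occupation[OF path] in blast)
  then have "AE \<omega> in M. finite_variation_on_compacts (\<lambda>t. h t (full_info Z x \<omega>))"
    by (intro cond_exp_process_finite_variation[OF full_info_measurable h occ_integrable, of "\<lambda>_ _. 2"]) auto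
  moreover have "AE \<omega> in M. cadlag (\<lambda>t. h t (full_info Z x \<omega>))"
    using h by (simp add: cond_exp_process_cadlag_def)
  ultimately show ?thesis by eventually_elim (simp add: cadlag_fv_def)
qed

section \<open>Identities between the reserves\<close>

text \<open>Localization on the event that \<open>x\<close> is occupied at \<open>t\<close>, where \<open>\<G>\<^sub>t\<close> and \<open>\<sigma>(\<xi>\<^sub>x)\<close> have the same trace\<close>

lemma state_reserve_eq_cond_exp:
  assumes v: "is_state_reserve M Z (full_info Z) Y x v" and t: "0 \<le> t"
  shows "AE \<omega> in M. ZJ Z t \<omega> = x \<longrightarrow> v t \<omega> = real_cond_exp M (info_family M Z (full_info Z) t) (Y t) \<omega>"
proof -
  let ?G = "info_family M Z (full_info Z) t" and ?H = "info_algebra x"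
  obtain g h where g: "cond_exp_process_cadlag M (\<lambda>t \<omega>. occ x t \<omega> * Y t \<omega>) (full_info Z x) borel g"
    and h: "cond_exp_process_cadlag M (\<lambda>t \<omega>. occ x t \<omega>) (full_info Z x) borel h"
    and gh: "\<And>t \<omega>. 0 \<le> t \<Longrightarrow> \<omega> \<in> space M \<Longrightarrow> v t \<omega> = g t (full_info Z x \<omega>) / h t (full_info Z x \<omega>)"
    using v unfolding is_state_reserve_def by blast
  interpret H: sigma_finite_subalgebra M ?H
    by (rule sigma_finite_subalgebraI[OF subalgebra_info])
  define C where "C = {\<omega> \<in> space M. ZJ Z t \<omega> = x}"
  have CM: "C \<in> sets M" unfolding C_def by (rule observes_ZJ[OF observes_M t])
  have sub: "subalgebra M ?G" by (rule subalgebra_info_family[OF t])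
  have BC: "B \<inter> C \<in> sets ?G" if "B \<in> sets ?H" for B
    unfolding C_def by (rule info_family_occupied[OF t that])
  have "space M \<in> sets ?H" using sets.top[of ?H] by (simp only: space_vimage_algebra)
  from BC[OF this] have CG: "C \<in> sets ?G" by (simp add: C_def Int_def)
  have AB: "\<exists>B\<in>sets ?H. AE \<omega> in M. \<omega> \<in> C \<longrightarrow> (\<omega> \<in> A \<longleftrightarrow> \<omega> \<in> B)" if A: "A \<in> sets ?G" for A
  proof -
    obtain B where B: "B \<in> sets borel" "AE \<omega> in M. ZJ Z t \<omega> = x \<longrightarrow> (\<omega> \<in> A \<longleftrightarrow> full_info Z x \<omega> \<in> B)"
      using info_family_trace[OF t A] by blast
    have "full_info Z x -` B \<inter> space M \<in> sets ?H" using B(1) by (rule in_vimage_algebra)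
    moreover have "AE \<omega> in M. \<omega> \<in> C \<longrightarrow> (\<omega> \<in> A \<longleftrightarrow> \<omega> \<in> full_info Z x -` B \<inter> space M)"
      using B(2) by eventually_elim (auto simp: C_def)
    ultimately show ?thesis by blast
  qed
  have "AE \<omega> in M. \<omega> \<in> C \<longrightarrow> 0 < real_cond_exp M ?H (indicator C) \<omega> \<and> real_cond_exp M ?G (Y t) \<omega> =
      real_cond_exp M ?H (\<lambda>\<omega>. indicator C \<omega> * Y t \<omega>) \<omega> / real_cond_exp M ?H (indicator C) \<omega>"
    by (rule real_cond_exp_local[OF sub subalgebra_info CG BC AB Y_integrable[OF t]])
  moreover have "AE \<omega> in M. real_cond_exp M ?H (\<lambda>\<omega>. indicator C \<omega> * Y t \<omega>) \<omega> =
      real_cond_exp M ?H (\<lambda>\<omega>. occ x t \<omega> * Y t \<omega>) \<omega>"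
  proof (rule H.real_cond_exp_cong)
    show "AE \<omega> in M. indicator C \<omega> * Y t \<omega> = occ x t \<omega> * Y t \<omega>"
      using AE_space by eventually_elim (auto simp: C_def indicator_def)
    show "(\<lambda>\<omega>. indicator C \<omega> * Y t \<omega>) \<in> borel_measurable M"
      using CM Y_integrable[OF t] by (intro borel_measurable_times borel_measurable_indicator) auto
    show "(\<lambda>\<omega>. occ x t \<omega> * Y t \<omega>) \<in> borel_measurable M"
      using occ_Y_integrable[OF t] by (rule borel_measurable_integrable)
  qed
  moreover have "AE \<omega> in M. real_cond_exp M ?H (indicator C) \<omega> = real_cond_exp M ?H (occ x t) \<omega>"
  proof (rule H.real_cond_exp_cong)
    show "AE \<omega> in M. indicator C \<omega> = occ x t \<omega>"
      using AE_space by eventually_elim (auto simp: C_def indicator_def)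
    show "indicator C \<in> borel_measurable M" using CM by (rule borel_measurable_indicator)
    show "occ x t \<in> borel_measurable M" by (rule occ_measurable[OF t])
  qed
  moreover have "AE \<omega> in M. g t (full_info Z x \<omega>) = real_cond_exp M ?H (\<lambda>\<omega>. occ x t \<omega> * Y t \<omega>) \<omega>"
    "AE \<omega> in M. h t (full_info Z x \<omega>) = real_cond_exp M ?H (occ x t) \<omega>"
    using g h t by (auto simp: cond_exp_process_cadlag_def factorized_cond_exp_def)
  ultimately show ?thesis
    using AE_space by eventually_elim (simp add: C_def gh[OF t])
qed

text \<open>At a fixed time \<open>t\<close>, the indicator of \<open>{T\<^sub>x \<noteq> t}\<close> can be pulled out of the conditional expectation given
  \<open>\<xi>\<^sub>x\<close>. This settles the rational times; right-continuity settles the others.\<close>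

lemma except_version_eq:
  assumes g: "cond_exp_process_cadlag M X (full_info Z x) borel g"
    and g': "cond_exp_process_except M X' (full_info Z x) borel g' (entry_time Z x)"
    and X: "\<And>t. 0 < t \<Longrightarrow> X t \<in> borel_measurable M"
    and eq: "\<And>t \<omega>. 0 < t \<Longrightarrow> \<omega> \<in> space M \<Longrightarrow> X' t \<omega> = of_bool (entry_time Z x \<omega> \<noteq> ereal t) * X t \<omega>"
  shows "AE \<omega> in M. \<forall>t>0. ereal t \<noteq> entry_time Z x \<omega> \<longrightarrow> g' t (full_info Z x \<omega>) = g t (full_info Z x \<omega>)"
proof -
  let ?H = "info_algebra x"
  interpret H: sigma_finite_subalgebra M ?H
    by (rule sigma_finite_subalgebraI[OF subalgebra_info])
  have "AE \<omega> in M. ereal q \<noteq> entry_time Z x \<omega> \<longrightarrow> g' q (full_info Z x \<omega>) = g q (full_info Z x \<omega>)"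
    if q: "0 < q" for q
  proof -
    define D where "D = {\<omega> \<in> space M. entry_time Z x \<omega> \<noteq> ereal q}"
    have DH: "D \<in> sets ?H"
    proof -
      note [measurable] = entry_time_info_algebra[of x]
      have "{\<omega> \<in> space ?H. entry_time Z x \<omega> \<noteq> ereal q} \<in> sets ?H" by measurable
      then show ?thesis unfolding D_def space_vimage_algebra .
    qed
    then have DM: "D \<in> sets M" using subalgebra_info[of x] unfolding subalgebra_def by blast
    have "AE \<omega> in M. real_cond_exp M ?H (\<lambda>\<omega>. indicator D \<omega> * X q \<omega>) \<omega> =
        indicator D \<omega> * real_cond_exp M ?H (X q) \<omega>"
      by (rule H.real_cond_exp_indicator[OF DH X[OF q]])
    moreover have "AE \<omega> in M. real_cond_exp M ?H (X' q) \<omega> = real_cond_exp M ?H (\<lambda>\<omega>. indicator D \<omega> * X q \<omega>) \<omega>"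
    proof (rule H.real_cond_exp_cong)
      show m: "(\<lambda>\<omega>. indicator D \<omega> * X q \<omega>) \<in> borel_measurable M"
        using DM X[OF q] by (intro borel_measurable_times borel_measurable_indicator) auto
      have eq': "X' q \<omega> = indicator D \<omega> * X q \<omega>" if "\<omega> \<in> space M" for \<omega>
        using eq[OF q that] that by (auto simp: D_def)
      then show "AE \<omega> in M. X' q \<omega> = indicator D \<omega> * X q \<omega>" by (intro AE_I2)
      show "X' q \<in> borel_measurable M" using m by (subst measurable_cong[OF eq'])
    qed
    moreover have "AE \<omega> in M. g' q (full_info Z x \<omega>) = real_cond_exp M ?H (X' q) \<omega>"
      "AE \<omega> in M. g q (full_info Z x \<omega>) = real_cond_exp M ?H (X q) \<omega>"
      using g g' q by (auto simp: cond_exp_process_cadlag_def cond_exp_process_except_def factorized_cond_exp_def)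
    ultimately show ?thesis
      using AE_space by eventually_elim (auto simp: D_def)
  qed
  then have "AE \<omega> in M. \<forall>q\<in>{q\<in>\<rat>. 0 < q}. ereal q \<noteq> entry_time Z x \<omega> \<longrightarrow>
      g' q (full_info Z x \<omega>) = g q (full_info Z x \<omega>)"
    by (subst AE_ball_countable) (auto intro: countable_subset[OF _ countable_rat])
  moreover have "AE \<omega> in M. cadlag (\<lambda>t. g t (full_info Z x \<omega>))"
    using g by (simp add: cond_exp_process_cadlag_def)
  moreover have "AE \<omega> in M. \<forall>t>0. ereal t \<noteq> entry_time Z x \<omega> \<longrightarrow>
      continuous (at_right t) (\<lambda>s. g' s (full_info Z x \<omega>))"
    using g' by (simp add: cond_exp_process_except_def)
  ultimately show ?thesis
  proof eventually_elim
    case (elim \<omega>)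
    show ?case
    proof (intro allI impI)
      fix t :: real assume t: "0 < t" "ereal t \<noteq> entry_time Z x \<omega>"
      have lim': "(\<lambda>n. g' (dyadic_above n t) (full_info Z x \<omega>)) \<longlonglongrightarrow> g' t (full_info Z x \<omega>)"
        using elim(3) t by (intro tendsto_dyadic_above[of t "\<lambda>t. g' t (full_info Z x \<omega>)"]) auto
      have lim: "(\<lambda>n. g (dyadic_above n t) (full_info Z x \<omega>)) \<longlonglongrightarrow> g t (full_info Z x \<omega>)"
        using elim(2) t
        by (intro tendsto_dyadic_above[of t "\<lambda>t. g t (full_info Z x \<omega>)"]) (auto simp: cadlag_def)
      have "eventually (\<lambda>s. ereal s \<noteq> entry_time Z x \<omega>) (at_right t)"
      proof (cases "entry_time Z x \<omega>")
        case (real e)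
        show ?thesis
        proof (cases "e < t")
          case True
          then show ?thesis using real by (auto simp: eventually_at_right_field intro!: exI[of _ "t + 1"])
        next
          case False
          then show ?thesis using real t(2) by (auto simp: eventually_at_right_field intro!: exI[of _ e])
        qed
      qed auto
      then have "eventually (\<lambda>n. ereal (dyadic_above n t) \<noteq> entry_time Z x \<omega>) sequentially"
        by (rule eventually_compose_filterlim[OF _ dyadic_above_at_right])
      then have ev: "eventually (\<lambda>n. g' (dyadic_above n t) (full_info Z x \<omega>) =
          g (dyadic_above n t) (full_info Z x \<omega>)) sequentially"
      proof eventually_elim
        case (elim n)
        then show ?case
          using \<open>\<forall>q\<in>{q\<in>\<rat>. 0 < q}. _ q\<close> t dyadic_above_gt[of t n] dyadic_above_Rats[of n t] by auto
      qed
      show "g' t (full_info Z x \<omega>) = g t (full_info Z x \<omega>)"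
        by (rule LIMSEQ_unique[OF lim' tendsto_cong[OF ev, THEN iffD2, OF lim]])
    qed
  qed
qed

lemma stay_reserve_eq:
  assumes v: "is_state_reserve M Z (full_info Z) Y x v" and vs: "is_stay_reserve M Z (full_info Z) Y x vs"
  shows "AE \<omega> in M. \<forall>t>0. ZJ_left Z t \<omega> = x \<longrightarrow> v t \<omega> = vs t \<omega>"
proof -
  obtain g h where g: "cond_exp_process_cadlag M (\<lambda>t \<omega>. occ x t \<omega> * Y t \<omega>) (full_info Z x) borel g"
    and h: "cond_exp_process_cadlag M (\<lambda>t \<omega>. occ x t \<omega>) (full_info Z x) borel h"
    and gh: "\<And>t \<omega>. 0 \<le> t \<Longrightarrow> \<omega> \<in> space M \<Longrightarrow> v t \<omega> = g t (full_info Z x \<omega>) / h t (full_info Z x \<omega>)"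
    using v unfolding is_state_reserve_def by blast
  obtain g' h' where g': "cond_exp_process_except M
      (\<lambda>t \<omega>. of_bool (ZJ_left Z t \<omega> = x) * of_bool (ZJ Z t \<omega> = x) * Y t \<omega>) (full_info Z x) borel g' (entry_time Z x)"
    and h': "cond_exp_process_except M
      (\<lambda>t \<omega>. of_bool (ZJ_left Z t \<omega> = x) * of_bool (ZJ Z t \<omega> = x)) (full_info Z x) borel h' (entry_time Z x)"
    and gh': "\<And>t \<omega>. 0 < t \<Longrightarrow> \<omega> \<in> space M \<Longrightarrow> vs t \<omega> = g' t (full_info Z x \<omega>) / h' t (full_info Z x \<omega>)"
    using vs unfolding is_stay_reserve_def by blast
  have stay: "of_bool (ZJ_left Z t \<omega> = x) * of_bool (ZJ Z t \<omega> = x) =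
      (of_bool (entry_time Z x \<omega> \<noteq> ereal t) * occ x t \<omega> :: real)" if "0 < t" "\<omega> \<in> space M" for t \<omega>
  proof -
    interpret jump_path Z \<omega> by (rule path[OF that(2)])
    have "ZJ_left Z t \<omega> = x \<and> ZJ Z t \<omega> = x \<longleftrightarrow> entry_time Z x \<omega> \<noteq> ereal t \<and> ZJ Z t \<omega> = x"
      using ZJ_left_iff_times[OF that(1), of x] ZJ_iff_times[of t x] that(1) by (auto simp: less_le)
    then show ?thesis by (auto split: if_splits)
  qed
  have "AE \<omega> in M. \<forall>t>0. ereal t \<noteq> entry_time Z x \<omega> \<longrightarrow> g' t (full_info Z x \<omega>) = g t (full_info Z x \<omega>)"
  proof (rule except_version_eq[OF g g'])
    show "(\<lambda>\<omega>. occ x t \<omega> * Y t \<omega>) \<in> borel_measurable M" if "0 < t" for t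
      using occ_Y_integrable[of t x] that by (intro borel_measurable_integrable) simp
  qed (simp add: stay)
  moreover have "AE \<omega> in M. \<forall>t>0. ereal t \<noteq> entry_time Z x \<omega> \<longrightarrow> h' t (full_info Z x \<omega>) = h t (full_info Z x \<omega>)"
  proof (rule except_version_eq[OF h h'])
    show "occ x t \<in> borel_measurable M" if "0 < t" for t
      using that by (intro occ_measurable) simp
  qed (rule stay)
  ultimately show ?thesis
    using AE_space
  proof eventually_elim
    case (elim \<omega>)
    interpret jump_path Z \<omega> by (rule path[OF elim(3)])
    show ?case
    proof (intro allI impI)
      fix t :: real assume t: "0 < t" "ZJ_left Z t \<omega> = x"
      then have "ereal t \<noteq> entry_time Z x \<omega>" using ZJ_left_iff_times[of t x] by auto
      then show "v t \<omega> = vs t \<omega>" using elim t gh[of t \<omega>] gh'[of t \<omega>] by simp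
    qed
  qed
qed

text \<open>Since \<open>\<xi>\<^sub>x\<close> discards the identity of a state entered at time zero, the state occupied before the entry
  of \<open>x\<close> is known to \<open>\<xi>\<^sub>x\<close> only because of \<open>\<F> = \<G>\<close>: at times shortly after the entry it is known to
  \<open>\<F>\<^sub>t = \<G>\<^sub>t\<close>, and therefore to \<open>\<xi>\<^sub>x\<close> as long as \<open>x\<close> is occupied. Suitable times are dyadic ones above \<open>T\<^sub>x\<close>,
  which are functions of \<open>\<xi>\<^sub>x\<close> and eventually precede the exit.\<close>

lemma previous_state_known:
  assumes FG: "\<And>t. 0 \<le> t \<Longrightarrow> sets (natural_filtration M Z t) = sets (info_family M Z (full_info Z) t)"
    and "y \<noteq> x"
  shows "{\<omega> \<in> space M. entry_time Z x \<omega> \<noteq> \<infinity> \<and> ZJ_left Z (entry_real x \<omega>) \<omega> = y}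
    \<in> sets (sigma_gen_null M (full_info Z x) borel)" (is "?C \<in> sets ?G")
proof -
  have C_iff: "\<omega> \<in> ?C \<longleftrightarrow> entry_time Z x \<omega> \<noteq> \<infinity> \<and> entry_time Z y \<omega> < entry_time Z x \<omega> \<and>
      (\<forall>z. \<not> (entry_time Z y \<omega> < entry_time Z z \<omega> \<and> entry_time Z z \<omega> < entry_time Z x \<omega>))"
    if \<omega>: "\<omega> \<in> space M" for \<omega>
  proof (cases "entry_time Z x \<omega> = \<infinity>")
    case False
    then obtain T where T: "entry_time Z x \<omega> = ereal T"
      using entry_nonneg[OF \<omega>, of x] by (cases "entry_time Z x \<omega>") auto
    show ?thesis
      using jump_path.ZJ_left_entry_iff[OF path[OF \<omega>] T \<open>y \<noteq> x\<close>] \<omega> T by simp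
  qed simp
  have "\<exists>B\<in>sets borel. AE \<omega> in M. ZJ Z t \<omega> = x \<longrightarrow> (\<omega> \<in> ?C \<longleftrightarrow> full_info Z x \<omega> \<in> B)" if t: "0 \<le> t" for t
  proof -
    let ?F = "natural_filtration M Z t"
    define A where "A = {\<omega> \<in> space M. stopped_entry t y \<omega> < stopped_entry t x \<omega> \<and>
      (\<forall>z. \<not> (stopped_entry t y \<omega> < stopped_entry t z \<omega> \<and> stopped_entry t z \<omega> < stopped_entry t x \<omega>))}"
    have "A \<in> sets ?F"
    proof -
      note [measurable] = observes_stopped_entry[OF observes_natural_filtration, of t]
      have "{\<omega> \<in> space ?F. stopped_entry t y \<omega> < stopped_entry t x \<omega> \<and>
        (\<forall>z. \<not> (stopped_entry t y \<omega> < stopped_entry t z \<omega> \<and> stopped_entry t z \<omega> < stopped_entry t x \<omega>))} \<in> sets ?F"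
        by measurable
      then show ?thesis unfolding A_def space_natural_filtration .
    qed
    then obtain B where B: "B \<in> sets borel"
      "AE \<omega> in M. ZJ Z t \<omega> = x \<longrightarrow> (\<omega> \<in> A \<longleftrightarrow> full_info Z x \<omega> \<in> B)"
      using info_family_trace[OF t] FG[OF t] by blast
    have "\<omega> \<in> A \<longleftrightarrow> \<omega> \<in> ?C" if "\<omega> \<in> space M" "ZJ Z t \<omega> = x" for \<omega>
    proof -
      have le: "entry_time Z x \<omega> \<le> ereal t"
        by (rule jump_path.entry_time_le[OF path[OF that(1)] t that(2)])
      then have x: "stopped_entry t x \<omega> = entry_time Z x \<omega>" "entry_time Z x \<omega> \<noteq> \<infinity>" by (auto simp: stopped_entry_def)
      have z: "stopped_entry t z \<omega> < entry_time Z x \<omega> \<longleftrightarrow> entry_time Z z \<omega> < entry_time Z x \<omega>" for z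
        using le by (auto simp: stopped_entry_def dest: less_le_trans)
      have z': "stopped_entry t z \<omega> = entry_time Z z \<omega>" if "entry_time Z z \<omega> < entry_time Z x \<omega>" for z
        using le that by (auto simp: stopped_entry_def dest: less_le_trans)
      have "\<omega> \<in> A \<longleftrightarrow> stopped_entry t y \<omega> < stopped_entry t x \<omega> \<and>
          (\<forall>u. \<not> (stopped_entry t y \<omega> < stopped_entry t u \<omega> \<and> stopped_entry t u \<omega> < stopped_entry t x \<omega>))"
        by (simp add: A_def that(1))
      also have "\<dots> \<longleftrightarrow> entry_time Z y \<omega> < entry_time Z x \<omega> \<and>
          (\<forall>u. \<not> (stopped_entry t y \<omega> < stopped_entry t u \<omega> \<and> entry_time Z u \<omega> < entry_time Z x \<omega>))"
        unfolding x(1) z by (rule refl)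
      also have "\<dots> \<longleftrightarrow> entry_time Z y \<omega> < entry_time Z x \<omega> \<and>
          (\<forall>u. \<not> (entry_time Z y \<omega> < entry_time Z u \<omega> \<and> entry_time Z u \<omega> < entry_time Z x \<omega>))"
      proof -
        have "stopped_entry t y \<omega> < stopped_entry t u \<omega> \<and> entry_time Z u \<omega> < entry_time Z x \<omega> \<longleftrightarrow>
            entry_time Z y \<omega> < entry_time Z u \<omega> \<and> entry_time Z u \<omega> < entry_time Z x \<omega>"
          if "entry_time Z y \<omega> < entry_time Z x \<omega>" for u
          using z'[of u] z'[of y] that by auto
        then show ?thesis by blast
      qed
      also have "\<dots> \<longleftrightarrow> \<omega> \<in> ?C"
        unfolding C_iff[OF that(1)] using x(2) by blast
      finally show ?thesis .
    qed
    then have "AE \<omega> in M. ZJ Z t \<omega> = x \<longrightarrow> (\<omega> \<in> ?C \<longleftrightarrow> full_info Z x \<omega> \<in> B)"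
      using B(2) AE_space by (auto elim!: AE_mp intro!: AE_I2)
    with B(1) show ?thesis by blast
  qed
  then have "\<exists>B. \<forall>t\<in>{0..}. B t \<in> sets borel \<and>
      (AE \<omega> in M. ZJ Z t \<omega> = x \<longrightarrow> (\<omega> \<in> ?C \<longleftrightarrow> full_info Z x \<omega> \<in> B t))"
    by (intro bchoice ballI) auto
  then obtain B where B: "\<And>t. 0 \<le> t \<Longrightarrow> B t \<in> sets borel"
    "\<And>t. 0 \<le> t \<Longrightarrow> AE \<omega> in M. ZJ Z t \<omega> = x \<longrightarrow> (\<omega> \<in> ?C \<longleftrightarrow> full_info Z x \<omega> \<in> B t)"
    by auto
  let ?H = "info_algebra x"
  \<comment> \<open>The test at the dyadic time of level \<open>n\<close> above the entry time, written out as a function of the integer part\<close>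
  define P where "P n \<omega> \<longleftrightarrow> full_info Z x \<omega> \<in> B (max 0 ((of_int \<lfloor>2 ^ n * entry_real x \<omega>\<rfloor> + 1) / 2 ^ n))" for n \<omega>
  define Q where "Q \<omega> \<longleftrightarrow> entry_time Z x \<omega> \<noteq> \<infinity> \<and> (\<exists>N. \<forall>n\<ge>N. P n \<omega>)" for \<omega>
  note [measurable] = entry_time_info_algebra[of x] full_info_info_algebra[of x]
  have "Measurable.pred ?H (P n)" for n
  proof -
    have "(\<lambda>\<omega>. \<lfloor>2 ^ n * entry_real x \<omega>\<rfloor>) \<in> ?H \<rightarrow>\<^sub>M count_space UNIV" by measurable
    then show ?thesis
      unfolding P_def[abs_def]
      by (rule measurable_compose_countable[where
            f = "\<lambda>k \<omega>. full_info Z x \<omega> \<in> B (max 0 ((of_int k + 1) / 2 ^ n))", rotated])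
        (intro pred_sets2[OF B(1)], auto)
  qed
  then have QH: "Measurable.pred ?H Q" unfolding Q_def by measurable
  have "AE \<omega> in M. \<forall>q\<in>{q\<in>\<rat>. 0 \<le> q}. ZJ Z q \<omega> = x \<longrightarrow> (\<omega> \<in> ?C \<longleftrightarrow> full_info Z x \<omega> \<in> B q)"
    using B(2) by (subst AE_ball_countable) (auto intro: countable_subset[OF _ countable_rat])
  then have ae: "AE \<omega> in M. Q \<omega> = (\<omega> \<in> ?C)"
    using AE_space
  proof eventually_elim
    case (elim \<omega>)
    interpret jump_path Z \<omega> by (rule path[OF elim(2)])
    show ?case
    proof (cases x rule: entry_time_cases)
      case never
      then show ?thesis by (simp add: Q_def)
    next
      case (visit T)
      obtain u where u: "T < u" "\<And>s. T \<le> s \<Longrightarrow> s < u \<Longrightarrow> ZJ Z s \<omega> = ZJ Z T \<omega>"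
        using ZJ_right_constant[OF visit(1)] by blast
      have "eventually (\<lambda>s. s < u) (at_right T)"
        using u(1) by (auto simp: eventually_at_right_field)
      then have "eventually (\<lambda>n. dyadic_above n T < u) sequentially"
        by (rule eventually_compose_filterlim[OF _ dyadic_above_at_right])
      then have "eventually (\<lambda>n. P n \<omega> = (\<omega> \<in> ?C)) sequentially"
      proof eventually_elim
        case (elim n)
        let ?d = "dyadic_above n T"
        have d: "T < ?d" "?d \<in> \<rat>" by (auto simp: dyadic_above_gt dyadic_above_Rats)
        then have "ZJ Z ?d \<omega> = x" using u(2)[of ?d] elim visit(3) by simp
        moreover have "max 0 ((of_int \<lfloor>2 ^ n * entry_real x \<omega>\<rfloor> + 1) / 2 ^ n) = ?d"
          using visit d by (simp add: dyadic_above_def)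
        ultimately show ?case
          using \<open>\<forall>q\<in>{q\<in>\<rat>. 0 \<le> q}. _ q\<close> d visit(1) unfolding P_def by auto
      qed
      then obtain N where N: "\<And>n. N \<le> n \<Longrightarrow> P n \<omega> = (\<omega> \<in> ?C)" by (auto simp: eventually_sequentially)
      have "(\<exists>N. \<forall>n\<ge>N. P n \<omega>) \<longleftrightarrow> \<omega> \<in> ?C"
      proof
        assume "\<exists>N. \<forall>n\<ge>N. P n \<omega>"
        then obtain N' where "\<forall>n\<ge>N'. P n \<omega>" by blast
        then have "P (max N N') \<omega>" by simp
        then show "\<omega> \<in> ?C" using N[of "max N N'"] by simp
      next
        assume "\<omega> \<in> ?C"
        then show "\<exists>N. \<forall>n\<ge>N. P n \<omega>" using N by blast
      qed
      then show ?thesis using visit by (simp add: Q_def)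
    qed
  qed
  have QG: "Measurable.pred ?G Q"
    using measurable_from_subalg[OF vimage_subalgebra_sigma_gen_null QH] .
  have "Measurable.pred ?G (\<lambda>\<omega>. \<omega> \<in> ?C)"
    by (rule measurable_AE_eq[OF complete subalgebra_sigma_gen_null[OF full_info_measurable]
          null_sets_sigma_gen_null QG ae]) simp
  then have "{\<omega> \<in> space ?G. \<omega> \<in> ?C} \<in> sets ?G" by measurable
  moreover have "space ?G = space M"
    using subalgebra_sigma_gen_null[OF full_info_measurable] by (simp add: subalgebra_def)
  moreover have "{\<omega> \<in> space M. \<omega> \<in> ?C} = ?C" by blast
  ultimately show ?thesis by simp
qed

text \<open>When \<open>x\<close> is entered from \<open>y\<close>, the variable \<open>\<xi>\<^sub>x\<close> carries the same information as \<open>\<xi>\<^sub>y\<close> together with \<open>T\<^sub>x\<close>.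
  Therefore localization on this event turns the conditional expectation of \<open>Y(T\<^sub>x)\<close> given \<open>\<xi>\<^sub>x\<close>, which is the
  value of the quotient for \<open>x\<close> at \<open>T\<^sub>x\<close>, into the jump quotient.\<close>

lemma reserve_at_entry:
  assumes FG: "\<And>t. 0 \<le> t \<Longrightarrow> sets (natural_filtration M Z t) = sets (info_family M Z (full_info Z) t)"
    and yx: "y \<noteq> x"
    and v: "is_state_reserve M Z (full_info Z) Y x v"
    and vj: "is_jump_reserve M Z (full_info Z) Y y x vj"
  shows "AE \<omega> in M. entry_time Z x \<omega> \<noteq> \<infinity> \<longrightarrow> ZJ_left Z (entry_real x \<omega>) \<omega> = y \<longrightarrow>
    vj (entry_real x \<omega>) \<omega> = v (entry_real x \<omega>) \<omega>"
proof -
  let ?H = "info_algebra x" and ?G = "sigma_gen_null M (full_info Z x) borel"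
    and ?U = "\<lambda>\<omega>. (full_info Z y \<omega>, entry_time Z x \<omega>)"
  let ?K = "vimage_algebra (space M) ?U (borel \<Otimes>\<^sub>M borel)"
  let ?X = "\<lambda>\<omega>. if entry_time Z x \<omega> = \<infinity> then 0
    else of_bool (ZJ_left Z (entry_real x \<omega>) \<omega> = y) * Y (entry_real x \<omega>) \<omega>"
  let ?I = "\<lambda>\<omega>. if entry_time Z x \<omega> = \<infinity> then 0 else of_bool (ZJ_left Z (entry_real x \<omega>) \<omega> = y) :: real"
  obtain g h where g: "cond_exp_process_cadlag M (\<lambda>t \<omega>. occ x t \<omega> * Y t \<omega>) (full_info Z x) borel g"
    and h: "cond_exp_process_cadlag M (\<lambda>t \<omega>. occ x t \<omega>) (full_info Z x) borel h"
    and gh: "\<And>t \<omega>. 0 \<le> t \<Longrightarrow> \<omega> \<in> space M \<Longrightarrow> v t \<omega> = g t (full_info Z x \<omega>) / h t (full_info Z x \<omega>)"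
    using v unfolding is_state_reserve_def by blast
  obtain g' h' where g': "factorized_cond_exp M ?X ?U (borel \<Otimes>\<^sub>M borel) g'"
    and h': "factorized_cond_exp M ?I ?U (borel \<Otimes>\<^sub>M borel) h'"
    and gh': "\<And>t \<omega>. 0 < t \<Longrightarrow> \<omega> \<in> space M \<Longrightarrow>
      vj t \<omega> = g' (full_info Z y \<omega>, ereal t) / h' (full_info Z y \<omega>, ereal t)"
    using vj unfolding is_jump_reserve_def by blast
  have UM: "?U \<in> M \<rightarrow>\<^sub>M borel \<Otimes>\<^sub>M borel"
    by (intro measurable_Pair full_info_measurable entry_time_measurable)
  have K: "subalgebra M ?K" by (rule subalgebra_vimage_algebra[OF UM])
  interpret K: sigma_finite_subalgebra M ?K by (rule sigma_finite_subalgebraI[OF K])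
  have G: "subalgebra M ?G" by (rule subalgebra_sigma_gen_null[OF full_info_measurable])
  have HG: "subalgebra ?G ?H" by (rule vimage_subalgebra_sigma_gen_null)
  define C where "C = {\<omega> \<in> space M. entry_time Z x \<omega> \<noteq> \<infinity> \<and> ZJ_left Z (entry_real x \<omega>) \<omega> = y}"
  have CG: "C \<in> sets ?G" unfolding C_def by (rule previous_state_known[OF FG yx])
  have CM: "C \<in> sets M" using CG G unfolding subalgebra_def by blast
  \<comment> \<open>On \<open>C\<close>, the two information variables are functions of each other.\<close>
  define \<Phi> where "\<Phi> u = ((\<lambda>z. if z = x then 0 else u z), u x)" for u :: "'s \<times> nat \<Rightarrow> ereal"
  define \<Psi> :: "('s \<times> nat \<Rightarrow> ereal) \<times> ereal \<Rightarrow> 's \<times> nat \<Rightarrow> ereal"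
    where "\<Psi> = (\<lambda>(u, e) z. if z = x then e else u z)"
  have on_C: "full_info Z y \<omega> z = (if z = x then 0 else full_info Z x \<omega> z)" if "\<omega> \<in> C" for \<omega> z
  proof -
    interpret jump_path Z \<omega> using that by (intro path) (simp add: C_def)
    have fin: "entry_time Z x \<omega> \<noteq> \<infinity>" "ZJ_left Z (entry_real x \<omega>) \<omega> = y" using that by (auto simp: C_def)
    then have T: "entry_time Z x \<omega> = ereal (entry_real x \<omega>)"
      using entry_time_nonneg[of x] by (cases "entry_time Z x \<omega>") auto
    note e = entry_time_le_iff_of_jump[OF T fin(2) yx]
    show ?thesis
    proof (cases "z = x")
      case True
      obtain w where "w \<noteq> x" using yx by blast
      from e(2)[OF this] have "\<not> entry_time Z x \<omega> \<le> entry_time Z y \<omega>" using T by (simp add: not_le)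
      then show ?thesis using True by (simp add: full_info_def)
    next
      case False
      then show ?thesis using e(1)[OF False] T by (simp add: full_info_def)
    qed
  qed
  have \<Phi>C: "?U \<omega> = \<Phi> (full_info Z x \<omega>)" and \<Psi>C: "full_info Z x \<omega> = \<Psi> (?U \<omega>)" if "\<omega> \<in> C" for \<omega>
    using on_C[OF that] by (auto simp: \<Phi>_def \<Psi>_def full_info_self fun_eq_iff)
  have \<Phi>m: "\<Phi> \<in> borel \<rightarrow>\<^sub>M borel \<Otimes>\<^sub>M borel"
  proof -
    have "(\<lambda>u z. if z = x then 0 else u z) \<in> borel_measurable (borel :: ('s \<times> nat \<Rightarrow> ereal) measure)"
    proof (rule measurable_coordinatewise_then_product)
      show "(\<lambda>u. if z = x then 0 else u z) \<in> borel_measurable (borel :: ('s \<times> nat \<Rightarrow> ereal) measure)" for z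
        by (cases "z = x") (auto intro: coordinate_measurable)
    qed
    then show ?thesis
      unfolding \<Phi>_def[abs_def] by (intro measurable_Pair coordinate_measurable)
  qed
  have \<Psi>m: "\<Psi> \<in> borel \<Otimes>\<^sub>M borel \<rightarrow>\<^sub>M borel"
  proof (rule measurable_coordinatewise_then_product)
    have "(\<lambda>u :: ('s \<times> nat \<Rightarrow> ereal) \<times> ereal. fst u z) \<in> borel_measurable (borel \<Otimes>\<^sub>M borel)" for z
      by (rule measurable_compose[OF measurable_fst coordinate_measurable])
    then show "(\<lambda>u. \<Psi> u z) \<in> borel_measurable (borel \<Otimes>\<^sub>M borel)" for z
      unfolding \<Psi>_def case_prod_unfold by (cases "z = x") auto
  qed
  have BC: "B \<inter> C \<in> sets ?G" if B: "B \<in> sets ?K" for B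
  proof -
    obtain B' where B': "B' \<in> sets (borel \<Otimes>\<^sub>M borel)" "B = ?U -` B' \<inter> space M"
      using B measurable_space[OF UM] by (auto simp: sets_vimage_algebra2)
    have "\<Phi> -` B' \<in> sets borel" using measurable_sets[OF \<Phi>m B'(1)] by simp
    then have "full_info Z x -` (\<Phi> -` B') \<inter> space M \<in> sets ?H" by (rule in_vimage_algebra)
    then have "full_info Z x -` (\<Phi> -` B') \<inter> space M \<in> sets ?G" using HG unfolding subalgebra_def by blast
    then have "(full_info Z x -` (\<Phi> -` B') \<inter> space M) \<inter> C \<in> sets ?G" using CG by (rule sets.Int)
    moreover have "(full_info Z x -` (\<Phi> -` B') \<inter> space M) \<inter> C = B \<inter> C"
      unfolding B'(2) using \<Phi>C by fastforce
    ultimately show ?thesis by simp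
  qed
  have AB: "\<exists>B\<in>sets ?K. AE \<omega> in M. \<omega> \<in> C \<longrightarrow> (\<omega> \<in> A \<longleftrightarrow> \<omega> \<in> B)" if A: "A \<in> sets ?G" for A
  proof -
    obtain A' where A': "A' \<in> sets borel" "AE \<omega> in M. \<omega> \<in> A \<longleftrightarrow> full_info Z x \<omega> \<in> A'"
      using sigma_gen_null_AE[OF full_info_measurable A] by blast
    have "\<Psi> -` A' \<in> sets (borel \<Otimes>\<^sub>M borel)" using measurable_sets[OF \<Psi>m A'(1)] by (simp add: space_pair_measure)
    then have "?U -` (\<Psi> -` A') \<inter> space M \<in> sets ?K" by (rule in_vimage_algebra)
    moreover have "AE \<omega> in M. \<omega> \<in> C \<longrightarrow> (\<omega> \<in> A \<longleftrightarrow> \<omega> \<in> ?U -` (\<Psi> -` A') \<inter> space M)"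
      using A'(2) AE_space
    proof eventually_elim
      case (elim \<omega>)
      show ?case using elim \<Psi>C[of \<omega>] by auto
    qed
    ultimately show ?thesis by blast
  qed
  have CX: "(\<lambda>\<omega>. indicator C \<omega> * Y_at_entry x m \<omega>) = (\<lambda>\<omega>. indicator (entry_before x m) \<omega> * ?X \<omega>)" for m
    by (auto simp: fun_eq_iff C_def indicator_def)
  have Ym: "integrable M (Y_at_entry x (real m))" for m :: nat by (rule occ_Y_at_entry(1)[OF g])
  have Xm: "?X \<in> borel_measurable M"
  proof (rule borel_measurable_LIMSEQ_real)
    show "(\<lambda>\<omega>. indicator (entry_before x (real m)) \<omega> * ?X \<omega>) \<in> borel_measurable M" for m :: nat
      unfolding CX[symmetric]
      by (rule borel_measurable_times[OF borel_measurable_indicator[OF CM] borel_measurable_integrable[OF Ym]])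
    fix \<omega> assume \<omega>: "\<omega> \<in> space M"
    show "(\<lambda>m. indicator (entry_before x (real m)) \<omega> * ?X \<omega>) \<longlonglongrightarrow> ?X \<omega>"
    proof (cases "entry_time Z x \<omega> = \<infinity>")
      case False
      then obtain e where e: "entry_time Z x \<omega> = ereal e"
        using entry_nonneg[OF \<omega>, of x] by (cases "entry_time Z x \<omega>") auto
      obtain N :: nat where N: "e < real N" using reals_Archimedean2 by blast
      have "eventually (\<lambda>m. indicator (entry_before x (real m)) \<omega> * ?X \<omega> = ?X \<omega>) sequentially"
        using eventually_ge_at_top[of N] by eventually_elim (use \<omega> e N in auto)
      then show ?thesis by (rule tendsto_eventually)
    qed simp
  qed
  have Icong: "AE \<omega> in M. real_cond_exp M ?K ?I \<omega> = real_cond_exp M ?K (indicator C) \<omega>"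
  proof (rule K.real_cond_exp_cong)
    have eq: "?I \<omega> = indicator C \<omega>" if "\<omega> \<in> space M" for \<omega> using that by (simp add: C_def)
    then show "AE \<omega> in M. ?I \<omega> = indicator C \<omega>" by (intro AE_I2)
    show "indicator C \<in> borel_measurable M" using CM by (rule borel_measurable_indicator)
    then show "?I \<in> borel_measurable M" by (subst measurable_cong[OF eq])
  qed
  have "AE \<omega> in M. \<omega> \<in> C \<longrightarrow> \<omega> \<in> entry_before x (real m) \<longrightarrow>
      vj (entry_real x \<omega>) \<omega> = v (entry_real x \<omega>) \<omega>" for m :: nat
  proof -
    let ?D = "entry_before x (real m)"
    have DK: "?D \<in> sets ?K"
    proof -
      have "(\<lambda>\<omega>. snd (?U \<omega>)) \<in> borel_measurable ?K"
        by (rule measurable_compose[OF measurable_vimage_algebra1 measurable_snd])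
          (simp add: space_pair_measure)
      then have [measurable]: "entry_time Z x \<in> borel_measurable ?K" by simp
      have "{\<omega> \<in> space ?K. entry_time Z x \<omega> < ereal (real m)} \<in> sets ?K" by measurable
      then show ?thesis unfolding space_vimage_algebra .
    qed
    have "AE \<omega> in M. real_cond_exp M ?K (\<lambda>\<omega>. indicator ?D \<omega> * ?X \<omega>) \<omega> = indicator ?D \<omega> * real_cond_exp M ?K ?X \<omega>"
      by (rule K.real_cond_exp_indicator[OF DK Xm])
    moreover have "AE \<omega> in M. \<omega> \<in> C \<longrightarrow> 0 < real_cond_exp M ?K (indicator C) \<omega> \<and>
        real_cond_exp M ?G (Y_at_entry x m) \<omega> =
        real_cond_exp M ?K (\<lambda>\<omega>. indicator ?D \<omega> * ?X \<omega>) \<omega> / real_cond_exp M ?K (indicator C) \<omega>"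
      using real_cond_exp_local[OF G K CG BC AB Ym] unfolding CX .
    moreover have "AE \<omega> in M. real_cond_exp M ?G (Y_at_entry x m) \<omega> = real_cond_exp M ?H (Y_at_entry x m) \<omega>"
    proof (rule real_cond_exp_mod_null[OF G HG _ Ym])
      fix A assume A: "A \<in> sets ?G"
      obtain A' where A': "A' \<in> sets borel" "AE \<omega> in M. \<omega> \<in> A \<longleftrightarrow> full_info Z x \<omega> \<in> A'"
        using sigma_gen_null_AE[OF full_info_measurable A] by blast
      have "full_info Z x -` A' \<inter> space M \<in> sets ?H" using A'(1) by (rule in_vimage_algebra)
      moreover have "AE \<omega> in M. \<omega> \<in> A \<longleftrightarrow> \<omega> \<in> full_info Z x -` A' \<inter> space M"
        using A'(2) AE_space by eventually_elim simp
      ultimately show "\<exists>B\<in>sets ?H. AE \<omega> in M. \<omega> \<in> A \<longleftrightarrow> \<omega> \<in> B" by blast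
    qed
    moreover have "AE \<omega> in M. \<omega> \<in> ?D \<longrightarrow>
        g (entry_real x \<omega>) (full_info Z x \<omega>) = real_cond_exp M ?H (Y_at_entry x m) \<omega>"
      by (rule occ_Y_at_entry(2)[OF g])
    moreover have "AE \<omega> in M. \<omega> \<in> ?D \<longrightarrow> h (entry_real x \<omega>) (full_info Z x \<omega>) = 1"
      by (rule occ_at_entry[OF h])
    moreover have "AE \<omega> in M. g' (?U \<omega>) = real_cond_exp M ?K ?X \<omega>" "AE \<omega> in M. h' (?U \<omega>) = real_cond_exp M ?K ?I \<omega>"
      using g' h' by (simp_all only: factorized_cond_exp_def)
    ultimately show ?thesis
      using Icong AE_space
    proof eventually_elim
      case (elim \<omega>)
      show ?case
      proof (intro impI)
        assume C: "\<omega> \<in> C" and D: "\<omega> \<in> ?D"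
        interpret jump_path Z \<omega> by (rule path[OF elim(9)])
        note T = entry_before_real[OF D]
        have y: "ZJ_left Z (entry_real x \<omega>) \<omega> = y" using C by (simp add: C_def)
        have "entry_time Z y \<omega> < ereal (entry_real x \<omega>)"
          by (rule entry_time_le_iff_of_jump(2)[OF T(1) y yx yx])
        then have pos: "0 < entry_real x \<omega>"
          using entry_time_nonneg[of y] by (metis ereal_less(2) le_less_trans)
        have U: "?U \<omega> = (full_info Z y \<omega>, ereal (entry_real x \<omega>))" using T(1) by simp
        have "vj (entry_real x \<omega>) \<omega> = g' (?U \<omega>) / h' (?U \<omega>)"
          unfolding U by (rule gh'[OF pos elim(9)])
        also have "\<dots> = real_cond_exp M ?H (Y_at_entry x m) \<omega>"
          using elim(1-3,6-8) C D by simp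
        also have "\<dots> = v (entry_real x \<omega>) \<omega>"
          using gh[OF T(2) elim(9)] elim(4,5) D by simp
        finally show "vj (entry_real x \<omega>) \<omega> = v (entry_real x \<omega>) \<omega>" .
      qed
    qed
  qed
  then have "AE \<omega> in M. \<forall>m::nat. \<omega> \<in> C \<longrightarrow> \<omega> \<in> entry_before x (real m) \<longrightarrow>
      vj (entry_real x \<omega>) \<omega> = v (entry_real x \<omega>) \<omega>"
    unfolding AE_all_countable by blast
  then show ?thesis
    using AE_space
  proof eventually_elim
    case (elim \<omega>)
    show ?case
    proof (intro impI)
      assume *: "entry_time Z x \<omega> \<noteq> \<infinity>" "ZJ_left Z (entry_real x \<omega>) \<omega> = y"
      then obtain e where e: "entry_time Z x \<omega> = ereal e"
        using entry_nonneg[OF elim(2), of x] by (cases "entry_time Z x \<omega>") auto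
      obtain m :: nat where "e < real m" using reals_Archimedean2 by blast
      then have "\<omega> \<in> entry_before x (real m)" using e elim(2) by simp
      moreover have "\<omega> \<in> C" using * elim(2) by (simp add: C_def)
      ultimately show "vj (entry_real x \<omega>) \<omega> = v (entry_real x \<omega>) \<omega>" using elim(1) by blast
    qed
  qed
qed

section \<open>Adaptedness of the contributions of the sojourns\<close>

lemma entry_before_adapted: "entry_before x t \<in> sets (natural_filtration M Z t)"
proof -
  let ?F = "natural_filtration M Z t"
  note [measurable] = observes_stopped_entry[OF observes_natural_filtration, of t x]
  have "{\<omega> \<in> space ?F. stopped_entry t x \<omega> < ereal t} \<in> sets ?F" by measurable
  moreover have "{\<omega> \<in> space ?F. stopped_entry t x \<omega> < ereal t} = entry_before x t"
    unfolding space_natural_filtration by (auto simp: stopped_entry_def not_le dest: less_imp_le)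
  ultimately show ?thesis by simp
qed

text \<open>On \<open>{T\<^sub>x < t}\<close> the information \<open>\<xi>\<^sub>x\<close> is known at time \<open>t\<close>, and so is every right-continuous version
  that is evaluated at a time known at \<open>t\<close>.\<close>

lemma adapted_at_random_time:
  fixes g :: "real \<Rightarrow> ('s \<times> nat \<Rightarrow> ereal) \<Rightarrow> real"
  assumes g: "\<And>q. 0 \<le> q \<Longrightarrow> g q \<in> borel_measurable borel" "AE \<omega> in M. cadlag (\<lambda>t. g t (full_info Z x \<omega>))"
    and R: "(\<lambda>\<omega>. indicator (entry_before x t) \<omega> * R \<omega>) \<in> borel_measurable (natural_filtration M Z t)"
    and R0: "\<And>\<omega>. \<omega> \<in> entry_before x t \<Longrightarrow> 0 \<le> R \<omega>"
  shows "(\<lambda>\<omega>. indicator (entry_before x t) \<omega> * g (R \<omega>) (full_info Z x \<omega>)) \<in> borel_measurable (natural_filtration M Z t)"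
proof -
  let ?F = "natural_filtration M Z t" and ?D = "entry_before x t"
  have DF: "?D \<in> sets ?F" by (rule entry_before_adapted)
  have "(\<lambda>\<omega>. indicator ?D \<omega> * g (indicator ?D \<omega> * R \<omega>) (full_info Z x \<omega>)) \<in> borel_measurable ?F"
  proof (rule measurable_at_random_time[OF complete subalgebra_natural_filtration null_sets_natural_filtration R])
    fix q :: real assume q: "0 \<le> q"
    have "(\<lambda>\<omega>. indicator ?D \<omega> * g q (stopped_info t x \<omega>)) \<in> borel_measurable ?F"
      using DF measurable_compose[OF observes_stopped_info[OF observes_natural_filtration] g(1)[OF q]]
      by (intro borel_measurable_times borel_measurable_indicator) auto
    moreover have "indicator ?D \<omega> * g q (stopped_info t x \<omega>) = indicator ?D \<omega> * g q (full_info Z x \<omega>)" for \<omega>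
      using stopped_info_eq[of x \<omega> t] by (cases "\<omega> \<in> ?D") auto
    ultimately show "(\<lambda>\<omega>. indicator ?D \<omega> * g q (full_info Z x \<omega>)) \<in> borel_measurable ?F" by simp
  next
    show "0 \<le> indicator ?D \<omega> * R \<omega>" if "\<omega> \<in> ?D" for \<omega> using R0[OF that] that by simp
    show "AE \<omega> in M. \<omega> \<in> ?D \<longrightarrow> (\<forall>s\<ge>0. continuous (at_right s) (\<lambda>s. g s (full_info Z x \<omega>)))"
      using g(2) by eventually_elim (simp add: cadlag_def)
  qed
  moreover have "indicator ?D \<omega> * g (indicator ?D \<omega> * R \<omega>) (full_info Z x \<omega>) =
      indicator ?D \<omega> * g (R \<omega>) (full_info Z x \<omega>)" for \<omega>
    by (cases "\<omega> \<in> ?D") auto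
  ultimately show ?thesis by simp
qed

lemma entry_real_adapted:
  "(\<lambda>\<omega>. indicator (entry_before x t) \<omega> * entry_real x \<omega>) \<in> borel_measurable (natural_filtration M Z t)"
proof -
  let ?F = "natural_filtration M Z t"
  note [measurable] = observes_stopped_entry[OF observes_natural_filtration, of t x]
  have "(\<lambda>\<omega>. if stopped_entry t x \<omega> < ereal t then real_of_ereal (stopped_entry t x \<omega>) else 0) \<in> borel_measurable ?F"
    by measurable
  moreover have "(if stopped_entry t x \<omega> < ereal t then real_of_ereal (stopped_entry t x \<omega>) else 0) =
      indicator (entry_before x t) \<omega> * entry_real x \<omega>" if "\<omega> \<in> space ?F" for \<omega>
    using that by (auto simp: stopped_entry_def space_natural_filtration indicator_def dest: less_imp_le)
  ultimately show ?thesis by (simp cong: measurable_cong)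
qed

abbreviation "exit_real x t \<omega> \<equiv> real_of_ereal (min (exit_time Z x \<omega>) (ereal t))"

lemma exit_real_adapted:
  assumes "0 \<le> t"
  shows "(\<lambda>\<omega>. indicator (entry_before x t) \<omega> * exit_real x t \<omega>) \<in> borel_measurable (natural_filtration M Z t)"
  unfolding borel_measurable_iff_le
proof
  let ?F = "natural_filtration M Z t" and ?D = "entry_before x t"
  have DF: "?D \<in> sets ?F" by (rule entry_before_adapted)
  have exit_iff: "exit_real x t \<omega> \<le> a \<longleftrightarrow> t \<le> a \<or> (0 \<le> a \<and> entry_time Z x \<omega> \<le> ereal a \<and> ZJ Z a \<omega> \<noteq> x)"
    if \<omega>: "\<omega> \<in> ?D" for \<omega> a
  proof -
    interpret jump_path Z \<omega> using \<omega> by (intro path) simp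
    have D: "entry_time Z x \<omega> < ereal t" using \<omega> by simp
    note T = entry_before_real[OF \<omega>]
    have lt0: "entry_time Z x \<omega> < exit_time Z x \<omega>" using D by (intro entry_less_exit) auto
    then have lt: "ereal (entry_real x \<omega>) < min (exit_time Z x \<omega>) (ereal t)" using D T(1) by simp
    moreover have "min (exit_time Z x \<omega>) (ereal t) \<le> ereal t" by simp
    ultimately obtain r where "min (exit_time Z x \<omega>) (ereal t) = ereal r"
      by (cases "min (exit_time Z x \<omega>) (ereal t)") auto
    then have "exit_real x t \<omega> \<le> a \<longleftrightarrow> min (exit_time Z x \<omega>) (ereal t) \<le> ereal a"
      by (simp only: real_of_ereal.simps ereal_less_eq)
    also have "\<dots> \<longleftrightarrow> exit_time Z x \<omega> \<le> ereal a \<or> t \<le> a" by (simp add: min_le_iff_disj)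
    also have "\<dots> \<longleftrightarrow> t \<le> a \<or> (0 \<le> a \<and> entry_time Z x \<omega> \<le> ereal a \<and> ZJ Z a \<omega> \<noteq> x)"
    proof (cases "0 \<le> a")
      case True
      have "entry_time Z x \<omega> \<le> ereal a" if "exit_time Z x \<omega> \<le> ereal a"
        by (rule order_trans[OF less_imp_le[OF lt0] that])
      then show ?thesis
        using True ZJ_iff_times[OF True, of x] not_less[of "ereal a" "exit_time Z x \<omega>"] by blast
    next
      case False
      have "\<not> exit_time Z x \<omega> \<le> ereal a"
      proof
        assume "exit_time Z x \<omega> \<le> ereal a"
        then have "entry_time Z x \<omega> < ereal a" by (rule less_le_trans[OF lt0])
        then have "0 < ereal a" by (rule le_less_trans[OF entry_time_nonneg])
        then show False using False by simp
      qed
      then show ?thesis using False by auto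
    qed
    finally show ?thesis .
  qed
  fix a :: real
  show "{\<omega> \<in> space ?F. indicator ?D \<omega> * exit_real x t \<omega> \<le> a} \<in> sets ?F"
  proof -
    consider "t \<le> a" | "0 \<le> a" "a < t" | "a < 0" by linarith
    then show ?thesis
    proof cases
      case 1
      have "indicator ?D \<omega> * exit_real x t \<omega> \<le> a" for \<omega>
        using exit_iff[of \<omega> a] 1 assms by (cases "\<omega> \<in> ?D") auto
      then have "{\<omega> \<in> space ?F. indicator ?D \<omega> * exit_real x t \<omega> \<le> a} = space ?F" by blast
      then show ?thesis by (simp only: sets.top)
    next
      case 2
      have "{\<omega> \<in> space ?F. indicator ?D \<omega> * exit_real x t \<omega> \<le> a} = (space ?F - ?D) \<union>
          ?D \<inter> ({\<omega> \<in> space M. entry_time Z x \<omega> \<le> ereal a} - {\<omega> \<in> space M. ZJ Z a \<omega> = x})"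
        unfolding space_natural_filtration
      proof (rule set_eqI)
        fix \<omega>
        show "\<omega> \<in> {\<omega> \<in> space M. indicator ?D \<omega> * exit_real x t \<omega> \<le> a} \<longleftrightarrow> \<omega> \<in> (space M - ?D) \<union>
          ?D \<inter> ({\<omega> \<in> space M. entry_time Z x \<omega> \<le> ereal a} - {\<omega> \<in> space M. ZJ Z a \<omega> = x})"
          using exit_iff[of \<omega> a] 2 by (cases "\<omega> \<in> ?D") auto
      qed
      also have "\<dots> \<in> sets ?F"
        using DF 2 observes_mono[OF observes_natural_filtration, of a t]
        by (intro sets.Un sets.Int sets.Diff sets.top observes_entry_le[of _ t] observes_ZJ
            observes_natural_filtration) auto
      finally show ?thesis .
    next
      case 3
      have "{\<omega> \<in> space ?F. indicator ?D \<omega> * exit_real x t \<omega> \<le> a} = space ?F \<inter> {}"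
        using exit_iff[of _ a] 3 assms
        by (auto simp: indicator_def of_bool_def space_natural_filtration split: if_splits)
      then show ?thesis by (simp only: Int_empty_right sets.empty_sets)
    qed
  qed
qed

lemma state_reserve_adapted:
  assumes v: "is_state_reserve M Z (full_info Z) Y x v"
    and R: "(\<lambda>\<omega>. indicator (entry_before x t) \<omega> * R \<omega>) \<in> borel_measurable (natural_filtration M Z t)"
    and R0: "\<And>\<omega>. \<omega> \<in> entry_before x t \<Longrightarrow> 0 \<le> R \<omega>"
  shows "(\<lambda>\<omega>. indicator (entry_before x t) \<omega> * v (R \<omega>) \<omega>) \<in> borel_measurable (natural_filtration M Z t)"
proof -
  let ?F = "natural_filtration M Z t" and ?D = "entry_before x t"
  obtain g h where g: "cond_exp_process_cadlag M (\<lambda>t \<omega>. occ x t \<omega> * Y t \<omega>) (full_info Z x) borel g"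
    and h: "cond_exp_process_cadlag M (\<lambda>t \<omega>. occ x t \<omega>) (full_info Z x) borel h"
    and gh: "\<And>t \<omega>. 0 \<le> t \<Longrightarrow> \<omega> \<in> space M \<Longrightarrow> v t \<omega> = g t (full_info Z x \<omega>) / h t (full_info Z x \<omega>)"
    using v unfolding is_state_reserve_def by blast
  have "(\<lambda>\<omega>. indicator ?D \<omega> * g (R \<omega>) (full_info Z x \<omega>)) \<in> borel_measurable ?F"
    "(\<lambda>\<omega>. indicator ?D \<omega> * h (R \<omega>) (full_info Z x \<omega>)) \<in> borel_measurable ?F"
    by (rule adapted_at_random_time[OF _ _ R R0];
        use g h in \<open>simp add: cond_exp_process_cadlag_def factorized_cond_exp_def\<close>)+
  then have "(\<lambda>\<omega>. (indicator ?D \<omega> * g (R \<omega>) (full_info Z x \<omega>)) / (indicator ?D \<omega> * h (R \<omega>) (full_info Z x \<omega>)))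
      \<in> borel_measurable ?F" by (rule borel_measurable_divide)
  moreover have "(indicator ?D \<omega> * g (R \<omega>) (full_info Z x \<omega>)) / (indicator ?D \<omega> * h (R \<omega>) (full_info Z x \<omega>)) =
      indicator ?D \<omega> * v (R \<omega>) \<omega>" if "\<omega> \<in> space ?F" for \<omega>
    using R0[of \<omega>] gh[of "R \<omega>" \<omega>] by (cases "\<omega> \<in> ?D") auto
  ultimately show ?thesis by (simp cong: measurable_cong)
qed

lemma state_reserve_contribution_cadlag_fv:
  assumes v: "is_state_reserve M Z (full_info Z) Y x v"
  shows "AE \<omega> in M. cadlag_fv (\<lambda>t. of_bool (entry_time Z x \<omega> < ereal t) *
    (v (exit_real x t \<omega>) \<omega> - v (entry_real x \<omega>) \<omega>))"
proof -
  obtain g h where g: "cond_exp_process_cadlag M (\<lambda>t \<omega>. occ x t \<omega> * Y t \<omega>) (full_info Z x) borel g"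
    and h: "cond_exp_process_cadlag M (\<lambda>t \<omega>. occ x t \<omega>) (full_info Z x) borel h"
    and gh: "\<And>t \<omega>. 0 \<le> t \<Longrightarrow> \<omega> \<in> space M \<Longrightarrow> v t \<omega> = g t (full_info Z x \<omega>) / h t (full_info Z x \<omega>)"
    using v unfolding is_state_reserve_def by blast
  show ?thesis
    using survival_bounded_below[OF h] occ_Y_version_cadlag_fv[OF g] occ_version_cadlag_fv[OF h] AE_space
  proof eventually_elim
    case (elim \<omega>)
    interpret jump_path Z \<omega> by (rule path[OF elim(4)])
    obtain \<epsilon> where \<epsilon>: "0 < \<epsilon>" "\<And>t. 0 \<le> t \<Longrightarrow> ZJ Z t \<omega> = x \<Longrightarrow> \<epsilon> \<le> h t (full_info Z x \<omega>)"
      using elim(1) by blast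
    show ?case
      by (rule cadlag_fv_sojourn_contribution[OF elim(2,3) \<epsilon>, where f = "\<lambda>t. v t \<omega>"])
        (use gh elim(4) in auto)
  qed
qed

end

section \<open>The state-wise prospective reserves\<close>

context jump_path
begin

lemma V_state_occupied:
  assumes "t = 0 \<or> Z_left Z t \<omega> = j"
  shows "V_state Z v vj j t \<omega> = v (j, exits Z j t \<omega>) t \<omega>"
proof -
  have "(\<Sum>\<^sub>\<infinity>n. of_bool (exits Z j t \<omega> = n) * v (j, n) t \<omega>) =
      (\<Sum>\<^sub>\<infinity>n\<in>{exits Z j t \<omega>}. of_bool (exits Z j t \<omega> = n) * v (j, n) t \<omega>)"
    by (rule infsum_cong_neutral) auto
  then show ?thesis using assms by (simp add: V_state_def)
qed

lemma V_jump_eq: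
  assumes "0 < t"
  shows "V_jump Z vj k j t \<omega> = vj (k, exits Z k t \<omega>) (j, exits Z j t \<omega>) t \<omega>"
proof -
  have "V_jump Z vj k j t \<omega> = (\<Sum>\<^sub>\<infinity>(l, n)\<in>{(exits Z k t \<omega>, exits Z j t \<omega>)}.
      of_bool (exits Z k t \<omega> = l) * of_bool (exits Z j t \<omega> = n) * vj (k, l) (j, n) t \<omega>)"
    unfolding V_jump_def left_lim_exits[OF assms] by (rule infsum_cong_neutral) auto
  then show ?thesis by simp
qed

lemma V_stay_eq:
  assumes "0 < t"
  shows "V_stay Z vs j t \<omega> = vs (j, exits Z j t \<omega>) t \<omega>"
proof -
  have "V_stay Z vs j t \<omega> =
      (\<Sum>\<^sub>\<infinity>l\<in>{exits Z j t \<omega>}. of_bool (exits Z j t \<omega> = l) * vs (j, l) t \<omega>)"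
    unfolding V_stay_def left_lim_exits[OF assms] by (rule infsum_cong_neutral) auto
  then show ?thesis by simp
qed

lemma ZJ_left_neq_at_entry:
  assumes "0 < T" "entry_time Z x \<omega> = ereal T"
  shows "ZJ_left Z T \<omega> \<noteq> x"
  using ZJ_left_iff_times[OF assms(1), of x] assms(2) by simp

lemma V_state_jump:
  assumes "0 < t" "Z_left Z t \<omega> \<noteq> j"
  shows "V_state Z v vj j t \<omega> = vj (ZJ_left Z t \<omega>) (j, exits Z j t \<omega>) t \<omega>"
  using assms by (simp add: V_state_def V_jump_eq ZJ_left_eq)

lemma entry_at_jump:
  assumes t: "0 < t" and "Z_left Z t \<omega> \<noteq> Z t \<omega>"
  shows "entry_time Z (ZJ Z t \<omega>) \<omega> = ereal t" "ZJ_left Z t \<omega> \<noteq> ZJ Z t \<omega>"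
proof -
  show ne: "ZJ_left Z t \<omega> \<noteq> ZJ Z t \<omega>" using assms by (simp add: ZJ_left_eq ZJ_eq)
  have "entry_time Z (ZJ Z t \<omega>) \<omega> \<le> ereal t" "ereal t < exit_time Z (ZJ Z t \<omega>) \<omega>"
    using ZJ_iff_times[of t "ZJ Z t \<omega>"] t by auto
  then show "entry_time Z (ZJ Z t \<omega>) \<omega> = ereal t"
    using ZJ_left_iff_times[OF t, of "ZJ Z t \<omega>"] ne by (auto simp: less_le)
qed

lemma V_state_decomposition:
  assumes t: "0 < t" and eq: "Z_left Z t \<omega> = j \<Longrightarrow> v (ZJ_left Z t \<omega>) t \<omega> = vs (ZJ_left Z t \<omega>) t \<omega>"
  shows "V_state Z v vj j t \<omega> = of_bool (Z_left Z t \<omega> = j) * V_stay Z vs j t \<omega> +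
    (\<Sum>\<^sub>\<infinity>k\<in>-{j}. of_bool (Z_left Z t \<omega> = k) * V_jump Z vj k j t \<omega>)"
proof (cases "Z_left Z t \<omega> = j")
  case True
  have "(\<Sum>\<^sub>\<infinity>k\<in>-{j}. of_bool (Z_left Z t \<omega> = k) * V_jump Z vj k j t \<omega>) = 0"
    using True by (intro infsum_0) auto
  moreover have "V_state Z v vj j t \<omega> = v (j, exits Z j t \<omega>) t \<omega>" using True by (intro V_state_occupied) simp
  ultimately show ?thesis using eq[OF True] True t by (simp add: V_stay_eq ZJ_left_eq)
next
  case False
  have "(\<Sum>\<^sub>\<infinity>k\<in>-{j}. of_bool (Z_left Z t \<omega> = k) * V_jump Z vj k j t \<omega>) =
      (\<Sum>\<^sub>\<infinity>k\<in>{Z_left Z t \<omega>}. of_bool (Z_left Z t \<omega> = k) * V_jump Z vj k j t \<omega>)"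
    using False by (intro infsum_cong_neutral) auto
  then show ?thesis using False t by (simp add: V_state_def)
qed

text \<open>At the left endpoint of a sojourn interval, the state-wise reserve has the value of \<open>v\<close>: at time zero by
  definition, at later times because of the hypothesis on the entry times.\<close>

lemma sojourn_integral_V_state:
  assumes entry: "\<And>x y. y \<noteq> x \<Longrightarrow> entry_time Z x \<omega> \<noteq> \<infinity> \<Longrightarrow>
    ZJ_left Z (real_of_ereal (entry_time Z x \<omega>)) \<omega> = y \<Longrightarrow>
    vj y x (real_of_ereal (entry_time Z x \<omega>)) \<omega> = v x (real_of_ereal (entry_time Z x \<omega>)) \<omega>"
  shows "sojourn_integral Z j (V_state Z v vj j) t \<omega> = (\<Sum>n\<in>{n. entry_time Z (j, n) \<omega> < ereal t}.
    v (j, n) (real_of_ereal (min (exit_time Z (j, n) \<omega>) (ereal t))) \<omega> -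
    v (j, n) (real_of_ereal (entry_time Z (j, n) \<omega>)) \<omega>)"
  unfolding sojourn_integral_eq
proof (rule sum.cong[OF refl])
  fix n assume "n \<in> {n. entry_time Z (j, n) \<omega> < ereal t}"
  then have n: "entry_time Z (j, n) \<omega> < ereal t" by simp
  obtain T where T: "entry_time Z (j, n) \<omega> = ereal T"
    using n entry_time_nonneg[of "(j, n)"] by (cases "entry_time Z (j, n) \<omega>") auto
  define m where "m = real_of_ereal (min (exit_time Z (j, n) \<omega>) (ereal t))"
  have "m \<in> {s \<in> {0<..t}. ZJ_left Z s \<omega> = (j, n)}"
    unfolding ZJ_left_sojourn_eq(1)[OF n] using ZJ_left_sojourn_eq(2)[OF n] by (simp add: m_def)
  then have m: "Z_left Z m \<omega> = j" "exits Z j m \<omega> = n" by (auto simp: ZJ_left_eq)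
  have 1: "V_state Z v vj j m \<omega> = v (j, n) m \<omega>" using V_state_occupied[of m j v vj] m by simp
  have 2: "V_state Z v vj j T \<omega> = v (j, n) T \<omega>"
  proof (cases "T = 0")
    case True
    then show ?thesis using V_state_occupied[of T j v vj] exits_at_entry[OF T] by simp
  next
    case False
    then have pos: "0 < T" using entry_time_leD(1)[OF T] by simp
    have ne: "ZJ_left Z T \<omega> \<noteq> (j, n)" by (rule ZJ_left_neq_at_entry[OF pos T])
    then have "Z_left Z T \<omega> \<noteq> j" using exits_at_entry[OF T] pos by (auto simp: ZJ_left_eq)
    then have "V_state Z v vj j T \<omega> = vj (ZJ_left Z T \<omega>) (j, n) T \<omega>"
      using V_state_jump[OF pos] exits_at_entry[OF T] by simp
    also have "\<dots> = v (j, n) T \<omega>" using entry[OF ne] T by simp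
    finally show ?thesis .
  qed
  show "V_state Z v vj j (real_of_ereal (min (exit_time Z (j, n) \<omega>) (ereal t))) \<omega> -
      V_state Z v vj j (real_of_ereal (entry_time Z (j, n) \<omega>)) \<omega> =
    v (j, n) (real_of_ereal (min (exit_time Z (j, n) \<omega>) (ereal t))) \<omega> -
      v (j, n) (real_of_ereal (entry_time Z (j, n) \<omega>)) \<omega>"
    using 1 2 unfolding m_def T by simp
qed

end

context jump_payments
begin

text \<open>If \<open>t\<close> is a jump time with new state \<open>x\<close>, then \<open>t\<close> is the entry time of \<open>x\<close>, and the jump quotient has the
  value of the quotient for \<open>x\<close>. So in all cases the claim is the one for a fixed occupied state.\<close>

lemma V_state_eq_reserve:
  assumes FG: "\<And>t. 0 \<le> t \<Longrightarrow> sets (natural_filtration M Z t) = sets (info_family M Z (full_info Z) t)"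
    and V: "prospective_reserve M (info_family M Z (full_info Z)) Y V"
    and v: "\<And>x. is_state_reserve M Z (full_info Z) Y x (v x)"
    and entry: "AE \<omega> in M. \<forall>x y. y \<noteq> x \<longrightarrow> entry_time Z x \<omega> \<noteq> \<infinity> \<longrightarrow>
      ZJ_left Z (entry_real x \<omega>) \<omega> = y \<longrightarrow> vj y x (entry_real x \<omega>) \<omega> = v x (entry_real x \<omega>) \<omega>"
    and t: "0 \<le> t"
  shows "AE \<omega> in M. of_bool (Z t \<omega> = j) * V_state Z v vj j t \<omega> = of_bool (Z t \<omega> = j) * V t \<omega>"
proof -
  have "AE \<omega> in M. \<forall>x. ZJ Z t \<omega> = x \<longrightarrow>
      v x t \<omega> = real_cond_exp M (info_family M Z (full_info Z) t) (Y t) \<omega>"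
    unfolding AE_all_countable by (intro allI state_reserve_eq_cond_exp v t)
  moreover have "AE \<omega> in M. V t \<omega> = real_cond_exp M (info_family M Z (full_info Z) t) (Y t) \<omega>"
    using V t by (simp add: prospective_reserve_def)
  ultimately show ?thesis
    using entry AE_space
  proof eventually_elim
    case (elim \<omega>)
    interpret jump_path Z \<omega> by (rule path[OF elim(4)])
    have "V_state Z v vj j t \<omega> = V t \<omega>" if j: "Z t \<omega> = j"
    proof -
      have ZJ: "ZJ Z t \<omega> = (j, exits Z j t \<omega>)" using j by (simp add: ZJ_eq)
      then have vV: "v (j, exits Z j t \<omega>) t \<omega> = V t \<omega>" using elim(1,2) by simp
      show ?thesis
      proof (cases "t = 0 \<or> Z_left Z t \<omega> = j")
        case True
        then show ?thesis using V_state_occupied[of t j v vj] vV by simp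
      next
        case False
        then have pos: "0 < t" "Z_left Z t \<omega> \<noteq> Z t \<omega>" using t j by auto
        note e = entry_at_jump[OF pos, unfolded ZJ]
        have "V_state Z v vj j t \<omega> = vj (ZJ_left Z t \<omega>) (j, exits Z j t \<omega>) t \<omega>"
          using False pos by (intro V_state_jump) auto
        also have "\<dots> = v (j, exits Z j t \<omega>) t \<omega>"
          using elim(3)[rule_format, OF e(2)] e(1) by simp
        finally show ?thesis using vV by simp
      qed
    qed
    then show ?case by simp
  qed
qed

text \<open>On \<open>{Z\<^sub>t\<^sub>- = j}\<close> the reserve is a function of the pair that generates \<open>\<G>\<^sub>t\<^sub>-\<close>; joint measurability is
  automatic because the state space is countable.\<close>

lemma V_state_left_measurable:
  assumes v: "\<And>x. is_state_reserve M Z (full_info Z) Y x (v x)" and t: "0 < t"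
  shows "(\<lambda>\<omega>. of_bool (Z_left Z t \<omega> = j) * V_state Z v vj j t \<omega>)
    \<in> borel_measurable (info_family_left M Z (full_info Z) t)"
proof -
  let ?G = "info_family_left M Z (full_info Z) t" and ?U = "\<lambda>\<omega>. (ZJ_left Z t \<omega>, full_info Z (ZJ_left Z t \<omega>) \<omega>)"
  let ?N = "count_space UNIV \<Otimes>\<^sub>M borel :: (('s \<times> nat) \<times> ('s \<times> nat \<Rightarrow> ereal)) measure"
  have "\<exists>g h. g \<in> borel_measurable borel \<and> h \<in> borel_measurable borel \<and>
      (\<forall>\<omega>\<in>space M. v x t \<omega> = g (full_info Z x \<omega>) / h (full_info Z x \<omega>))" for x
    using v[of x] t unfolding is_state_reserve_def cond_exp_process_cadlag_def factorized_cond_exp_def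
    by (meson less_imp_le)
  then obtain g h where gh: "\<And>x. g x \<in> borel_measurable borel" "\<And>x. h x \<in> borel_measurable borel"
    "\<And>x \<omega>. \<omega> \<in> space M \<Longrightarrow> v x t \<omega> = g x (full_info Z x \<omega>) / h x (full_info Z x \<omega>)"
    by metis
  define f where "f = (\<lambda>(x, u). of_bool (fst x = j) * (g x u / h x u) :: real)"
  have f: "f \<in> borel_measurable ?N"
    unfolding f_def
    by (rule measurable_pair_measure_countable1) (use gh in \<open>auto intro!: borel_measurable_times borel_measurable_divide\<close>)
  have sp: "space ?G = space M"
    by (simp add: info_family_left_def space_sigma_gen_null)
  have sub: "subalgebra ?G (vimage_algebra (space M) ?U ?N)"
    unfolding info_family_left_def by (rule vimage_subalgebra_sigma_gen_null)
  have "?U \<in> vimage_algebra (space M) ?U ?N \<rightarrow>\<^sub>M ?N"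
    by (rule measurable_vimage_algebra1) (simp add: space_pair_measure)
  from measurable_from_subalg[OF sub this] have "(\<lambda>\<omega>. f (?U \<omega>)) \<in> borel_measurable ?G"
    using f by (rule measurable_compose)
  moreover have "f (?U \<omega>) = of_bool (Z_left Z t \<omega> = j) * V_state Z v vj j t \<omega>" if "\<omega> \<in> space ?G" for \<omega>
  proof -
    have \<omega>: "\<omega> \<in> space M" using that sp by simp
    interpret jump_path Z \<omega> by (rule path[OF \<omega>])
    show ?thesis
    proof (cases "Z_left Z t \<omega> = j")
      case True
      then show ?thesis
        using V_state_occupied[of t j v vj] gh(3)[OF \<omega>] t by (simp add: f_def ZJ_left_eq)
    qed (use t in \<open>simp add: f_def ZJ_left_eq\<close>)
  qed
  ultimately show ?thesis by (simp cong: measurable_cong)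
qed

text \<open>Only entries before \<open>t\<close> contribute up to time \<open>t\<close>. This makes the sum of the contributions adapted, and
  finite on compacts.\<close>

lemma sojourn_integral_finite_variation_process:
  assumes v: "\<And>x. is_state_reserve M Z (full_info Z) Y x (v x)"
    and entry: "AE \<omega> in M. \<forall>x y. y \<noteq> x \<longrightarrow> entry_time Z x \<omega> \<noteq> \<infinity> \<longrightarrow>
      ZJ_left Z (entry_real x \<omega>) \<omega> = y \<longrightarrow> vj y x (entry_real x \<omega>) \<omega> = v x (entry_real x \<omega>) \<omega>"
  shows "finite_variation_process M (natural_filtration M Z) (sojourn_integral Z j (V_state Z v vj j))"
proof -
  define X where "X n t \<omega> = of_bool (entry_time Z (j, n) \<omega> < ereal t) *
    (v (j, n) (exit_real (j, n) t \<omega>) \<omega> - v (j, n) (entry_real (j, n) \<omega>) \<omega>)" for n t \<omega>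
  have AE_eq: "AE \<omega> in M. \<forall>t. sojourn_integral Z j (V_state Z v vj j) t \<omega> =
      (\<Sum>n\<in>{n. entry_time Z (j, n) \<omega> < ereal t}. X n t \<omega>)"
    using entry AE_space
  proof eventually_elim
    case (elim \<omega>)
    interpret jump_path Z \<omega> by (rule path[OF elim(2)])
    show ?case
    proof
      fix t
      have "sojourn_integral Z j (V_state Z v vj j) t \<omega> = (\<Sum>n\<in>{n. entry_time Z (j, n) \<omega> < ereal t}.
          v (j, n) (exit_real (j, n) t \<omega>) \<omega> - v (j, n) (entry_real (j, n) \<omega>) \<omega>)"
        by (rule sojourn_integral_V_state) (use elim(1) in blast)
      also have "\<dots> = (\<Sum>n\<in>{n. entry_time Z (j, n) \<omega> < ereal t}. X n t \<omega>)"
        by (intro sum.cong) (auto simp: X_def)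
      finally show "sojourn_integral Z j (V_state Z v vj j) t \<omega> =
          (\<Sum>n\<in>{n. entry_time Z (j, n) \<omega> < ereal t}. X n t \<omega>)" .
    qed
  qed
  have "sojourn_integral Z j (V_state Z v vj j) t \<in> borel_measurable (natural_filtration M Z t)" if t: "0 \<le> t" for t
  proof (rule measurable_AE_eq[OF complete subalgebra_natural_filtration null_sets_natural_filtration])
    let ?F = "natural_filtration M Z t"
    have "X n t \<in> borel_measurable ?F" for n
    proof -
      let ?D = "entry_before (j, n) t"
      have "(\<lambda>\<omega>. indicator ?D \<omega> * v (j, n) (exit_real (j, n) t \<omega>) \<omega>) \<in> borel_measurable ?F"
      proof (rule state_reserve_adapted[OF v exit_real_adapted[OF t]])
        fix \<omega> assume D: "\<omega> \<in> ?D"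
        then interpret jump_path Z \<omega> by (intro path) simp
        have e: "entry_time Z (j, n) \<omega> < ereal t" using D by simp
        show "0 \<le> exit_real (j, n) t \<omega>"
          using ZJ_left_sojourn_eq(2,3)[OF e] by linarith
      qed
      moreover have "(\<lambda>\<omega>. indicator ?D \<omega> * v (j, n) (entry_real (j, n) \<omega>) \<omega>) \<in> borel_measurable ?F"
        by (rule state_reserve_adapted[OF v entry_real_adapted]) (rule entry_before_real(2))
      ultimately have "(\<lambda>\<omega>. indicator ?D \<omega> * v (j, n) (exit_real (j, n) t \<omega>) \<omega> -
          indicator ?D \<omega> * v (j, n) (entry_real (j, n) \<omega>) \<omega>) \<in> borel_measurable ?F"
        by (rule borel_measurable_diff)
      moreover have "indicator ?D \<omega> * v (j, n) (exit_real (j, n) t \<omega>) \<omega> -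
          indicator ?D \<omega> * v (j, n) (entry_real (j, n) \<omega>) \<omega> = X n t \<omega>" if "\<omega> \<in> space ?F" for \<omega>
        using that by (auto simp: X_def space_natural_filtration)
      ultimately show ?thesis by (simp cong: measurable_cong)
    qed
    then show "(\<lambda>\<omega>. \<Sum>n. X n t \<omega>) \<in> borel_measurable ?F" by (rule borel_measurable_suminf)
    show "AE \<omega> in M. (\<Sum>n. X n t \<omega>) = sojourn_integral Z j (V_state Z v vj j) t \<omega>"
      using AE_eq AE_space
    proof eventually_elim
      case (elim \<omega>)
      interpret jump_path Z \<omega> by (rule path[OF elim(2)])
      have "(\<Sum>n. X n t \<omega>) = (\<Sum>n\<in>{n. entry_time Z (j, n) \<omega> < ereal t}. X n t \<omega>)"
        by (rule suminf_finite[OF finite_visited]) (simp add: X_def)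
      then show ?case using elim(1) by simp
    qed
  qed simp
  moreover have "AE \<omega> in M. cadlag_fv (\<lambda>t. sojourn_integral Z j (V_state Z v vj j) t \<omega>)"
  proof -
    have "AE \<omega> in M. \<forall>n. cadlag_fv (\<lambda>t. X n t \<omega>)"
      unfolding AE_all_countable X_def by (intro allI state_reserve_contribution_cadlag_fv v)
    then show ?thesis
      using AE_eq AE_space
    proof eventually_elim
      case (elim \<omega>)
      interpret jump_path Z \<omega> by (rule path[OF elim(3)])
      show ?case
      proof (rule cadlag_fv_local)
        fix R :: real assume "0 \<le> R"
        have "sojourn_integral Z j (V_state Z v vj j) t \<omega> = (\<Sum>n\<le>exits Z j R \<omega>. X n t \<omega>)" if "t \<in> {0..R}" for t
        proof -
          have "(\<Sum>n\<in>{n. entry_time Z (j, n) \<omega> < ereal t}. X n t \<omega>) = (\<Sum>n\<le>exits Z j R \<omega>. X n t \<omega>)"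
          proof (rule sum.mono_neutral_left)
            have "n \<le> exits Z j R \<omega>" if "entry_time Z (j, n) \<omega> < ereal t" for n
              using visited_le_exits[OF that] exits_mono[of t R j] \<open>t \<in> {0..R}\<close> by simp
            then show "{n. entry_time Z (j, n) \<omega> < ereal t} \<subseteq> {..exits Z j R \<omega>}" by auto
          qed (auto simp: X_def)
          then show ?thesis using elim(2) by simp
        qed
        moreover have "cadlag_fv (\<lambda>t. \<Sum>n\<le>exits Z j R \<omega>. X n t \<omega>)"
          using elim(1) by (intro cadlag_fv_sum) blast
        ultimately show "\<exists>F. cadlag_fv F \<and> (\<forall>t\<in>{0..R}. sojourn_integral Z j (V_state Z v vj j) t \<omega> = F t)"
          by (intro exI[of _ "\<lambda>t. \<Sum>n\<le>exits Z j R \<omega>. X n t \<omega>"]) blast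
      qed
    qed
  qed
  ultimately show ?thesis
    unfolding finite_variation_process_def cadlag_fv_def by blast
qed

end

theorem theorem5p9:
  fixes M :: "'a measure"
    and Z :: "real \<Rightarrow> 'a \<Rightarrow> 's::{countable,discrete_topology}"
    and b :: "'s \<Rightarrow> real \<Rightarrow> 'a \<Rightarrow> real"
    and bb :: "'s \<Rightarrow> 's \<Rightarrow> real \<Rightarrow> 'a \<Rightarrow> real"
    and \<tau> :: "nat \<Rightarrow> real"
    and \<kappa> :: "real \<Rightarrow> real"
    and Y V :: "real \<Rightarrow> 'a \<Rightarrow> real"
    and v vs :: "'s \<times> nat \<Rightarrow> real \<Rightarrow> 'a \<Rightarrow> real"
    and vj :: "'s \<times> nat \<Rightarrow> 's \<times> nat \<Rightarrow> real \<Rightarrow> 'a \<Rightarrow> real"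
  assumes "prob_space M" and "complete_measure M"
    and "pure_jump_process M Z"
    and "\<forall>t\<ge>0. (\<integral>\<^sup>+\<omega>. (\<Sum>\<^sub>\<infinity>(j, k)\<in>{(j, k). j \<noteq> k}. of_nat (jump_count Z j k t \<omega>)) \<partial>M) < \<infinity>"
    \<comment> \<open>payments and discounting\<close>
    and "\<forall>j. predictable_bounded M (natural_filtration M Z) (b j)"
    and "\<forall>j k. j \<noteq> k \<longrightarrow> predictable_bounded M (natural_filtration M Z) (bb j k)"
    and "0 \<le> \<tau> 0" and "strict_mono \<tau>" and "filterlim \<tau> at_top sequentially"
    and "\<kappa> \<in> borel_measurable (restrict_space borel {0..})" and "cadlag \<kappa>"
    and "finite_variation_on_compacts \<kappa>" and "\<exists>c>0. \<forall>t\<ge>0. c \<le> \<kappa> t" and "\<kappa> 0 = 1"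
    and "AE \<omega> in M. \<forall>t\<ge>0. payments_convergent Z \<tau> \<kappa> b bb t \<omega>"
    and "Y = future_payments Z \<tau> \<kappa> b bb"
    and "\<forall>t\<ge>0. integrable M (Y t)"
    and "\<forall>t\<ge>0. (\<integral>\<^sup>+\<omega>. variation (\<lambda>s. Y s \<omega>) 0 t \<partial>M) < \<infinity>"
    \<comment> \<open>full information\<close>
    and "\<forall>t\<ge>0. sets (natural_filtration M Z t) = sets (info_family M Z (full_info Z) t)"
    and "prospective_reserve M (info_family M Z (full_info Z)) Y V"
    \<comment> \<open>state-wise quantities\<close>
    and "\<forall>x. is_state_reserve M Z (full_info Z) Y x (v x)"
    and "\<forall>x. is_stay_reserve M Z (full_info Z) Y x (vs x)"
    and "\<forall>x y. x \<noteq> y \<longrightarrow> is_jump_reserve M Z (full_info Z) Y x y (vj x y)"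
  shows "statewise_prospective_reserves M Z (full_info Z) V (V_state Z v vj) \<and>
    (AE \<omega> in M. \<forall>j. \<forall>t>0.
       V_state Z v vj j t \<omega> =
         of_bool (Z_left Z t \<omega> = j) * V_stay Z vs j t \<omega> +
         (\<Sum>\<^sub>\<infinity>k\<in>-{j}. of_bool (Z_left Z t \<omega> = k) * V_jump Z vj k j t \<omega>))"
proof -
  interpret jump_payments M Z Y
  proof (intro jump_payments.intro jump_process.intro jump_process_axioms.intro jump_payments_axioms.intro)
    show "AE \<omega> in M. \<forall>t\<ge>0. continuous (at_right t) (\<lambda>t. Y t \<omega>)"
      using assms(15)
    proof eventually_elim
      case (elim \<omega>)
      then show ?case
        unfolding assms(16) using right_continuous_future_payments[OF elim assms(11,14)] by blast
    qed
  qed (use assms(1-3,17,18) in blast)+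
  have FG: "sets (natural_filtration M Z t) = sets (info_family M Z (full_info Z) t)" if "0 \<le> t" for t
    using assms(19) that by blast
  have v: "is_state_reserve M Z (full_info Z) Y x (v x)" for x using assms(21) by blast
  have entry: "AE \<omega> in M. \<forall>x y. y \<noteq> x \<longrightarrow> entry_time Z x \<omega> \<noteq> \<infinity> \<longrightarrow>
      ZJ_left Z (entry_real x \<omega>) \<omega> = y \<longrightarrow> vj y x (entry_real x \<omega>) \<omega> = v x (entry_real x \<omega>) \<omega>"
    unfolding AE_all_countable
  proof (intro allI)
    fix x y
    show "AE \<omega> in M. y \<noteq> x \<longrightarrow> entry_time Z x \<omega> \<noteq> \<infinity> \<longrightarrow>
      ZJ_left Z (entry_real x \<omega>) \<omega> = y \<longrightarrow> vj y x (entry_real x \<omega>) \<omega> = v x (entry_real x \<omega>) \<omega>"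
    proof (cases "y = x")
      case False
      then have "is_jump_reserve M Z (full_info Z) Y y x (vj y x)" using assms(23) by blast
      from reserve_at_entry[OF FG False v this] show ?thesis using False by simp
    qed simp
  qed
  have "statewise_prospective_reserves M Z (full_info Z) V (V_state Z v vj)"
    unfolding statewise_prospective_reserves_def
  proof (intro allI conjI impI)
    show "AE \<omega> in M. of_bool (Z t \<omega> = j) * V_state Z v vj j t \<omega> = of_bool (Z t \<omega> = j) * V t \<omega>"
      if "0 \<le> t" for j t
      by (rule V_state_eq_reserve[where v = v and vj = vj, OF _ assms(20) v entry that]) (rule FG)
    show "(\<lambda>\<omega>. of_bool (Z_left Z t \<omega> = j) * V_state Z v vj j t \<omega>)
        \<in> borel_measurable (info_family_left M Z (full_info Z) t)" if "0 < t" for j t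
      using v that by (rule V_state_left_measurable)
    show "finite_variation_process M (natural_filtration M Z) (sojourn_integral Z j (V_state Z v vj j))" for j
      using v entry by (rule sojourn_integral_finite_variation_process)
  qed
  moreover have "AE \<omega> in M. \<forall>x. \<forall>t>0. ZJ_left Z t \<omega> = x \<longrightarrow> v x t \<omega> = vs x t \<omega>"
    unfolding AE_all_countable using stay_reserve_eq[OF v] assms(22) by blast
  then have "AE \<omega> in M. \<forall>j. \<forall>t>0. V_state Z v vj j t \<omega> =
      of_bool (Z_left Z t \<omega> = j) * V_stay Z vs j t \<omega> +
      (\<Sum>\<^sub>\<infinity>k\<in>-{j}. of_bool (Z_left Z t \<omega> = k) * V_jump Z vj k j t \<omega>)"
    using AE_space
  proof eventually_elim
    case (elim \<omega>)
    interpret jump_path Z \<omega> by (rule path[OF elim(2)])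
    show ?case using elim(1) by (intro allI impI V_state_decomposition) blast+
  qed
  ultimately show ?thesis by blast
qed

end
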